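(* A non-rotational spectral genus one constant mean curvature (cmc) torus in $\mathbb{S}^3$ is never embedded.
   Context: Let $q\in\mathbb{R}$ with $0<|q|<1$ and let $\lambda_j=e^{2i\theta_j}$ ($j=1,2$) be two distinct points of $\mathbb{S}^1$. Put $\varphi=\theta_1-\theta_2$ and $v=\mathrm{dn}(y,1-q^2)$ (Jacobi function with parameter $1-q^2$, i.e. $(v')^2+(v^2-1)(v^2-q^2)=0$, $v(0)=1$, non-constant). The associated equivariant cmc surface is the immersion $f:\mathbb{R}^2\to\mathbb{S}^3$, unique up to isometry, with induced metric $\sin^2\varphi\,v^2(dx^2+dy^2)$ and second fundamental form $H\sin^2\varphi\,v^2(dx^2+dy^2)+\mathrm{Re}\left(Q\,(dx+i\,dy)^2\right)$, where $H=\cot\varphi$ is the mean curvature and $Q=\frac{i}{2}q(\lambda_2^{-1}-\lambda_1^{-1})$. A spectral genus one cmc torus in $\mathbb{S}^3$ is such an immersion which factors through $\mathbb{R}^2/\Gamma$ for a lattice $\Gamma$. The surface is equivariant: translation in $x$ induces a one-parameter group of isometries of $\mathbb{S}^3$. It is rotational if this group fixes a geodesic of $\mathbb{S}^3$ point-wise (equivalently $\lambda_2=\lambda_1^{-1}$), and non-rotational otherwise. *)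

theory Defs
  imports "HOL-Analysis.Analysis"
begin

section \<open>The Jacobi function dn\<close>

definition elliptic_F :: "real \<Rightarrow> real \<Rightarrow> real" where
  "elliptic_F m \<phi> = (LBINT t=0..\<phi>. 1 / sqrt (1 - m * (sin t)\<^sup>2))"

definition jacobi_am :: "real \<Rightarrow> real \<Rightarrow> real" where
  "jacobi_am m = inv (elliptic_F m)"

text \<open>The second argument is the parameter \<open>m\<close> (the square of the modulus); the definition is
  meant for \<open>0 \<le> m < 1\<close>, where \<open>elliptic_F m\<close> is a bijection of the real line.\<close>

definition jacobi_dn :: "real \<Rightarrow> real \<Rightarrow> real" where
  "jacobi_dn u m = sqrt (1 - m * (sin (jacobi_am m u))\<^sup>2)"

context
  fixes m :: real
  assumes m: "0 \<le> m" "m < 1"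
begin

lemma elliptic_integrand_pos: "0 < 1 - m * (sin t)\<^sup>2"
proof -
  have "m * (sin t)\<^sup>2 \<le> m * 1"
    using m by (intro mult_left_mono) (auto simp: abs_square_le_1)
  with m show ?thesis by simp
qed

lemma elliptic_F_has_derivative:
  "(elliptic_F m has_real_derivative 1 / sqrt (1 - m * (sin x)\<^sup>2)) (at x)"
proof -
  define a b where "a = - \<bar>x\<bar> - 1" and "b = \<bar>x\<bar> + 1"
  have ab: "a < x" "x < b" "a \<le> 0" "0 \<le> b" by (auto simp: a_def b_def)
  have "continuous_on {a..b} (\<lambda>t. 1 / sqrt (1 - m * (sin t)\<^sup>2))"
    using elliptic_integrand_pos by (intro continuous_intros) (auto simp: less_imp_neq[symmetric])
  from interval_integral_FTC2[OF ab(3,4) this, of x]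
  have "((\<lambda>u. LBINT t=0..u. 1 / sqrt (1 - m * (sin t)\<^sup>2)) has_vector_derivative
     1 / sqrt (1 - m * (sin x)\<^sup>2)) (at x within {a..b})"
    using ab by (simp flip: zero_ereal_def)
  then show ?thesis
    unfolding elliptic_F_def[abs_def]
    using ab by (simp add: has_real_derivative_iff_has_vector_derivative at_within_Icc_at)
qed

lemma elliptic_F_mono: "x \<le> y \<Longrightarrow> y - x \<le> elliptic_F m y - elliptic_F m x"
proof -
  assume xy: "x \<le> y"
  have "elliptic_F m x - x \<le> elliptic_F m y - y"
  proof (rule DERIV_nonneg_imp_nondecreasing[OF xy])
    fix z
    have "sqrt (1 - m * (sin z)\<^sup>2) \<le> 1" using m by simp
    then have "1 / sqrt (1 - m * (sin z)\<^sup>2) - 1 \<ge> 0"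
      using elliptic_integrand_pos[of z] by simp
    then show "\<exists>d. ((\<lambda>x. elliptic_F m x - x) has_real_derivative d) (at z) \<and> 0 \<le> d"
      using DERIV_diff[OF elliptic_F_has_derivative[of z] DERIV_ident] by blast
  qed
  then show ?thesis by simp
qed

lemma isCont_elliptic_F: "isCont (elliptic_F m) x"
  using elliptic_F_has_derivative DERIV_isCont by blast

lemma elliptic_F_0: "elliptic_F m 0 = 0"
  by (simp add: elliptic_F_def flip: zero_ereal_def)

lemma bij_elliptic_F: "bij (elliptic_F m)"
proof (rule bijI)
  show "inj (elliptic_F m)"
  proof (rule injI)
    fix x y assume "elliptic_F m x = elliptic_F m y"
    then show "x = y" using elliptic_F_mono[of x y] elliptic_F_mono[of y x] by linarith
  qed
  show "surj (elliptic_F m)"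
  proof -
    have "\<exists>x. elliptic_F m x = u" for u
    proof -
      have "\<exists>x. - \<bar>u\<bar> \<le> x \<and> x \<le> \<bar>u\<bar> \<and> elliptic_F m x = u"
        using elliptic_F_mono[of "- \<bar>u\<bar>" 0] elliptic_F_mono[of 0 "\<bar>u\<bar>"] elliptic_F_0
        by (intro IVT) (auto simp: isCont_elliptic_F)
      then show ?thesis by blast
    qed
    then show ?thesis by (metis surjI)
  qed
qed

lemma jacobi_am_has_derivative: "(jacobi_am m has_real_derivative jacobi_dn u m) (at u)"
proof -
  have F_am: "elliptic_F m (jacobi_am m y) = y" for y
    using bij_elliptic_F by (simp add: jacobi_am_def bij_is_surj surj_f_inv_f)
  have am_F: "jacobi_am m (elliptic_F m y) = y" for y
    using bij_elliptic_F by (simp add: jacobi_am_def bij_is_inj)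
  have "isCont (jacobi_am m) (elliptic_F m (jacobi_am m u))"
    by (rule isCont_inverse_function[of 1]) (auto simp: am_F isCont_elliptic_F)
  then have cont: "isCont (jacobi_am m) u" by (simp add: F_am)
  have "1 / sqrt (1 - m * (sin (jacobi_am m u))\<^sup>2) \<noteq> 0"
    using elliptic_integrand_pos[of "jacobi_am m u"] by simp
  from DERIV_inverse_function[where a = "u - 1" and b = "u + 1",
      OF elliptic_F_has_derivative this _ _ F_am cont]
  have "DERIV (jacobi_am m) u :> inverse (1 / sqrt (1 - m * (sin (jacobi_am m u))\<^sup>2))"
    by simp
  then show ?thesis by (simp add: jacobi_dn_def)
qed

lemma jacobi_dn_0: "jacobi_dn 0 m = 1"
proof -
  have "jacobi_am m 0 = 0"
    using bij_elliptic_F by (metis elliptic_F_0 bij_is_inj inv_f_f jacobi_am_def)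
  then show ?thesis by (simp add: jacobi_dn_def)
qed

lemma jacobi_dn_has_derivative:
  "((\<lambda>u. jacobi_dn u m) has_real_derivative
      - m * sin (jacobi_am m u) * cos (jacobi_am m u)) (at u)"
proof -
  have p: "0 < 1 - m * (sin (jacobi_am m u))\<^sup>2" by (rule elliptic_integrand_pos)
  have d: "jacobi_dn u m > 0" using p by (simp add: jacobi_dn_def)
  have "((\<lambda>u. 1 - m * (sin (jacobi_am m u))\<^sup>2) has_real_derivative
      - (m * (2 * sin (jacobi_am m u) * (cos (jacobi_am m u) * jacobi_dn u m)))) (at u)"
    by (rule derivative_eq_intros jacobi_am_has_derivative refl | simp)+
  from DERIV_chain2[OF DERIV_real_sqrt[OF p] this] show ?thesis
    unfolding jacobi_dn_def[abs_def, symmetric] jacobi_dn_def[symmetric]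
    using d by (simp add: field_simps)
qed

lemma jacobi_dn_ode:
  fixes q :: real
  assumes "m = 1 - q\<^sup>2"
  shows "(deriv (\<lambda>u. jacobi_dn u m) u)\<^sup>2 + ((jacobi_dn u m)\<^sup>2 - 1) * ((jacobi_dn u m)\<^sup>2 - q\<^sup>2) = 0"
proof -
  define s where "s = sin (jacobi_am m u)"
  have d2: "(jacobi_dn u m)\<^sup>2 = 1 - m * s\<^sup>2"
    using elliptic_integrand_pos[of "jacobi_am m u"] by (simp add: jacobi_dn_def s_def)
  have c2: "(cos (jacobi_am m u))\<^sup>2 = 1 - s\<^sup>2"
    by (simp add: cos_squared_eq s_def)
  have q2: "q\<^sup>2 = 1 - m" using assms by simp
  have "(deriv (\<lambda>u. jacobi_dn u m) u)\<^sup>2 = m\<^sup>2 * s\<^sup>2 * (1 - s\<^sup>2)"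
    by (simp add: DERIV_imp_deriv[OF jacobi_dn_has_derivative] power_mult_distrib c2 s_def[symmetric])
  then show ?thesis unfolding d2 q2 by (simp add: algebra_simps power2_eq_square)
qed

lemma jacobi_dn_nonconstant: "0 < m \<Longrightarrow> \<exists>u. jacobi_dn u m \<noteq> 1"
proof -
  assume "0 < m"
  have "jacobi_am m (elliptic_F m (pi/2)) = pi/2"
    using bij_elliptic_F by (simp add: jacobi_am_def bij_is_inj)
  then have "jacobi_dn (elliptic_F m (pi/2)) m = sqrt (1 - m)"
    unfolding jacobi_dn_def \<open>jacobi_am m _ = _\<close> by simp
  also have "\<dots> \<noteq> 1" using \<open>0 < m\<close> by simp
  finally show ?thesis by blast
qed

end


section \<open>Smooth maps and immersed surfaces in the 3-sphere\<close>

text \<open>The 3-sphere is \<open>sphere 0 1\<close> in \<open>real^4\<close>, and the parameter plane is \<open>real \<times> real\<close> with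
  coordinates \<open>(x, y)\<close>.\<close>

primrec C_k :: "nat \<Rightarrow> ('a::euclidean_space \<Rightarrow> 'b::real_normed_vector) \<Rightarrow> bool" where
  "C_k 0 f \<longleftrightarrow> continuous_on UNIV f"
| "C_k (Suc k) f \<longleftrightarrow> (\<forall>p. f differentiable at p) \<and>
     (\<forall>b\<in>Basis. C_k k (\<lambda>p. frechet_derivative f (at p) b))"

definition smooth_map :: "('a::euclidean_space \<Rightarrow> 'b::real_normed_vector) \<Rightarrow> bool" where
  "smooth_map f \<longleftrightarrow> (\<forall>k. C_k k f)"

definition immersion_S3 :: "(real \<times> real \<Rightarrow> real^4) \<Rightarrow> bool" where
  "immersion_S3 f \<longleftrightarrow> smooth_map f \<and> range f \<subseteq> sphere 0 1 \<and>
     (\<forall>p. inj (frechet_derivative f (at p)))"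

definition unit_normal_S3 :: "(real \<times> real \<Rightarrow> real^4) \<Rightarrow> (real \<times> real \<Rightarrow> real^4) \<Rightarrow> bool" where
  "unit_normal_S3 f N \<longleftrightarrow> smooth_map N \<and>
     (\<forall>p. norm (N p) = 1 \<and> N p \<bullet> f p = 0 \<and> (\<forall>X. N p \<bullet> frechet_derivative f (at p) X = 0))"

text \<open>Both fundamental forms are given as quadratic forms. As \<open>N\<close> is tangent to the sphere, the
  normal component of the covariant second derivative in the sphere is the \<open>N\<close>-component of the
  second derivative in \<open>real^4\<close>.\<close>

definition first_form :: "(real \<times> real \<Rightarrow> real^4) \<Rightarrow> real \<times> real \<Rightarrow> real \<times> real \<Rightarrow> real" where
  "first_form f p X = frechet_derivative f (at p) X \<bullet> frechet_derivative f (at p) X"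

definition second_form ::
  "(real \<times> real \<Rightarrow> real^4) \<Rightarrow> (real \<times> real \<Rightarrow> real^4) \<Rightarrow> real \<times> real \<Rightarrow> real \<times> real \<Rightarrow> real" where
  "second_form f N p X =
     frechet_derivative (\<lambda>p'. frechet_derivative f (at p') X) (at p) X \<bullet> N p"


section \<open>Spectral genus one surfaces\<close>

definition hopf_Q :: "real \<Rightarrow> complex \<Rightarrow> complex \<Rightarrow> complex" where
  "hopf_Q q l\<^sub>1 l\<^sub>2 = \<i> / 2 * of_real q * (inverse l\<^sub>2 - inverse l\<^sub>1)"

text \<open>In the predicate below, \<open>(dx, dy)\<close> is a tangent vector at \<open>(x, y)\<close>, the coefficient \<open>cot \<phi>\<close> is
  the mean curvature, and the unit normal \<open>N\<close> may be chosen freely.\<close>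

definition equivariant_cmc_surface ::
  "real \<Rightarrow> real \<Rightarrow> real \<Rightarrow> (real \<times> real \<Rightarrow> real^4) \<Rightarrow> bool" where
  "equivariant_cmc_surface q \<theta>1 \<theta>2 f \<longleftrightarrow>
     (let \<phi> = \<theta>1 - \<theta>2;
          Q = hopf_Q q (cis (2 * \<theta>1)) (cis (2 * \<theta>2));
          v = (\<lambda>y. jacobi_dn y (1 - q\<^sup>2))
      in immersion_S3 f \<and>
         (\<exists>N. unit_normal_S3 f N \<and>
           (\<forall>x y dx dy.
              first_form f (x, y) (dx, dy) = (sin \<phi>)\<^sup>2 * (v y)\<^sup>2 * (dx\<^sup>2 + dy\<^sup>2) \<and>
              second_form f N (x, y) (dx, dy) =
                cot \<phi> * (sin \<phi>)\<^sup>2 * (v y)\<^sup>2 * (dx\<^sup>2 + dy\<^sup>2) + Re (Q * (Complex dx dy)\<^sup>2))))"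


section \<open>Equivariance and rotational surfaces\<close>

text \<open>Isometries of the 3-sphere are the restrictions of orthogonal transformations, and its
  geodesics are its intersections with the two-dimensional linear subspaces.\<close>

definition one_param_isometry_group :: "(real \<Rightarrow> real^4 \<Rightarrow> real^4) \<Rightarrow> bool" where
  "one_param_isometry_group A \<longleftrightarrow> (\<forall>t. orthogonal_transformation (A t)) \<and>
     (\<forall>s t. A (s + t) = A s \<circ> A t) \<and> (\<forall>z. continuous_on UNIV (\<lambda>t. A t z))"

definition x_translation_group ::
  "(real \<times> real \<Rightarrow> real^4) \<Rightarrow> (real \<Rightarrow> real^4 \<Rightarrow> real^4) \<Rightarrow> bool" where
  "x_translation_group f A \<longleftrightarrow> one_param_isometry_group A \<and>
     (\<forall>t x y. f (x + t, y) = A t (f (x, y)))"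

definition geodesic_S3 :: "(real^4) set \<Rightarrow> bool" where
  "geodesic_S3 G \<longleftrightarrow> (\<exists>P. subspace P \<and> dim P = 2 \<and> G = P \<inter> sphere 0 1)"

definition rotational :: "(real \<times> real \<Rightarrow> real^4) \<Rightarrow> bool" where
  "rotational f \<longleftrightarrow> (\<exists>A. x_translation_group f A \<and>
     (\<exists>G. geodesic_S3 G \<and> (\<forall>t. \<forall>z\<in>G. A t z = z)))"


section \<open>The quotient torus\<close>

text \<open>\<open>torus \<Gamma>\<close> carries the quotient topology. The map that an immersion of the plane induces on
  the torus is again an immersion, so it is embedded iff it is a topological embedding.\<close>

definition plane_lattice :: "(real \<times> real) set \<Rightarrow> bool" where
  "plane_lattice \<Gamma> \<longleftrightarrow> (\<exists>a b. a \<noteq> b \<and> independent {a, b} \<and>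
     \<Gamma> = {of_int m *\<^sub>R a + of_int n *\<^sub>R b | m n :: int. True})"

definition plane_coset :: "(real \<times> real) set \<Rightarrow> real \<times> real \<Rightarrow> (real \<times> real) set" where
  "plane_coset \<Gamma> p = (\<lambda>\<gamma>. p + \<gamma>) ` \<Gamma>"

definition torus :: "(real \<times> real) set \<Rightarrow> (real \<times> real) set topology" where
  "torus \<Gamma> = topology (\<lambda>U. U \<subseteq> range (plane_coset \<Gamma>) \<and> open (plane_coset \<Gamma> -` U))"

lemma openin_torus:
  "openin (torus \<Gamma>) U \<longleftrightarrow> U \<subseteq> range (plane_coset \<Gamma>) \<and> open (plane_coset \<Gamma> -` U)"
proof -
  have "istopology (\<lambda>U. U \<subseteq> range (plane_coset \<Gamma>) \<and> open (plane_coset \<Gamma> -` U))"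
    unfolding istopology_def
  proof (intro conjI allI impI)
    fix \<K> assume K: "\<forall>K\<in>\<K>. K \<subseteq> range (plane_coset \<Gamma>) \<and> open (plane_coset \<Gamma> -` K)"
    show "open (plane_coset \<Gamma> -` \<Union>\<K>)"
      unfolding vimage_Union using K by (intro open_UN) blast
  qed (blast | simp add: open_Int)+
  then show ?thesis by (simp add: torus_def topology_inverse')
qed

lemma topspace_torus: "topspace (torus \<Gamma>) = range (plane_coset \<Gamma>)"
proof
  have "openin (torus \<Gamma>) (range (plane_coset \<Gamma>))"
    unfolding openin_torus by (simp add: vimage_def)
  then show "range (plane_coset \<Gamma>) \<subseteq> topspace (torus \<Gamma>)" by (rule openin_subset)
  show "topspace (torus \<Gamma>) \<subseteq> range (plane_coset \<Gamma>)"
    using openin_topspace[of "torus \<Gamma>"] unfolding openin_torus by blast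
qed

end

theory Submission
  imports Defs
begin

text \<open>Following Andrews and Li, compare the surface with the geodesic balls that touch it at \<open>f p\<close> from the
  side of \<open>N p\<close>. Let \<open>\<mu>\<close> be half the difference of the principal curvatures and orient \<open>N\<close> such that
  \<open>H \<ge> 0\<close>. If the torus is embedded, then for large \<open>\<kappa>\<close> every touching ball of curvature
  \<open>H + \<kappa> * \<mu>\<close> avoids the surface. If \<open>\<kappa> > 1\<close> is the first value at which a ball hits the surface a
  second time, then the maximum principle for the two-point function \<open>Z\<close> gives a contradiction; the
  simple connectivity of the 3-sphere ensures that the second contact is from the same side. Hence the
  balls of curvature equal to the larger principal curvature avoid the surface as well. They touch to
  second order along the corresponding principal direction, so the third derivative along it vanishes,
  which says that the larger principal curvature is constant in this direction. As the metric depends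
  on \<open>y\<close> only, the direction is that of the \<open>x\<close>-axis. This means that the Hopf differential is
  real, and then the surface is rotational.\<close>

section \<open>Preliminaries from analysis and linear algebra\<close>

text \<open>The family \<open>\<kappa> * \<mu>\<close> is forced by an identity: by the equation for
  \<open>v\<close>, every term of the second-order condition for
  \<open>\<Psi> = \<kappa> * \<mu>\<close>, except the one with the factor \<open>H\<close>, is a
  multiple of \<open>(vd y)^2\<close>, and for \<open>\<kappa> > 1\<close> the total multiple is
  negative whatever the principal direction is. The term with \<open>H\<close> has the right sign
  for \<open>H \<ge> 0\<close> and \<open>\<Psi> > \<mu>\<close>, which explains the orientation. A
  contact from the opposite side would let the mean curvature of the second point enter with the
  wrong sign and add a positive term \<open>4 * H * R^2\<close>; this is why the two sides of the
  surface must be told apart. On the diagonal \<open>Z\<close> vanishes identically, so a first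
  contact exists only because the Hessian of \<open>Z\<close> is positive definite there for
  \<open>\<kappa> > 1\<close>. At \<open>\<kappa> = 1\<close> it degenerates, and that case is
  reached only as a limit. All maps live on the plane; compactness comes from the periods and a
  compact set that meets every orbit.\<close>

lemma nonneg_zero_second_derivative:
  fixes \<phi> \<phi>' :: "real \<Rightarrow> real"
  assumes d1: "\<And>t. (\<phi> has_real_derivative \<phi>' t) (at t)"
    and d2: "(\<phi>' has_real_derivative c) (at 0)"
    and nonneg: "\<And>t. 0 \<le> \<phi> t" and zero: "\<phi> 0 = 0"
  shows "\<phi>' 0 = 0" "0 \<le> c"
proof -
  show z: "\<phi>' 0 = 0"
    by (rule DERIV_local_min[OF d1, of 1]) (auto simp: zero nonneg)
  show "0 \<le> c"
  proof (rule ccontr)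
    assume "\<not> 0 \<le> c"
    then obtain d where d: "d > 0" "\<And>h. 0 < h \<Longrightarrow> h < d \<Longrightarrow> \<phi>' (0 + h) < \<phi>' 0"
      using DERIV_neg_dec_right[OF d2] by auto
    have "\<exists>z>0. z < d/2 \<and> \<phi> (d/2) - \<phi> 0 = (d/2 - 0) * \<phi>' z"
      using d by (intro MVT2 d1) auto
    then obtain z where z: "0 < z" "z < d/2" "\<phi> (d/2) = d/2 * \<phi>' z"
      using zero by auto
    have "\<phi>' z < 0" using d(2)[of z] z d(1) \<open>\<phi>' 0 = 0\<close> by auto
    then have "d/2 * \<phi>' z < 0" using d(1) by (intro mult_pos_neg) auto
    then have "\<phi> (d/2) < 0" using z(3) by simp
    then show False using nonneg[of "d/2"] by simp
  qed
qed

text \<open>If \<open>c < 0\<close>, then the second derivative, the first derivative and the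
  function itself are successively negative immediately to the right of 0.\<close>

lemma nonneg_third_derivative_right:
  fixes \<phi> \<phi>' \<phi>'' :: "real \<Rightarrow> real"
  assumes d1: "\<And>t. (\<phi> has_real_derivative \<phi>' t) (at t)"
    and d2: "\<And>t. (\<phi>' has_real_derivative \<phi>'' t) (at t)"
    and d3: "(\<phi>'' has_real_derivative c) (at 0)"
    and nonneg: "\<And>t. 0 \<le> \<phi> t" and zero: "\<phi> 0 = 0" "\<phi>' 0 = 0" "\<phi>'' 0 = 0"
  shows "0 \<le> c"
proof (rule ccontr)
  assume "\<not> 0 \<le> c"
  then obtain d where d: "d > 0" "\<And>h. 0 < h \<Longrightarrow> h < d \<Longrightarrow> \<phi>'' (0 + h) < \<phi>'' 0"
    using DERIV_neg_dec_right[OF d3] by auto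
  have neg: "\<phi>' t < 0" if "0 < t" "t < d" for t
  proof -
    have "\<exists>z>0. z < t \<and> \<phi>' t - \<phi>' 0 = (t - 0) * \<phi>'' z"
      using that by (intro MVT2 d2) auto
    then obtain z where "0 < z" "z < t" "\<phi>' t = t * \<phi>'' z"
      using zero by auto
    then show ?thesis using d(2)[of z] that zero by (simp add: mult_pos_neg)
  qed
  have "\<exists>z>0. z < d/2 \<and> \<phi> (d/2) - \<phi> 0 = (d/2 - 0) * \<phi>' z"
    using d by (intro MVT2 d1) auto
  then obtain z where z: "0 < z" "z < d/2" "\<phi> (d/2) = d/2 * \<phi>' z"
    using zero by auto
  have "d/2 * \<phi>' z < 0" using neg[of z] z d(1) by (intro mult_pos_neg) auto
  then have "\<phi> (d/2) < 0" using z(3) by simp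
  then show False using nonneg[of "d/2"] by simp
qed

text \<open>The reflection \<open>t \<mapsto> - t\<close> preserves the hypotheses and changes the
  sign of the third derivative, so the one-sided bound holds for \<open>c\<close> and for
  \<open>- c\<close>.\<close>

lemma nonneg_third_derivative:
  fixes \<phi> \<phi>' \<phi>'' :: "real \<Rightarrow> real"
  assumes d1: "\<And>t. (\<phi> has_real_derivative \<phi>' t) (at t)"
    and d2: "\<And>t. (\<phi>' has_real_derivative \<phi>'' t) (at t)"
    and d3: "(\<phi>'' has_real_derivative c) (at 0)"
    and nonneg: "\<And>t. 0 \<le> \<phi> t" and zero: "\<phi> 0 = 0" "\<phi>' 0 = 0" "\<phi>'' 0 = 0"
  shows "c = 0"
proof -
  have 1: "0 \<le> c" by (rule nonneg_third_derivative_right[OF assms])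
  have m: "((\<lambda>t. g (- t)) has_real_derivative - g') (at t)"
    if "(g has_real_derivative g') (at (- t))" for g :: "real \<Rightarrow> real" and g' t
    using DERIV_chain'[OF DERIV_minus[OF DERIV_ident] that] by simp
  have d1': "((\<lambda>t. \<phi> (- t)) has_real_derivative - \<phi>' (- t)) (at t)" for t by (rule m[OF d1])
  have d2': "((\<lambda>t. - \<phi>' (- t)) has_real_derivative \<phi>'' (- t)) (at t)" for t
    using DERIV_minus[OF m[OF d2]] by simp
  have d3': "((\<lambda>t. \<phi>'' (- t)) has_real_derivative - c) (at 0)" using m[of \<phi>'' c 0] d3 by simp
  have "0 \<le> - c"
    by (rule nonneg_third_derivative_right[OF d1' d2' d3']) (use nonneg zero in auto)
  with 1 show ?thesis by simp
qed

section \<open>Derivatives along lines and symmetry of second derivatives\<close>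

lemma has_vector_derivative_along_line:
  assumes "(f has_derivative f') (at (p + t *\<^sub>R a))"
  shows "((\<lambda>t. f (p + t *\<^sub>R a)) has_vector_derivative f' a) (at t)"
proof -
  have "((\<lambda>t. p + t *\<^sub>R a) has_derivative (\<lambda>h. h *\<^sub>R a)) (at t)"
    by (auto intro!: derivative_eq_intros)
  from has_derivative_compose[OF this assms] show ?thesis
    unfolding has_vector_derivative_def
    using linear_cmul[OF has_derivative_linear[OF assms]] by simp
qed

lemma has_real_derivative_inner:
  assumes "(f has_vector_derivative f') (at t)" "(g has_vector_derivative g') (at t)"
  shows "((\<lambda>t. f t \<bullet> g t) has_real_derivative f t \<bullet> g' + f' \<bullet> g t) (at t)"
  unfolding has_real_derivative_iff_has_vector_derivative
  by (rule bounded_bilinear.has_vector_derivative[OF bounded_bilinear_inner assms])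

text \<open>The second difference over a small parallelogram is symmetric in \<open>u\<close> and
  \<open>w\<close>, and two applications of the mean value theorem express it by either mixed
  derivative at a point near \<open>p\<close>.\<close>

lemma second_derivative_symmetric_real:
  fixes f :: "'a::real_normed_vector \<Rightarrow> real"
  assumes f: "\<And>x. (f has_derivative D x) (at x)"
    and Du: "\<And>x. ((\<lambda>x. D x u) has_derivative Du x) (at x)"
    and Dw: "\<And>x. ((\<lambda>x. D x w) has_derivative Dw x) (at x)"
    and contu: "continuous (at p) (\<lambda>x. Du x w)" and contw: "continuous (at p) (\<lambda>x. Dw x u)"
  shows "Du p w = Dw p u"
proof -
  have mix: "\<exists>s t. 0 < s \<and> s < h \<and> 0 < t \<and> t < h \<and>
      f (p + h *\<^sub>R u + h *\<^sub>R w) - f (p + h *\<^sub>R u) - f (p + h *\<^sub>R w) + f p = h * h * Da (p + s *\<^sub>R u + t *\<^sub>R w) w"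
    if h: "0 < h" and Da: "\<And>x. ((\<lambda>x. D x u) has_derivative Da x) (at x)" for h u w Da
  proof -
    define \<phi> where "\<phi> s = f (p + h *\<^sub>R w + s *\<^sub>R u) - f (p + s *\<^sub>R u)" for s
    have "(\<phi> has_real_derivative D (p + h *\<^sub>R w + s *\<^sub>R u) u - D (p + s *\<^sub>R u) u) (at s)" for s
      unfolding \<phi>_def has_real_derivative_iff_has_vector_derivative
      by (intro has_vector_derivative_diff has_vector_derivative_along_line f)
    then have "\<exists>z>0. z < h \<and> \<phi> h - \<phi> 0 = (h - 0) * (D (p + h *\<^sub>R w + z *\<^sub>R u) u - D (p + z *\<^sub>R u) u)"
      using h by (intro MVT2) auto
    then obtain s where s: "0 < s" "s < h"
      "\<phi> h - \<phi> 0 = h * (D (p + h *\<^sub>R w + s *\<^sub>R u) u - D (p + s *\<^sub>R u) u)" by auto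
    have "((\<lambda>t. D (p + s *\<^sub>R u + t *\<^sub>R w) u) has_real_derivative Da (p + s *\<^sub>R u + t *\<^sub>R w) w) (at t)" for t
      unfolding has_real_derivative_iff_has_vector_derivative
      by (intro has_vector_derivative_along_line Da)
    then have "\<exists>z>0. z < h \<and> D (p + s *\<^sub>R u + h *\<^sub>R w) u - D (p + s *\<^sub>R u + 0 *\<^sub>R w) u
        = (h - 0) * Da (p + s *\<^sub>R u + z *\<^sub>R w) w"
      using h by (intro MVT2) auto
    then obtain t where t: "0 < t" "t < h" "D (p + s *\<^sub>R u + h *\<^sub>R w) u - D (p + s *\<^sub>R u) u
        = h * Da (p + s *\<^sub>R u + t *\<^sub>R w) w" by auto
    have "f (p + h *\<^sub>R u + h *\<^sub>R w) - f (p + h *\<^sub>R u) - f (p + h *\<^sub>R w) + f p = \<phi> h - \<phi> 0"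
      by (simp add: \<phi>_def add_ac)
    also have "\<dots> = h * h * Da (p + s *\<^sub>R u + t *\<^sub>R w) w"
      unfolding s(3) using t(3) by (simp add: add_ac)
    finally show ?thesis using s t by blast
  qed
  have "\<bar>Du p w - Dw p u\<bar> \<le> e" if "e > 0" for e
  proof -
    obtain d1 where d1: "d1 > 0" "\<And>x. dist x p < d1 \<Longrightarrow> dist (Du x w) (Du p w) < e/2"
      using contu \<open>e > 0\<close> unfolding continuous_at_eps_delta by (metis half_gt_zero)
    obtain d2 where d2: "d2 > 0" "\<And>x. dist x p < d2 \<Longrightarrow> dist (Dw x u) (Dw p u) < e/2"
      using contw \<open>e > 0\<close> unfolding continuous_at_eps_delta by (metis half_gt_zero)
    define h where "h = min d1 d2 / (norm u + norm w + 1)"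
    have nn: "0 < norm u + norm w + 1" by (simp add: add_nonneg_pos)
    have h: "h > 0" using d1 d2 nn by (simp add: h_def)
    have hb: "h * (norm u + norm w) < min d1 d2"
    proof -
      have "h * (norm u + norm w) < h * (norm u + norm w + 1)" using h by simp
      also have "\<dots> = min d1 d2" using nn by (simp add: h_def)
      finally show ?thesis .
    qed
    have close: "dist (p + s *\<^sub>R u + t *\<^sub>R w) p < min d1 d2" if "0 < s" "s < h" "0 < t" "t < h" for s t
    proof -
      have "dist (p + s *\<^sub>R u + t *\<^sub>R w) p = norm (s *\<^sub>R u + t *\<^sub>R w)" by (simp add: dist_norm)
      also have "\<dots> \<le> s * norm u + t * norm w"
        by (rule order_trans[OF norm_triangle_ineq]) (use that in simp)
      also have "\<dots> \<le> h * norm u + h * norm w"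
        using that by (intro add_mono mult_right_mono) auto
      finally show ?thesis using hb by (simp add: algebra_simps)
    qed
    from mix[OF h Du, of w] obtain s t where st: "0 < s" "s < h" "0 < t" "t < h"
      "f (p + h *\<^sub>R u + h *\<^sub>R w) - f (p + h *\<^sub>R u) - f (p + h *\<^sub>R w) + f p = h * h * Du (p + s *\<^sub>R u + t *\<^sub>R w) w" by blast
    from mix[OF h Dw, of u] obtain s' t' where st': "0 < s'" "s' < h" "0 < t'" "t' < h"
      "f (p + h *\<^sub>R w + h *\<^sub>R u) - f (p + h *\<^sub>R w) - f (p + h *\<^sub>R u) + f p = h * h * Dw (p + s' *\<^sub>R w + t' *\<^sub>R u) u" by blast
    have "h * h * Du (p + s *\<^sub>R u + t *\<^sub>R w) w = h * h * Dw (p + s' *\<^sub>R w + t' *\<^sub>R u) u"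
      unfolding st(5)[symmetric] st'(5)[symmetric] by (simp add: add.commute add.left_commute)
    then have eq: "Du (p + s *\<^sub>R u + t *\<^sub>R w) w = Dw (p + t' *\<^sub>R u + s' *\<^sub>R w) u" using h by (simp add: add_ac)
    have "dist (Du (p + s *\<^sub>R u + t *\<^sub>R w) w) (Du p w) < e/2" using close[OF st(1-4)] d1 by simp
    moreover have "dist (Dw (p + t' *\<^sub>R u + s' *\<^sub>R w) u) (Dw p u) < e/2" using close[OF st'(3,4,1,2)] d2 by simp
    ultimately show ?thesis unfolding eq dist_real_def by linarith
  qed
  then have "\<bar>Du p w - Dw p u\<bar> \<le> 0" by (rule field_le_epsilon[of _ 0, simplified])
  then show ?thesis by simp
qed

lemma second_derivative_symmetric:
  fixes f :: "'a::real_normed_vector \<Rightarrow> 'b::euclidean_space"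
  assumes f: "\<And>x. (f has_derivative D x) (at x)"
    and Du: "\<And>x. ((\<lambda>x. D x u) has_derivative Du x) (at x)"
    and Dw: "\<And>x. ((\<lambda>x. D x w) has_derivative Dw x) (at x)"
    and cont: "continuous (at p) (\<lambda>x. Du x w)" "continuous (at p) (\<lambda>x. Dw x u)"
  shows "Du p w = Dw p u"
proof (rule euclidean_eqI)
  fix b :: 'b assume "b \<in> Basis"
  show "Du p w \<bullet> b = Dw p u \<bullet> b"
    by (rule second_derivative_symmetric_real[of "\<lambda>x. f x \<bullet> b" "\<lambda>x h. D x h \<bullet> b"
          u "\<lambda>x h. Du x h \<bullet> b" w "\<lambda>x h. Dw x h \<bullet> b" p])
      (intro has_derivative_inner_left f Du Dw continuous_intros cont)+
qed

section \<open>Orthogonal frames\<close>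

lemma orthonormal_expand_real4:
  fixes a b c d x :: "real^4"
  assumes "a \<bullet> a = 1" "b \<bullet> b = 1" "c \<bullet> c = 1" "d \<bullet> d = 1"
    "a \<bullet> b = 0" "a \<bullet> c = 0" "a \<bullet> d = 0" "b \<bullet> c = 0" "b \<bullet> d = 0" "c \<bullet> d = 0"
  shows "x = (x \<bullet> a) *\<^sub>R a + (x \<bullet> b) *\<^sub>R b + (x \<bullet> c) *\<^sub>R c + (x \<bullet> d) *\<^sub>R d"
proof -
  note o = assms
  have o': "b \<bullet> a = 0" "c \<bullet> a = 0" "d \<bullet> a = 0" "c \<bullet> b = 0" "d \<bullet> b = 0" "d \<bullet> c = 0"
    using o by (simp_all add: inner_commute)
  have ne: "a \<noteq> b" "a \<noteq> c" "a \<noteq> d" "b \<noteq> c" "b \<noteq> d" "c \<noteq> d" using o by auto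
  have "card {a, b, c, d} = DIM(real^4)" using ne by simp
  moreover have "pairwise orthogonal {a, b, c, d}"
    using o o' by (auto simp: pairwise_def orthogonal_def)
  moreover have "0 \<notin> {a, b, c, d}" using o by auto
  ultimately have "independent {a, b, c, d}" by (intro pairwise_orthogonal_independent)
  then have span: "span {a, b, c, d} = UNIV"
    using card_ge_dim_independent[of "{a, b, c, d}" UNIV] \<open>card _ = _\<close> by (simp add: dim_UNIV) blast
  define y where "y = x - ((x \<bullet> a) *\<^sub>R a + (x \<bullet> b) *\<^sub>R b + (x \<bullet> c) *\<^sub>R c + (x \<bullet> d) *\<^sub>R d)"
  have "orthogonal y z" if "z \<in> {a, b, c, d}" for z
    using that o o' by (auto simp: y_def orthogonal_def inner_simps)
  then have "orthogonal y y"
    using orthogonal_to_span[of y "{a,b,c,d}" y] span by (auto simp: orthogonal_commute)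
  then show ?thesis by (simp add: orthogonal_def y_def)
qed

text \<open>The frame of the surface has this shape: position and normal are unit vectors, and
  \<open>R\<close> is the common squared length of the two tangent vectors.\<close>

lemma orthogonal_expand_real4:
  fixes a b c d z :: "real^4"
  assumes "a \<bullet> a = 1" "b \<bullet> b = 1" "c \<bullet> c = R" "d \<bullet> d = R" "0 < R"
    "a \<bullet> b = 0" "c \<bullet> a = 0" "d \<bullet> a = 0" "c \<bullet> b = 0" "d \<bullet> b = 0" "c \<bullet> d = 0"
  shows "z = (z \<bullet> a) *\<^sub>R a + (z \<bullet> b) *\<^sub>R b + (z \<bullet> c / R) *\<^sub>R c + (z \<bullet> d / R) *\<^sub>R d"
proof -
  define r where "r = sqrt R"
  have r: "0 < r" "R = r * r" using assms by (simp_all add: r_def)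
  have "z = (z \<bullet> a) *\<^sub>R a + (z \<bullet> b) *\<^sub>R b
     + (z \<bullet> (c /\<^sub>R r)) *\<^sub>R (c /\<^sub>R r) + (z \<bullet> (d /\<^sub>R r)) *\<^sub>R (d /\<^sub>R r)"
    by (rule orthonormal_expand_real4) (use assms r in \<open>simp_all add: inner_commute field_simps\<close>)
  then show ?thesis by (simp add: r(2) divide_inverse mult_ac)
qed

text \<open>Orthonormal rows make a square matrix orthogonal. This allows a trace at one contact
  point to be taken in a basis transported from the other.\<close>

lemma orthonormal_rows_imp_columns:
  fixes a b c d :: real
  assumes "a\<^sup>2 + b\<^sup>2 = 1" "c\<^sup>2 + d\<^sup>2 = 1" "a * c + b * d = 0"
  shows "a\<^sup>2 + c\<^sup>2 = 1" "b\<^sup>2 + d\<^sup>2 = 1"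
proof -
  define t where "t = a * d - b * c"
  have "t\<^sup>2 + (a * c + b * d)\<^sup>2 = (a\<^sup>2 + b\<^sup>2) * (c\<^sup>2 + d\<^sup>2)"
    by (simp add: t_def power2_eq_square algebra_simps)
  then have t: "t\<^sup>2 = 1" using assms by simp
  \<comment> \<open>For determinant \<open>t = \<plusminus>1\<close>, orthogonality means
    \<open>a = d * t\<close> and \<open>b = - c * t\<close>; one vanishing sum of squares gives
    both.\<close>
  have "(a - d * t)\<^sup>2 + (b + c * t)\<^sup>2 = (a\<^sup>2 + b\<^sup>2) - 2 * t * (a * d - b * c) + (c\<^sup>2 + d\<^sup>2) * t\<^sup>2"
    by (simp add: power2_eq_square algebra_simps)
  also have "\<dots> = 1 - 2 * t\<^sup>2 + t\<^sup>2" using assms by (simp add: t_def[symmetric] power2_eq_square)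
  finally have "(a - d * t)\<^sup>2 + (b + c * t)\<^sup>2 = 0" using t by simp
  then have e: "a - d * t = 0" "b + c * t = 0" by (simp_all add: sum_power2_eq_zero_iff)
  from e have "a\<^sup>2 = (d * t)\<^sup>2" "b\<^sup>2 = (c * t)\<^sup>2" by (simp, metis add_eq_0_iff power2_minus)
  then have "a\<^sup>2 = d\<^sup>2" "b\<^sup>2 = c\<^sup>2" using t by (simp_all add: power_mult_distrib)
  with assms show "a\<^sup>2 + c\<^sup>2 = 1" "b\<^sup>2 + d\<^sup>2 = 1" by auto
qed

text \<open>Applied to the known products of frame vectors, this yields the components of their
  derivatives.\<close>

lemma inner_derivative_eq:
  assumes "(a has_derivative a') (at p)" "(b has_derivative b') (at p)" "\<And>p. a p \<bullet> b p = c p"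
    and "(c has_derivative c') (at p)"
  shows "a p \<bullet> b' h + a' h \<bullet> b p = c' h"
proof -
  have "((\<lambda>p. a p \<bullet> b p) has_derivative (\<lambda>h. a p \<bullet> b' h + a' h \<bullet> b p)) (at p)"
    by (rule has_derivative_inner[OF assms(1,2)])
  then have "(\<lambda>h. a p \<bullet> b' h + a' h \<bullet> b p) = c'"
    unfolding assms(3) using assms(4) by (rule has_derivative_unique)
  then show ?thesis by (rule fun_cong)
qed

lemma vector_derivative_zero_constant:
  fixes g :: "real \<Rightarrow> 'a::real_normed_vector"
  assumes "\<And>t. (g has_vector_derivative 0) (at t)"
  shows "g x = g y"
  using has_vector_derivative_zero_constant[of UNIV g] assms by (metis UNIV_I convex_UNIV has_vector_derivative_at_within)

text \<open>Turning the pair \<open>(E, G / c)\<close> back by the angle \<open>c * x\<close>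
  produces two constant vectors; solving for \<open>E x\<close> undoes the rotation.\<close>

lemma harmonic_oscillator:
  fixes E G :: "real \<Rightarrow> 'a::real_normed_vector"
  assumes E: "\<And>x. (E has_vector_derivative G x) (at x)"
    and G: "\<And>x. (G has_vector_derivative - (c\<^sup>2) *\<^sub>R E x) (at x)" and c: "c \<noteq> 0"
  shows "E x = cos (c * x) *\<^sub>R E 0 + (sin (c * x) / c) *\<^sub>R G 0"
proof -
  have "((\<lambda>x. cos (c * x) *\<^sub>R E x - (sin (c * x) / c) *\<^sub>R G x) has_vector_derivative 0) (at x)" for x
    by (rule derivative_eq_intros E G refl | simp add: c)+
      (simp add: c power2_eq_square algebra_simps)
  from vector_derivative_zero_constant[OF this, of x 0]
  have 1: "cos (c * x) *\<^sub>R E x - (sin (c * x) / c) *\<^sub>R G x = E 0" by simp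
  have "((\<lambda>x. (c * sin (c * x)) *\<^sub>R E x + cos (c * x) *\<^sub>R G x) has_vector_derivative 0) (at x)" for x
    by (rule derivative_eq_intros E G refl | simp add: c)+
      (simp add: c power2_eq_square algebra_simps)
  from vector_derivative_zero_constant[OF this, of x 0]
  have 2: "(c * sin (c * x)) *\<^sub>R E x + cos (c * x) *\<^sub>R G x = G 0" by simp
  have "cos (c * x) *\<^sub>R E 0 + (sin (c * x) / c) *\<^sub>R G 0
      = (cos (c * x) * cos (c * x)) *\<^sub>R E x + (sin (c * x) * sin (c * x)) *\<^sub>R E x"
    unfolding 1[symmetric] 2[symmetric] using c by (simp add: algebra_simps)
  also have "\<dots> = E x" by (simp flip: scaleR_add_left)
  finally show ?thesis by simp
qed

text \<open>\<open>C_k\<close> speaks only of basis directions. Expansion in the basis carries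
  differentiability, continuity and additivity over to arbitrary directions.\<close>

lemma C_k_2_derivatives:
  fixes f :: "'a::euclidean_space \<Rightarrow> 'b::real_normed_vector"
  assumes C2: "C_k 2 f"
  defines "D \<equiv> \<lambda>p. frechet_derivative f (at p)"
  defines "D2 \<equiv> \<lambda>u p. frechet_derivative (\<lambda>p. D p u) (at p)"
  shows "(f has_derivative D p) (at p)" "((\<lambda>p. D p u) has_derivative D2 u p) (at p)"
    "continuous_on UNIV (\<lambda>p. D2 u p w)" "linear (D p)" "D2 (u + u') p h = D2 u p h + D2 u' p h"
proof -
  have C: "\<And>p. f differentiable at p" "\<And>b. b \<in> Basis \<Longrightarrow> C_k 1 (\<lambda>p. D p b)"
    using C2 by (simp_all add: numeral_2_eq_2 D_def)
  have C': "(\<lambda>p. D p b) differentiable at p" "continuous_on UNIV (\<lambda>p. D2 b p b')" if "b \<in> Basis" "b' \<in> Basis" for b b' p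
    using C(2)[OF that(1)] that(2) by (simp_all add: D2_def)
  show D: "(f has_derivative D p) (at p)" for p unfolding D_def using C(1) frechet_derivative_works by blast
  show lin: "linear (D p)" for p using D has_derivative_linear by blast
  have Db: "((\<lambda>p. D p b) has_derivative D2 b p) (at p)" if "b \<in> Basis" for b p
    unfolding D2_def using C'(1)[OF that that] frechet_derivative_works by blast
  have Du: "D p u = (\<Sum>b\<in>Basis. (u \<bullet> b) *\<^sub>R D p b)" for p u
  proof -
    have "D p (\<Sum>b\<in>Basis. (u \<bullet> b) *\<^sub>R b) = (\<Sum>b\<in>Basis. (u \<bullet> b) *\<^sub>R D p b)"
      by (simp only: linear_sum[OF lin] linear_cmul[OF lin])
    then show ?thesis by (simp only: euclidean_representation)
  qed
  have "((\<lambda>p. D p u) has_derivative (\<lambda>h. \<Sum>b\<in>Basis. (u \<bullet> b) *\<^sub>R D2 b p h)) (at p)" for p u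
    unfolding Du[of _ u] by (intro has_derivative_sum has_derivative_scaleR_right Db)
  then have D2u: "((\<lambda>p. D p u) has_derivative D2 u p) (at p)" "D2 u p = (\<lambda>h. \<Sum>b\<in>Basis. (u \<bullet> b) *\<^sub>R D2 b p h)" for p u
    unfolding D2_def by (metis frechet_derivative_at)+
  show "((\<lambda>p. D p u) has_derivative D2 u p) (at p)" by (rule D2u)
  have lin2: "linear (D2 u p)" for u p using D2u(1) has_derivative_linear by blast
  have "D2 u p w = (\<Sum>b'\<in>Basis. (w \<bullet> b') *\<^sub>R (\<Sum>b\<in>Basis. (u \<bullet> b) *\<^sub>R D2 b p b'))" for p
  proof -
    have "D2 u p (\<Sum>b'\<in>Basis. (w \<bullet> b') *\<^sub>R b') = (\<Sum>b'\<in>Basis. (w \<bullet> b') *\<^sub>R D2 u p b')"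
      by (simp only: linear_sum[OF lin2] linear_cmul[OF lin2])
    then show ?thesis unfolding euclidean_representation D2u(2)[of u] .
  qed
  then show "continuous_on UNIV (\<lambda>p. D2 u p w)" by (simp add: continuous_intros C')
  show "D2 (u + u') p h = D2 u p h + D2 u' p h"
    by (simp add: D2u(2)[of u] D2u(2)[of u'] D2u(2)[of "u + u'"] inner_add_left scaleR_add_left sum.distrib)
qed

section \<open>The Gauss--Weingarten equations in a principal frame\<close>

text \<open>\<open>F1\<close> and \<open>F2\<close> are the derivatives of \<open>f\<close> along the orthonormal principal directions \<open>(C, S)\<close> and
  \<open>(- S, C)\<close>; the coordinates of a tangent vector \<open>h\<close> in this basis are \<open>C * fst h + S * snd h\<close> and
  \<open>C * snd h - S * fst h\<close>. The metric is \<open>(s * v y)\<^sup>2 * (dx\<^sup>2 + dy\<^sup>2)\<close>, and \<open>\<bar>k\<bar>\<close> is the modulus of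
  the Hopf differential.\<close>

locale dn_surface =
  fixes q s H k C S :: real and v vd :: "real \<Rightarrow> real"
    and f F1 F2 N :: "real \<times> real \<Rightarrow> real^4"
  assumes CS: "C\<^sup>2 + S\<^sup>2 = 1"
    and s_pos: "0 < s" and sH: "s\<^sup>2 * (1 + H\<^sup>2) = 1" and k_sq: "k\<^sup>2 = q\<^sup>2 * s\<^sup>2"
    and q: "q \<noteq> 0" "q\<^sup>2 < 1"
    and v_pos: "\<And>y. 0 < v y" and v_le_1: "\<And>y. v y \<le> 1"
    and DERIV_v: "\<And>y. (v has_real_derivative vd y) (at y)"
    and DERIV_vd: "\<And>y. (vd has_real_derivative v y * (1 + q\<^sup>2 - 2 * (v y)\<^sup>2)) (at y)"
    and vd_sq: "\<And>y. (vd y)\<^sup>2 = (1 - (v y)\<^sup>2) * ((v y)\<^sup>2 - q\<^sup>2)"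
    and frame: "\<And>p. f p \<bullet> f p = 1" "\<And>p. N p \<bullet> N p = 1" "\<And>p. f p \<bullet> N p = 0"
      "\<And>p. F1 p \<bullet> f p = 0" "\<And>p. F2 p \<bullet> f p = 0" "\<And>p. F1 p \<bullet> N p = 0" "\<And>p. F2 p \<bullet> N p = 0"
      "\<And>p. F1 p \<bullet> F2 p = 0" "\<And>p. F1 p \<bullet> F1 p = (s * v (snd p))\<^sup>2" "\<And>p. F2 p \<bullet> F2 p = (s * v (snd p))\<^sup>2"
    and Df: "\<And>p. (f has_derivative (\<lambda>h. (C * fst h + S * snd h) *\<^sub>R F1 p + (C * snd h - S * fst h) *\<^sub>R F2 p)) (at p)"
    and DN: "\<And>p. (N has_derivative (\<lambda>h.
         (C * fst h + S * snd h) *\<^sub>R (- (H + k / (s * v (snd p))\<^sup>2)) *\<^sub>R F1 p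
         + (C * snd h - S * fst h) *\<^sub>R (- (H - k / (s * v (snd p))\<^sup>2)) *\<^sub>R F2 p)) (at p)"
    and DF1: "\<And>p. (F1 has_derivative (\<lambda>h.
         (C * fst h + S * snd h) *\<^sub>R ((vd (snd p) / v (snd p)) *\<^sub>R (S *\<^sub>R F1 p - C *\<^sub>R F2 p)
            + (H * (s * v (snd p))\<^sup>2 + k) *\<^sub>R N p - (s * v (snd p))\<^sup>2 *\<^sub>R f p)
         + (C * snd h - S * fst h) *\<^sub>R ((vd (snd p) / v (snd p)) *\<^sub>R (C *\<^sub>R F1 p + S *\<^sub>R F2 p)))) (at p)"
    and DF2: "\<And>p. (F2 has_derivative (\<lambda>h.
         (C * fst h + S * snd h) *\<^sub>R ((vd (snd p) / v (snd p)) *\<^sub>R (C *\<^sub>R F1 p + S *\<^sub>R F2 p))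
         + (C * snd h - S * fst h) *\<^sub>R ((vd (snd p) / v (snd p)) *\<^sub>R (C *\<^sub>R F2 p - S *\<^sub>R F1 p)
            + (H * (s * v (snd p))\<^sup>2 - k) *\<^sub>R N p - (s * v (snd p))\<^sup>2 *\<^sub>R f p))) (at p)"
begin

definition \<rho> :: "real \<times> real \<Rightarrow> real" where "\<rho> p = s * v (snd p)"
text \<open>\<open>H + \<mu>\<close> and \<open>H - \<mu>\<close> are the principal curvatures in
  the directions of \<open>F1\<close> and \<open>F2\<close>; the sign is that of
  \<open>k\<close>.\<close>

definition \<mu> :: "real \<Rightarrow> real" where "\<mu> y = k / (s * v y)\<^sup>2"
definition x1 :: "real \<times> real \<Rightarrow> real" where "x1 h = C * fst h + S * snd h"
definition x2 :: "real \<times> real \<Rightarrow> real" where "x2 h = C * snd h - S * fst h"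
text \<open>The second derivatives of \<open>f\<close> in principal directions, that is, the
  coefficients in \<open>DF1\<close> and \<open>DF2\<close> (Gauss formula).\<close>

definition F11 where "F11 p = (vd (snd p) / v (snd p)) *\<^sub>R (S *\<^sub>R F1 p - C *\<^sub>R F2 p)
  + (H * (\<rho> p)\<^sup>2 + k) *\<^sub>R N p - (\<rho> p)\<^sup>2 *\<^sub>R f p"
definition F12 where "F12 p = (vd (snd p) / v (snd p)) *\<^sub>R (C *\<^sub>R F1 p + S *\<^sub>R F2 p)"
definition F22 where "F22 p = (vd (snd p) / v (snd p)) *\<^sub>R (C *\<^sub>R F2 p - S *\<^sub>R F1 p)
  + (H * (\<rho> p)\<^sup>2 - k) *\<^sub>R N p - (\<rho> p)\<^sup>2 *\<^sub>R f p"

lemma frame':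
  "N p \<bullet> f p = 0" "f p \<bullet> F1 p = 0" "f p \<bullet> F2 p = 0" "N p \<bullet> F1 p = 0" "N p \<bullet> F2 p = 0" "F2 p \<bullet> F1 p = 0"
  using frame(3-8)[of p] by (simp_all only: inner_commute)

lemma \<rho>_pos: "0 < \<rho> p"
  using s_pos v_pos by (simp add: \<rho>_def)

lemma line_f: "((\<lambda>t. f (p + t *\<^sub>R a)) has_vector_derivative
    x1 a *\<^sub>R F1 (p + t *\<^sub>R a) + x2 a *\<^sub>R F2 (p + t *\<^sub>R a)) (at t)"
  using has_vector_derivative_along_line[OF Df] by (simp add: x1_def x2_def)

lemma line_N: "((\<lambda>t. N (p + t *\<^sub>R a)) has_vector_derivative
    x1 a *\<^sub>R (- (H + \<mu> (snd (p + t *\<^sub>R a)))) *\<^sub>R F1 (p + t *\<^sub>R a)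
    + x2 a *\<^sub>R (- (H - \<mu> (snd (p + t *\<^sub>R a)))) *\<^sub>R F2 (p + t *\<^sub>R a)) (at t)"
  using has_vector_derivative_along_line[OF DN] by (simp only: x1_def x2_def \<mu>_def)

lemma line_F1: "((\<lambda>t. F1 (p + t *\<^sub>R a)) has_vector_derivative
    x1 a *\<^sub>R F11 (p + t *\<^sub>R a) + x2 a *\<^sub>R F12 (p + t *\<^sub>R a)) (at t)"
  using has_vector_derivative_along_line[OF DF1] by (simp only: x1_def x2_def F11_def F12_def \<rho>_def)

lemma line_F2: "((\<lambda>t. F2 (p + t *\<^sub>R a)) has_vector_derivative
    x1 a *\<^sub>R F12 (p + t *\<^sub>R a) + x2 a *\<^sub>R F22 (p + t *\<^sub>R a)) (at t)"
  using has_vector_derivative_along_line[OF DF2] by (simp only: x1_def x2_def F22_def F12_def \<rho>_def)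

lemma DERIV_\<mu>: "(\<mu> has_real_derivative - 2 * \<mu> y * vd y / v y) (at y)"
proof -
  have "s * v y \<noteq> 0" using s_pos v_pos[of y] by simp
  have "((\<lambda>y. k / (s * v y)\<^sup>2) has_real_derivative
     - (k * (2 * (s * v y) * (s * vd y))) / ((s * v y)\<^sup>2 * (s * v y)\<^sup>2)) (at y)"
    using s_pos v_pos[of y] by (auto intro!: derivative_eq_intros DERIV_v simp: power2_eq_square)
  also have "- (k * (2 * (s * v y) * (s * vd y))) / ((s * v y)\<^sup>2 * (s * v y)\<^sup>2) = - 2 * \<mu> y * vd y / v y"
    using s_pos v_pos[of y] by (simp add: \<mu>_def divide_simps power2_eq_square)
  finally show ?thesis unfolding \<mu>_def[abs_def] .
qed

lemma expand:
  "z = (z \<bullet> f p) *\<^sub>R f p + (z \<bullet> N p) *\<^sub>R N p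
     + (z \<bullet> F1 p / (\<rho> p)\<^sup>2) *\<^sub>R F1 p + (z \<bullet> F2 p / (\<rho> p)\<^sup>2) *\<^sub>R F2 p"
  using \<rho>_pos[of p]
  by (intro orthogonal_expand_real4 frame frame(9,10)[folded \<rho>_def]) simp

text \<open>\<open>Z \<Psi> p r \<ge> 0\<close> says that \<open>f r\<close> is not in the open ball of curvature \<open>H + \<Psi>\<close> that touches the surface
  at \<open>f p\<close>. \<open>Z'\<close> and \<open>Z''\<close> are its derivatives as \<open>p\<close> and \<open>r\<close> move with velocities \<open>a\<close> and \<open>b\<close>.\<close>

definition Z :: "(real \<Rightarrow> real) \<Rightarrow> real \<times> real \<Rightarrow> real \<times> real \<Rightarrow> real" where
  "Z \<Psi> p r = (H + \<Psi> (snd p)) * (1 - f p \<bullet> f r) - N p \<bullet> f r"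

definition Z' where
  "Z' \<Psi> \<Psi>1 a b p r = \<Psi>1 (snd p) * snd a * (1 - f p \<bullet> f r)
     - x1 a * (\<Psi> (snd p) - \<mu> (snd p)) * (F1 p \<bullet> f r) - x2 a * (\<Psi> (snd p) + \<mu> (snd p)) * (F2 p \<bullet> f r)
     - x1 b * ((H + \<Psi> (snd p)) * (f p \<bullet> F1 r) + N p \<bullet> F1 r)
     - x2 b * ((H + \<Psi> (snd p)) * (f p \<bullet> F2 r) + N p \<bullet> F2 r)"

definition Z'' where
  "Z'' \<Psi> \<Psi>1 \<Psi>2 a b p r =
     \<Psi>2 (snd p) * (snd a)\<^sup>2 * (1 - f p \<bullet> f r)
     - \<Psi>1 (snd p) * snd a * ((x1 a *\<^sub>R F1 p + x2 a *\<^sub>R F2 p) \<bullet> f r + f p \<bullet> (x1 b *\<^sub>R F1 r + x2 b *\<^sub>R F2 r))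
     - x1 a * (\<Psi>1 (snd p) + 2 * \<mu> (snd p) * vd (snd p) / v (snd p)) * snd a * (F1 p \<bullet> f r)
     - x1 a * (\<Psi> (snd p) - \<mu> (snd p)) *
         ((x1 a *\<^sub>R F11 p + x2 a *\<^sub>R F12 p) \<bullet> f r + F1 p \<bullet> (x1 b *\<^sub>R F1 r + x2 b *\<^sub>R F2 r))
     - x2 a * (\<Psi>1 (snd p) - 2 * \<mu> (snd p) * vd (snd p) / v (snd p)) * snd a * (F2 p \<bullet> f r)
     - x2 a * (\<Psi> (snd p) + \<mu> (snd p)) *
         ((x1 a *\<^sub>R F12 p + x2 a *\<^sub>R F22 p) \<bullet> f r + F2 p \<bullet> (x1 b *\<^sub>R F1 r + x2 b *\<^sub>R F2 r))
     - (\<Psi>1 (snd p) * snd a) * (f p \<bullet> (x1 b *\<^sub>R F1 r + x2 b *\<^sub>R F2 r))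
     - (x1 a * (\<Psi> (snd p) - \<mu> (snd p))) * (F1 p \<bullet> (x1 b *\<^sub>R F1 r + x2 b *\<^sub>R F2 r))
     - (x2 a * (\<Psi> (snd p) + \<mu> (snd p))) * (F2 p \<bullet> (x1 b *\<^sub>R F1 r + x2 b *\<^sub>R F2 r))
     - ((H + \<Psi> (snd p)) *\<^sub>R f p + N p) \<bullet>
         (x1 b *\<^sub>R (x1 b *\<^sub>R F11 r + x2 b *\<^sub>R F12 r) + x2 b *\<^sub>R (x1 b *\<^sub>R F12 r + x2 b *\<^sub>R F22 r))"

lemma DERIV_line:
  assumes "\<And>y. (\<Psi> has_real_derivative \<Psi>1 y) (at y)"
  shows "((\<lambda>t. \<Psi> (snd (p + t *\<^sub>R a))) has_real_derivative \<Psi>1 (snd (p + t *\<^sub>R a)) * snd a) (at t)"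
proof -
  have "((\<lambda>t. snd (p + t *\<^sub>R a)) has_real_derivative snd a) (at t)"
    by (auto intro!: derivative_eq_intros)
  from DERIV_chain2[OF assms this] show ?thesis .
qed

lemma DERIV_Z_line:
  assumes "\<And>y. (\<Psi> has_real_derivative \<Psi>1 y) (at y)"
  shows "((\<lambda>t. Z \<Psi> (p + t *\<^sub>R a) (r + t *\<^sub>R b)) has_real_derivative
    Z' \<Psi> \<Psi>1 a b (p + t *\<^sub>R a) (r + t *\<^sub>R b)) (at t)"
  unfolding Z_def Z'_def
  by (rule derivative_eq_intros DERIV_line[of \<Psi> \<Psi>1] assms has_real_derivative_inner line_f line_N refl)+
    (simp add: inner_simps algebra_simps)

lemma DERIV_Z'_line:
  assumes "\<And>y. (\<Psi> has_real_derivative \<Psi>1 y) (at y)" "\<And>y. (\<Psi>1 has_real_derivative \<Psi>2 y) (at y)"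
  shows "((\<lambda>t. Z' \<Psi> \<Psi>1 a b (p + t *\<^sub>R a) (r + t *\<^sub>R b)) has_real_derivative
    Z'' \<Psi> \<Psi>1 \<Psi>2 a b (p + t *\<^sub>R a) (r + t *\<^sub>R b)) (at t)"
  unfolding Z''_def Z'_def
  by (rule derivative_eq_intros DERIV_line[of \<Psi> \<Psi>1] DERIV_line[of \<Psi>1 \<Psi>2] DERIV_line[OF DERIV_\<mu>] assms
      has_real_derivative_inner line_f line_N line_F1 line_F2 refl)+
    (simp only: inner_simps, simp add: algebra_simps power2_eq_square)

subsection \<open>The maximum principle\<close>

text \<open>The second derivatives of \<open>Z\<close> are added up along the two pairs of directions in which \<open>p\<close> moves along
  a principal unit vector and \<open>r\<close> along its image under the reflection that exchanges \<open>f p\<close> and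
  \<open>f r\<close>. At a second contact this reflection maps one tangent plane to the other.\<close>

lemma touching:
  assumes \<Psi>1: "\<And>y. (\<Psi> has_real_derivative \<Psi>1 y) (at y)" and \<Psi>2: "\<And>y. (\<Psi>1 has_real_derivative \<Psi>2 y) (at y)"
    and nonneg: "\<And>p r. 0 \<le> Z \<Psi> p r" and zero: "Z \<Psi> p r = 0" and ne: "f p \<noteq> f r"
    and gap: "\<mu> (snd p) < \<Psi> (snd p)" "- \<mu> (snd p) < \<Psi> (snd p)"
    and side: "H = 0 \<or> ((H + \<Psi> (snd p)) *\<^sub>R f p + N p) \<bullet> N r \<noteq> -1"
  shows "0 \<le> \<Psi>2 (snd p) - 2 * (\<Psi>1 (snd p))\<^sup>2 *
       (S\<^sup>2 / (\<Psi> (snd p) - \<mu> (snd p)) + C\<^sup>2 / (\<Psi> (snd p) + \<mu> (snd p)))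
     - 2 * \<Psi> (snd p) * ((v (snd p))\<^sup>2 - q\<^sup>2 / (v (snd p))\<^sup>2)
     - 2 * H * (\<rho> p)\<^sup>2 * ((\<Psi> (snd p))\<^sup>2 - (\<mu> (snd p))\<^sup>2)"
proof -
  define y where "y = snd p"
  define P where "P = \<Psi> y"
  define P1 where "P1 = \<Psi>1 y"
  define P2 where "P2 = \<Psi>2 y"
  define m where "m = \<mu> y"
  define l where "l = vd y / v y"
  define \<Phi> where "\<Phi> = H + P"
  define d where "d = 1 - f p \<bullet> f r"
  \<comment> \<open>The boundary of the touching ball consists of the points \<open>z\<close> of the
    3-sphere with \<open>w \<bullet> z = \<Phi>\<close>.\<close>
  define w where "w = \<Phi> *\<^sub>R f p + N p"
  define X1 where "X1 = F1 p \<bullet> f r"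
  define X2 where "X2 = F2 p \<bullet> f r"
  define R where "R = \<rho> p"
  define R' where "R' = \<rho> r"
  note defs = y_def P_def P1_def P2_def m_def l_def \<Phi>_def d_def w_def X1_def X2_def R_def R'_def
  have Rpos: "R > 0" "R' > 0" using \<rho>_pos by (auto simp: R_def R'_def)
  have gap': "P - m > 0" "P + m > 0" using gap by (auto simp: P_def m_def y_def)
  note o = frame[of p, folded \<rho>_def, folded R_def] frame[of r, folded \<rho>_def, folded R'_def]
  note o' = o frame'[of p] frame'[of r]
  have d_pos: "d > 0"
  proof -
    have "0 < (norm (f p - f r))\<^sup>2" using ne by simp
    also have "\<dots> = 2 * d" using o by (simp add: d_def power2_norm_eq_inner inner_simps inner_commute)
    finally show ?thesis by simp
  qed
  have first: "Z' \<Psi> \<Psi>1 a b p r = 0" and second: "0 \<le> Z'' \<Psi> \<Psi>1 \<Psi>2 a b p r" for a b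
  proof -
    note line = DERIV_Z_line[of \<Psi> \<Psi>1, OF \<Psi>1, where p = p and a = a and r = r and b = b]
      and line' = DERIV_Z'_line[of \<Psi> \<Psi>1 \<Psi>2, OF \<Psi>1 \<Psi>2, where p = p and a = a and r = r and b = b and t = 0]
    show "Z' \<Psi> \<Psi>1 a b p r = 0" "0 \<le> Z'' \<Psi> \<Psi>1 \<Psi>2 a b p r"
      using nonneg_zero_second_derivative[OF line line'] nonneg zero by simp_all
  qed
  have N_fr: "N p \<bullet> f r = \<Phi> * d" using zero by (simp add: Z_def defs)
  have w_fr: "w \<bullet> f r = \<Phi>" using N_fr by (simp add: w_def inner_simps d_def algebra_simps)
  have w_fp: "w \<bullet> f p = \<Phi>" using o' by (simp add: w_def inner_simps)
  define u1 u2 where "u1 = (C, S)" and "u2 = (- S, C)"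
  have u: "x1 u1 = 1" "x2 u1 = 0" "x1 u2 = 0" "x2 u2 = 1" "snd u1 = S" "snd u2 = C"
    using CS by (auto simp: x1_def x2_def u1_def u2_def power2_eq_square)
  have z: "x1 0 = 0" "x2 0 = 0" by (auto simp: x1_def x2_def)
  \<comment> \<open>With \<open>p\<close> at rest: the surface is tangent at \<open>f r\<close> to
    the boundary of the ball, which confines \<open>w\<close> to the span of \<open>f r\<close> and
    \<open>N r\<close>.\<close>
  have wF: "w \<bullet> F1 r = 0" "w \<bullet> F2 r = 0"
    using first[of 0 u1] first[of 0 u2] unfolding Z'_def
    by (auto simp: u z w_def inner_simps defs)
  \<comment> \<open>With \<open>r\<close> at rest: the first-order condition determines
    \<open>X1\<close> and \<open>X2\<close> by the derivative of \<open>\<Psi>\<close>.\<close>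
  have XX: "(P - m) * X1 = P1 * S * d" "(P + m) * X2 = P1 * C * d"
    using first[of u1 0] first[of u2 0] unfolding Z'_def
    by (auto simp: u z X1_def X2_def P_def P1_def m_def d_def y_def)
  define \<sigma> where "\<sigma> = w \<bullet> N r"
  have w_exp: "w = \<Phi> *\<^sub>R f r + \<sigma> *\<^sub>R N r" using expand[of w r] wF w_fr by (simp add: \<sigma>_def)
  have "\<Phi>\<^sup>2 + 1 = w \<bullet> w" using o' by (simp add: w_def inner_simps power2_eq_square)
  also have "\<dots> = \<Phi>\<^sup>2 + \<sigma>\<^sup>2" unfolding w_exp using o' by (simp add: inner_simps power2_eq_square)
  finally have \<sigma>2: "\<sigma>\<^sup>2 = 1" by simp
  then have \<sigma>: "\<sigma> = 1 \<or> \<sigma> = -1" by (simp add: power2_eq_1_iff)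
  \<comment> \<open>\<open>\<sigma> = 1\<close> is contact from the same side. The sign enters the
    trace below only through \<open>H * \<sigma>\<close>, so it is harmless if
    \<open>H = 0\<close>.\<close>
  have H\<sigma>: "H * \<sigma> = H" using side \<sigma> by (auto simp: \<sigma>_def w_def defs)
  \<comment> \<open>The reflection sends \<open>x\<close> to
    \<open>x - (x \<bullet> n / d) *\<^sub>R n\<close> with \<open>n = f p - f r\<close> and
    \<open>n \<bullet> n = 2 * d\<close>; these are the images of the unit principal vectors at
    \<open>p\<close>.\<close>
  define e1 e2 where "e1 = F1 p /\<^sub>R R + (X1 / (R * d)) *\<^sub>R (f p - f r)"
    and "e2 = F2 p /\<^sub>R R + (X2 / (R * d)) *\<^sub>R (f p - f r)"
  have frp: "f r \<bullet> f p = 1 - d" "f p \<bullet> f r = 1 - d" by (auto simp: d_def inner_commute)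
  have X': "f r \<bullet> F1 p = X1" "f r \<bullet> F2 p = X2" "F1 p \<bullet> f r = X1" "F2 p \<bullet> f r = X2"
    by (auto simp: X1_def X2_def inner_commute)
  have e_f: "e1 \<bullet> f r = 0" "e2 \<bullet> f r = 0"
    using Rpos d_pos o by (simp_all add: e1_def e2_def inner_simps frp X' field_simps)
  have wF_p: "w \<bullet> F1 p = 0" "w \<bullet> F2 p = 0" using o' by (simp_all add: w_def inner_simps)
  have "e1 \<bullet> w = 0" "e2 \<bullet> w = 0"
    using wF_p w_fr w_fp by (simp_all add: e1_def e2_def inner_simps inner_commute[of _ w])
  then have e_N: "e1 \<bullet> N r = 0" "e2 \<bullet> N r = 0" using \<sigma> e_f by (auto simp: w_exp inner_simps)
  have ee: "e1 \<bullet> e1 = 1" "e2 \<bullet> e2 = 1" "e1 \<bullet> e2 = 0"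
    using Rpos d_pos o' by (simp_all add: e1_def e2_def inner_simps frp X' field_simps power2_eq_square)
  have e_fp: "f p \<bullet> e1 = X1 / R" "f p \<bullet> e2 = X2 / R"
    using Rpos d_pos o' by (simp_all add: e1_def e2_def inner_simps frp X' field_simps)
  have e_Fp: "F1 p \<bullet> e1 = R - X1\<^sup>2 / (R * d)" "F2 p \<bullet> e2 = R - X2\<^sup>2 / (R * d)"
    using Rpos d_pos o' by (simp_all add: e1_def e2_def inner_simps frp X' field_simps power2_eq_square)
  define b11 b12 b21 b22 where "b11 = e1 \<bullet> F1 r / R'\<^sup>2" and "b12 = e1 \<bullet> F2 r / R'\<^sup>2"
    and "b21 = e2 \<bullet> F1 r / R'\<^sup>2" and "b22 = e2 \<bullet> F2 r / R'\<^sup>2"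
  have e_exp: "b11 *\<^sub>R F1 r + b12 *\<^sub>R F2 r = e1" "b21 *\<^sub>R F1 r + b22 *\<^sub>R F2 r = e2"
    using expand[of e1 r] expand[of e2 r] e_f e_N by (simp_all add: b11_def b12_def b21_def b22_def R'_def)
  have "(R' * b11)\<^sup>2 + (R' * b12)\<^sup>2 = e1 \<bullet> e1" "(R' * b21)\<^sup>2 + (R' * b22)\<^sup>2 = e2 \<bullet> e2"
    "(R' * b11) * (R' * b21) + (R' * b12) * (R' * b22) = e1 \<bullet> e2"
    unfolding e_exp[symmetric] using o' by (simp_all add: inner_simps power2_eq_square algebra_simps)
  from orthonormal_rows_imp_columns[OF this[unfolded ee]]
  have col: "R'\<^sup>2 * (b11\<^sup>2 + b21\<^sup>2) = 1" "R'\<^sup>2 * (b12\<^sup>2 + b22\<^sup>2) = 1"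
    by (simp_all add: power_mult_distrib algebra_simps)
  \<comment> \<open>Velocities in the parameter plane: \<open>a1\<close>, \<open>a2\<close> move
    \<open>f p\<close> along its unit principal vectors, and \<open>b1\<close>, \<open>b2\<close>
    below move \<open>f r\<close> along \<open>e1\<close>, \<open>e2\<close>.\<close>
  define a1 a2 where "a1 = u1 /\<^sub>R R" and "a2 = u2 /\<^sub>R R"
  have lin: "x1 (t *\<^sub>R h) = t * x1 h" "x2 (t *\<^sub>R h) = t * x2 h" for t h
    by (auto simp: x1_def x2_def algebra_simps)
  have a: "x1 a1 = 1 / R" "x2 a1 = 0" "x1 a2 = 0" "x2 a2 = 1 / R" "snd a1 = S / R" "snd a2 = C / R"
    by (auto simp: a1_def a2_def lin u divide_inverse)
  define b1 b2 where "b1 = b11 *\<^sub>R u1 + b12 *\<^sub>R u2" and "b2 = b21 *\<^sub>R u1 + b22 *\<^sub>R u2"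
  have linadd: "x1 (h + h') = x1 h + x1 h'" "x2 (h + h') = x2 h + x2 h'" for h h'
    by (auto simp: x1_def x2_def algebra_simps)
  have b: "x1 b1 = b11" "x2 b1 = b12" "x1 b2 = b21" "x2 b2 = b22"
    by (auto simp: b1_def b2_def linadd lin u)
  define W11 W22 where "W11 = w \<bullet> F11 r" and "W22 = w \<bullet> F22 r"
  have W12: "w \<bullet> F12 r = 0" by (simp add: F12_def inner_simps wF)
  have W11: "W11 = (H * R'\<^sup>2 + k) * \<sigma> - R'\<^sup>2 * \<Phi>" and W22: "W22 = (H * R'\<^sup>2 - k) * \<sigma> - R'\<^sup>2 * \<Phi>"
    by (simp_all add: W11_def W22_def F11_def F22_def inner_simps wF w_fr \<sigma>_def R'_def)
  have kR: "k = m * R\<^sup>2" using s_pos v_pos[of y] by (simp add: m_def \<mu>_def R_def \<rho>_def y_def[symmetric])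
  have G11: "F11 p \<bullet> f r = l * (S * X1 - C * X2) + (H + m) * R\<^sup>2 * \<Phi> * d - R\<^sup>2 * (1 - d)"
    and G22: "F22 p \<bullet> f r = l * (C * X2 - S * X1) + (H - m) * R\<^sup>2 * \<Phi> * d - R\<^sup>2 * (1 - d)"
  proof -
    have "F11 p \<bullet> f r = l * (S * X1 - C * X2) + (H * R\<^sup>2 + k) * (\<Phi> * d) - R\<^sup>2 * (1 - d)"
      "F22 p \<bullet> f r = l * (C * X2 - S * X1) + (H * R\<^sup>2 - k) * (\<Phi> * d) - R\<^sup>2 * (1 - d)"
      by (simp_all add: F11_def F22_def inner_simps X' N_fr frp l_def y_def R_def[symmetric])
    moreover have "(H * R\<^sup>2 + k) * (\<Phi> * d) = (H + m) * R\<^sup>2 * \<Phi> * d"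
      "(H * R\<^sup>2 - k) * (\<Phi> * d) = (H - m) * R\<^sup>2 * \<Phi> * d"
      using kR by (simp_all add: algebra_simps)
    ultimately show "F11 p \<bullet> f r = l * (S * X1 - C * X2) + (H + m) * R\<^sup>2 * \<Phi> * d - R\<^sup>2 * (1 - d)"
      "F22 p \<bullet> f r = l * (C * X2 - S * X1) + (H - m) * R\<^sup>2 * \<Phi> * d - R\<^sup>2 * (1 - d)" by simp_all
  qed
  have s1: "0 \<le> P2 * (S / R)\<^sup>2 * d - P1 * (S / R) * (X1 / R + X1 / R)
     - 1 / R * (P1 + 2 * m * l) * (S / R) * X1
     - 1 / R * (P - m) * (1 / R * (F11 p \<bullet> f r) + F1 p \<bullet> e1)
     - P1 * (S / R) * (X1 / R) - 1 / R * (P - m) * (F1 p \<bullet> e1)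
     - (b11\<^sup>2 * W11 + b12\<^sup>2 * W22)"
    using second[of a1 b1] unfolding Z''_def a b e_exp
    by (simp add: inner_simps X' e_fp W11_def[symmetric] W22_def[symmetric] W12
        w_def[symmetric] P_def[symmetric] P1_def[symmetric] P2_def[symmetric] m_def[symmetric]
        l_def y_def[symmetric] \<Phi>_def[symmetric] d_def[symmetric] power2_eq_square mult.assoc)
  have s2: "0 \<le> P2 * (C / R)\<^sup>2 * d - P1 * (C / R) * (X2 / R + X2 / R)
     - 1 / R * (P1 - 2 * m * l) * (C / R) * X2
     - 1 / R * (P + m) * (1 / R * (F22 p \<bullet> f r) + F2 p \<bullet> e2)
     - P1 * (C / R) * (X2 / R) - 1 / R * (P + m) * (F2 p \<bullet> e2)
     - (b21\<^sup>2 * W11 + b22\<^sup>2 * W22)"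
    using second[of a2 b2] unfolding Z''_def a b e_exp
    by (simp add: inner_simps X' e_fp W11_def[symmetric] W22_def[symmetric] W12
        w_def[symmetric] P_def[symmetric] P1_def[symmetric] P2_def[symmetric] m_def[symmetric]
        l_def y_def[symmetric] \<Phi>_def[symmetric] d_def[symmetric] power2_eq_square mult.assoc)
  \<comment> \<open>A trace over an orthonormal basis at \<open>f r\<close>: \<open>k\<close>
    cancels, and only the mean curvature at \<open>r\<close> survives.\<close>
  have W: "(b11\<^sup>2 * W11 + b12\<^sup>2 * W22) + (b21\<^sup>2 * W11 + b22\<^sup>2 * W22) = - 2 * P"
  proof -
    have "b11\<^sup>2 + b21\<^sup>2 = 1 / R'\<^sup>2" "b12\<^sup>2 + b22\<^sup>2 = 1 / R'\<^sup>2"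
      using col Rpos by (simp_all add: field_simps)
    moreover have "(b11\<^sup>2 * W11 + b12\<^sup>2 * W22) + (b21\<^sup>2 * W11 + b22\<^sup>2 * W22)
      = (b11\<^sup>2 + b21\<^sup>2) * W11 + (b12\<^sup>2 + b22\<^sup>2) * W22" by (simp add: algebra_simps)
    ultimately have "(b11\<^sup>2 * W11 + b12\<^sup>2 * W22) + (b21\<^sup>2 * W11 + b22\<^sup>2 * W22) = (W11 + W22) / R'\<^sup>2"
      by (simp add: add_divide_distrib)
    also have "\<dots> = 2 * (H * \<sigma>) - 2 * \<Phi>" using Rpos by (simp add: W11 W22 field_simps)
    finally show ?thesis by (simp add: H\<sigma> \<Phi>_def)
  qed
  have X1e: "X1 = P1 * S * d / (P - m)" and X2e: "X2 = P1 * C * d / (P + m)"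
    using XX gap' by (simp_all add: field_simps)
  define T where "T = P2 - 2 * P1\<^sup>2 * (S\<^sup>2 / (P - m) + C\<^sup>2 / (P + m))
     - 2 * R\<^sup>2 * (P * (1 + H\<^sup>2 - m\<^sup>2) + H * (P\<^sup>2 - m\<^sup>2))"
  \<comment> \<open>This is \<open>s1\<close> times \<open>R^2\<close>, with the square of
    \<open>X1\<close> removed by the first-order condition.\<close>
  have s1': "0 \<le> P2 * S\<^sup>2 * d - 2 * P1 * S * X1 - 2 * m * l * S * X1 - (P - m) * (F11 p \<bullet> f r + 2 * R\<^sup>2)
      - R\<^sup>2 * (b11\<^sup>2 * W11 + b12\<^sup>2 * W22)" (is "0 \<le> ?r1")
  proof -
    have "(P - m) * X1\<^sup>2 = P1 * S * d * X1"
      unfolding XX(1)[symmetric] by (simp add: power2_eq_square)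
    then have "(P - m) * X1\<^sup>2 / (R * d) = P1 * S * X1 / R"
      using d_pos Rpos by (simp add: field_simps)
    then have e: "(P - m) * (F1 p \<bullet> e1) = (P - m) * R - P1 * S * X1 / R"
      using Rpos by (simp add: e_Fp right_diff_distrib)
    have "R\<^sup>2 * (P2 * (S / R)\<^sup>2 * d - P1 * (S / R) * (X1 / R + X1 / R)
     - 1 / R * (P1 + 2 * m * l) * (S / R) * X1
     - 1 / R * (1 / R * ((P - m) * (F11 p \<bullet> f r)) + ((P - m) * (F1 p \<bullet> e1)))
     - P1 * (S / R) * (X1 / R) - 1 / R * ((P - m) * (F1 p \<bullet> e1))
     - (b11\<^sup>2 * W11 + b12\<^sup>2 * W22)) = ?r1"
      unfolding e using Rpos by (simp add: field_simps power2_eq_square)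
    moreover have "0 \<le> R\<^sup>2 * (P2 * (S / R)\<^sup>2 * d - P1 * (S / R) * (X1 / R + X1 / R)
     - 1 / R * (P1 + 2 * m * l) * (S / R) * X1
     - 1 / R * (1 / R * ((P - m) * (F11 p \<bullet> f r)) + ((P - m) * (F1 p \<bullet> e1)))
     - P1 * (S / R) * (X1 / R) - 1 / R * ((P - m) * (F1 p \<bullet> e1))
     - (b11\<^sup>2 * W11 + b12\<^sup>2 * W22))"
      using s1 by (intro mult_nonneg_nonneg) (simp_all add: algebra_simps diff_divide_distrib add_divide_distrib)
    ultimately show ?thesis by simp
  qed
  have s2': "0 \<le> P2 * C\<^sup>2 * d - 2 * P1 * C * X2 + 2 * m * l * C * X2 - (P + m) * (F22 p \<bullet> f r + 2 * R\<^sup>2)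
      - R\<^sup>2 * (b21\<^sup>2 * W11 + b22\<^sup>2 * W22)" (is "0 \<le> ?r2")
  proof -
    have "(P + m) * X2\<^sup>2 = P1 * C * d * X2"
      unfolding XX(2)[symmetric] by (simp add: power2_eq_square)
    then have "(P + m) * X2\<^sup>2 / (R * d) = P1 * C * X2 / R"
      using d_pos Rpos by (simp add: field_simps)
    then have e: "(P + m) * (F2 p \<bullet> e2) = (P + m) * R - P1 * C * X2 / R"
      using Rpos by (simp add: e_Fp right_diff_distrib)
    have "R\<^sup>2 * (P2 * (C / R)\<^sup>2 * d - P1 * (C / R) * (X2 / R + X2 / R)
     - 1 / R * (P1 - 2 * m * l) * (C / R) * X2
     - 1 / R * (1 / R * ((P + m) * (F22 p \<bullet> f r)) + ((P + m) * (F2 p \<bullet> e2)))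
     - P1 * (C / R) * (X2 / R) - 1 / R * ((P + m) * (F2 p \<bullet> e2))
     - (b21\<^sup>2 * W11 + b22\<^sup>2 * W22)) = ?r2"
      unfolding e using Rpos by (simp add: field_simps power2_eq_square)
    moreover have "0 \<le> R\<^sup>2 * (P2 * (C / R)\<^sup>2 * d - P1 * (C / R) * (X2 / R + X2 / R)
     - 1 / R * (P1 - 2 * m * l) * (C / R) * X2
     - 1 / R * (1 / R * ((P + m) * (F22 p \<bullet> f r)) + ((P + m) * (F2 p \<bullet> e2)))
     - P1 * (C / R) * (X2 / R) - 1 / R * ((P + m) * (F2 p \<bullet> e2))
     - (b21\<^sup>2 * W11 + b22\<^sup>2 * W22))"
      using s2 by (intro mult_nonneg_nonneg) (simp_all add: algebra_simps diff_divide_distrib add_divide_distrib)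
    ultimately show ?thesis by simp
  qed
  \<comment> \<open>In the sum the terms with \<open>l\<close> cancel against those in
    \<open>G11\<close> and \<open>G22\<close>. By the first-order condition every remaining term
    carries the factor \<open>d\<close>.\<close>
  have "0 \<le> d * T"
  proof -
    have "0 \<le> P2 * (C\<^sup>2 + S\<^sup>2) * d - 2 * P1 * (S * X1 + C * X2)
       - 2 * R\<^sup>2 * \<Phi> * d * (H * P - m\<^sup>2) - 2 * P * R\<^sup>2 * d"
    proof -
      have "0 \<le> P2 * (C\<^sup>2 + S\<^sup>2) * d - 2 * P1 * (S * X1 + C * X2) - 2 * m * l * (S * X1 - C * X2)
         - (P - m) * (F11 p \<bullet> f r) - (P + m) * (F22 p \<bullet> f r) - 4 * P * R\<^sup>2
         - R\<^sup>2 * ((b11\<^sup>2 * W11 + b12\<^sup>2 * W22) + (b21\<^sup>2 * W11 + b22\<^sup>2 * W22))"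
        using add_nonneg_nonneg[OF s1' s2'] by (simp only: algebra_simps)
      then show ?thesis unfolding W G11 G22 by (simp add: algebra_simps power2_eq_square)
    qed
    also have "\<dots> = d * T"
      unfolding CS X1e X2e T_def \<Phi>_def by (simp add: algebra_simps power2_eq_square add_divide_distrib)
    finally show ?thesis .
  qed
  then have T: "0 \<le> T" using d_pos by (simp add: zero_le_mult_iff)
  \<comment> \<open>By the Gauss equation \<open>1 + H^2 - m^2\<close> is the Gaussian curvature;
    \<open>sH\<close> and \<open>k_sq\<close> express it through \<open>v\<close>.\<close>
  have V: "R\<^sup>2 * (1 + H\<^sup>2 - m\<^sup>2) = (v y)\<^sup>2 - q\<^sup>2 / (v y)\<^sup>2"
  proof -
    have "R\<^sup>2 * (1 + H\<^sup>2) = (v y)\<^sup>2 * (s\<^sup>2 * (1 + H\<^sup>2))"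
      by (simp add: R_def \<rho>_def y_def power_mult_distrib)
    also have "\<dots> = (v y)\<^sup>2" using sH by simp
    finally have 1: "R\<^sup>2 * (1 + H\<^sup>2) = (v y)\<^sup>2" .
    have "R\<^sup>2 * m\<^sup>2 = k\<^sup>2 / R\<^sup>2" by (subst kR, use Rpos in \<open>simp add: power2_eq_square\<close>)
    also have "\<dots> = q\<^sup>2 / (v y)\<^sup>2"
      using s_pos v_pos[of y] by (simp add: k_sq R_def \<rho>_def y_def power_mult_distrib)
    finally show ?thesis using 1 by (simp add: algebra_simps)
  qed
  have "2 * R\<^sup>2 * (P * (1 + H\<^sup>2 - m\<^sup>2) + H * (P\<^sup>2 - m\<^sup>2))
      = 2 * P * ((v y)\<^sup>2 - q\<^sup>2 / (v y)\<^sup>2) + 2 * H * R\<^sup>2 * (P\<^sup>2 - m\<^sup>2)"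
    unfolding V[symmetric] by (simp add: algebra_simps)
  with T have "0 \<le> P2 - 2 * P1\<^sup>2 * (S\<^sup>2 / (P - m) + C\<^sup>2 / (P + m))
     - 2 * P * ((v y)\<^sup>2 - q\<^sup>2 / (v y)\<^sup>2) - 2 * H * R\<^sup>2 * (P\<^sup>2 - m\<^sup>2)"
    unfolding T_def by linarith
  then show ?thesis unfolding defs .
qed

section \<open>Bounds for the profile and a family of strict supersolutions\<close>

lemma v_sq_ge: "q\<^sup>2 \<le> (v y)\<^sup>2"
proof (cases "v y = 1")
  case True then show ?thesis using q by simp
next
  case False
  then have "v y < 1" using v_le_1[of y] by simp
  then have "(v y)\<^sup>2 < 1" using v_pos[of y] by (simp add: power_less_one_iff)
  moreover have "0 \<le> (1 - (v y)\<^sup>2) * ((v y)\<^sup>2 - q\<^sup>2)" using vd_sq[of y] by (metis zero_le_power2)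
  ultimately show ?thesis by (simp add: zero_le_mult_iff)
qed

lemma v_sq_le: "(v y)\<^sup>2 \<le> 1"
  using v_pos[of y] v_le_1[of y] by (simp add: power_le_one)

lemma vd_sq_le: "(vd y)\<^sup>2 \<le> 1"
proof -
  have "(1 - (v y)\<^sup>2) * ((v y)\<^sup>2 - q\<^sup>2) \<le> 1 * 1"
    using v_sq_ge[of y] v_sq_le[of y] by (intro mult_mono) (auto, smt (verit) zero_le_power2)
  then show ?thesis by (simp add: vd_sq)
qed

text \<open>The term \<open>- \<delta> * (vd y)\<^sup>2\<close> makes the differential inequality strict also where \<open>vd\<close> vanishes,
  so that no strong maximum principle is needed.\<close>

definition \<omega> :: "real \<Rightarrow> real \<Rightarrow> real \<Rightarrow> real" where "\<omega> \<kappa> \<delta> y = \<kappa> - \<delta> * (vd y)\<^sup>2"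
text \<open>The quotient of the second derivative of \<open>v\<close> by \<open>v\<close>.\<close>

definition accel :: "real \<Rightarrow> real" where "accel y = 1 + q\<^sup>2 - 2 * (v y)\<^sup>2"
text \<open>The cofactor of \<open>- 2 * \<mu> * vd\<close> in the derivative of
  \<open>\<Psi>\<close>; splitting it off makes the gradient term a visible multiple of
  \<open>vd^2\<close>.\<close>

definition slope :: "real \<Rightarrow> real \<Rightarrow> real \<Rightarrow> real" where "slope \<kappa> \<delta> y = \<omega> \<kappa> \<delta> y / v y + \<delta> * v y * accel y"
definition \<Psi> :: "real \<Rightarrow> real \<Rightarrow> real \<Rightarrow> real" where "\<Psi> \<kappa> \<delta> y = \<mu> y * \<omega> \<kappa> \<delta> y"
definition \<Psi>' :: "real \<Rightarrow> real \<Rightarrow> real \<Rightarrow> real" where "\<Psi>' \<kappa> \<delta> y = - 2 * \<mu> y * vd y * slope \<kappa> \<delta> y"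
definition \<Psi>'' :: "real \<Rightarrow> real \<Rightarrow> real \<Rightarrow> real" where
  "\<Psi>'' \<kappa> \<delta> y = \<mu> y * (4 * (vd y)\<^sup>2 * slope \<kappa> \<delta> y / v y - 2 * v y * accel y * slope \<kappa> \<delta> y
     + 2 * (vd y)\<^sup>2 * (\<omega> \<kappa> \<delta> y / (v y)\<^sup>2 + \<delta> * accel y + 4 * \<delta> * (v y)\<^sup>2))"

lemma DERIV_\<omega>: "(\<omega> \<kappa> \<delta> has_real_derivative - 2 * \<delta> * vd y * (v y * accel y)) (at y)"
  unfolding \<omega>_def[abs_def] accel_def
  by (auto intro!: derivative_eq_intros DERIV_vd simp: algebra_simps)

lemma DERIV_\<Psi>: "(\<Psi> \<kappa> \<delta> has_real_derivative \<Psi>' \<kappa> \<delta> y) (at y)"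
  unfolding \<Psi>_def[abs_def] \<Psi>'_def slope_def using v_pos[of y]
  by (auto intro!: derivative_eq_intros DERIV_\<mu> DERIV_\<omega> simp: field_simps)

lemma DERIV_\<Psi>': "(\<Psi>' \<kappa> \<delta> has_real_derivative \<Psi>'' \<kappa> \<delta> y) (at y)"
proof -
  have A: "(accel has_real_derivative - 4 * v y * vd y) (at y)"
    unfolding accel_def[abs_def] by (auto intro!: derivative_eq_intros DERIV_v)
  have B: "(slope \<kappa> \<delta> has_real_derivative
      - vd y * (\<omega> \<kappa> \<delta> y / (v y)\<^sup>2 + \<delta> * accel y + 4 * \<delta> * (v y)\<^sup>2)) (at y)"
    unfolding slope_def[abs_def] using v_pos[of y]
    by (auto intro!: derivative_eq_intros DERIV_v DERIV_\<omega> A simp: field_simps power2_eq_square)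
  show ?thesis
    unfolding \<Psi>'_def[abs_def] \<Psi>''_def
    by (rule derivative_eq_intros DERIV_\<mu> DERIV_vd B refl)+
      (use v_pos[of y] in \<open>simp add: accel_def[symmetric], simp add: field_simps power2_eq_square\<close>)
qed

lemma \<omega>_ge: "0 \<le> \<delta> \<Longrightarrow> \<kappa> - \<delta> \<le> \<omega> \<kappa> \<delta> y"
  using vd_sq_le[of y] mult_left_le[of "(vd y)\<^sup>2" \<delta>] by (simp add: \<omega>_def)

text \<open>For \<open>\<delta> = 0\<close> the terms without \<open>H\<close> add up to
  \<open>m * x * (4 * X / w^2 - 8 * X^2 * D / w^2)\<close>, which is negative for
  \<open>X > 1\<close> and \<open>x > 0\<close> since \<open>D \<ge> 1 / (X + 1)\<close>. The bound
  on \<open>\<kappa>\<close> keeps the errors caused by \<open>\<delta>\<close> smaller than this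
  gain.\<close>

lemma supersolution:
  assumes k: "0 < k" and H: "0 \<le> H" and \<delta>: "0 < \<delta>" and \<kappa>: "1 + 17 * \<delta> \<le> \<kappa>"
  shows "\<Psi>'' \<kappa> \<delta> y - 2 * (\<Psi>' \<kappa> \<delta> y)\<^sup>2 *
       (S\<^sup>2 / (\<Psi> \<kappa> \<delta> y - \<mu> y) + C\<^sup>2 / (\<Psi> \<kappa> \<delta> y + \<mu> y))
     - 2 * \<Psi> \<kappa> \<delta> y * ((v y)\<^sup>2 - q\<^sup>2 / (v y)\<^sup>2)
     - 2 * H * c\<^sup>2 * ((\<Psi> \<kappa> \<delta> y)\<^sup>2 - (\<mu> y)\<^sup>2) < 0" (is "?lhs < 0")
proof -
  define m X a x b w where "m = \<mu> y" and "X = \<omega> \<kappa> \<delta> y" and "a = accel y" and "x = (vd y)\<^sup>2"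
    and "b = slope \<kappa> \<delta> y" and "w = v y"
  have w: "0 < w" "w\<^sup>2 \<le> 1" using v_pos v_sq_le by (auto simp: w_def)
  have m: "0 < m" using k w s_pos by (simp add: m_def \<mu>_def w_def)
  \<comment> \<open>Passing from \<open>\<kappa>\<close> to \<open>X\<close> costs at most
    \<open>\<delta>\<close>. In \<open>neg\<close> below, the gain
    \<open>2 * (X - 1) \<ge> 32 * \<delta>\<close> faces errors of at most
    \<open>(16 + 6 + 8) * \<delta>\<close>.\<close>
  have X: "1 + 16 * \<delta> \<le> X" using \<omega>_ge[of \<delta> \<kappa> y] \<kappa> \<delta> by (simp add: X_def)
  have a: "\<bar>a\<bar> \<le> 1" using v_sq_ge[of y] v_sq_le[of y] q zero_le_power2[of q] unfolding a_def accel_def abs_le_iff by linarith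
  have x: "0 \<le> x" "x = (1 - w\<^sup>2) * (w\<^sup>2 - q\<^sup>2)" by (simp add: x_def) (simp add: x_def w_def vd_sq)
  have b: "b = X / w + \<delta> * w * a" by (simp add: b_def slope_def X_def w_def a_def)
  define D where "D = S\<^sup>2 / (X - 1) + C\<^sup>2 / (X + 1)"
  have X1: "X > 1" using X \<delta> by simp
  \<comment> \<open>The worst case over all principal directions is \<open>S = 0\<close>.\<close>
  have D: "1 / (X + 1) \<le> D"
  proof -
    have "1 / (X + 1) = S\<^sup>2 / (X + 1) + C\<^sup>2 / (X + 1)"
      using CS by (simp add: add_divide_distrib[symmetric] add.commute)
    also have "\<dots> \<le> D" unfolding D_def using X1 by (intro add_right_mono divide_left_mono) auto
    finally show ?thesis .
  qed
  have b2: "X\<^sup>2 / w\<^sup>2 + 2 * X * \<delta> * a \<le> b\<^sup>2"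
  proof -
    have "b\<^sup>2 = X\<^sup>2 / w\<^sup>2 + 2 * X * \<delta> * a + (\<delta> * w * a)\<^sup>2"
      unfolding b using w by (simp add: power2_sum power_divide)
    then show ?thesis by simp
  qed
  have neg: "4 * X / w\<^sup>2 + 6 * \<delta> * a + 8 * \<delta> * w\<^sup>2 - 8 * b\<^sup>2 * D < 0"
  proof -
    have "8 * (X\<^sup>2 / w\<^sup>2 + 2 * X * \<delta> * a) / (X + 1) \<le> 8 * b\<^sup>2 * (1 / (X + 1))"
      using b2 X1 by (simp add: divide_right_mono)
    also have "\<dots> \<le> 8 * b\<^sup>2 * D" using D by (intro mult_left_mono) auto
    finally have 1: "8 * (X\<^sup>2 / w\<^sup>2 + 2 * X * \<delta> * a) / (X + 1) \<le> 8 * b\<^sup>2 * D" .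
    have "4 * X / w\<^sup>2 - 8 * (X\<^sup>2 / w\<^sup>2 + 2 * X * \<delta> * a) / (X + 1)
       = - (4 * X / (w\<^sup>2 * (X + 1))) * (X - 1) - 16 * \<delta> * (X / (X + 1)) * a"
      using w X1 by (simp add: divide_simps) (simp add: algebra_simps power2_eq_square)
    moreover have "2 * (X - 1) \<le> (4 * X / (w\<^sup>2 * (X + 1))) * (X - 1)"
    proof (rule mult_right_mono)
      have "w\<^sup>2 * (X + 1) \<le> 1 * (2 * X)" using w X1 by (intro mult_mono) auto
      then show "2 \<le> 4 * X / (w\<^sup>2 * (X + 1))" using w X1 by (simp add: le_divide_eq mult.commute)
    qed (use X1 in simp)
    moreover have "\<bar>16 * \<delta> * (X / (X + 1)) * a\<bar> \<le> 16 * \<delta> * 1 * 1"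
      unfolding abs_mult using a X1 \<delta> by (intro mult_mono) auto
    moreover have "6 * \<delta> * a \<le> 6 * \<delta>" using a \<delta> by simp
    moreover have "8 * \<delta> * w\<^sup>2 \<le> 8 * \<delta>" using w \<delta> by simp
    ultimately show ?thesis using 1 X \<delta> by argo
  qed
  have eq: "?lhs = m * (x * (4 * X / w\<^sup>2 + 6 * \<delta> * a + 8 * \<delta> * w\<^sup>2 - 8 * b\<^sup>2 * D) - 2 * \<delta> * w\<^sup>2 * a\<^sup>2)
     - 2 * H * c\<^sup>2 * (m\<^sup>2 * (X\<^sup>2 - 1))"
  proof -
    have xw: "x / w\<^sup>2 = 1 + q\<^sup>2 - w\<^sup>2 - q\<^sup>2 / w\<^sup>2"
      unfolding x(2) using w by (simp add: field_simps power2_eq_square)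
    have D': "S\<^sup>2 / (m * X - m) + C\<^sup>2 / (m * X + m) = D / m"
    proof -
      have "m * X - m = m * (X - 1)" "m * X + m = m * (X + 1)" by (simp_all add: algebra_simps)
      then show ?thesis using m X1 by (simp add: D_def add_divide_distrib divide_divide_eq_left mult.commute)
    qed
    have wab: "w * a * b = X * a + \<delta> * w\<^sup>2 * a\<^sup>2" unfolding b using w by (simp add: field_simps power2_eq_square)
    have bw: "b / w = X / w\<^sup>2 + \<delta> * a" unfolding b using w by (simp add: field_simps power2_eq_square)
    \<comment> \<open>The first-order equation for \<open>v\<close> enters here: the terms of order
      zero combine to a multiple of \<open>x = (vd y)^2\<close>.\<close>
    have aw: "X * a + X * (w\<^sup>2 - q\<^sup>2 / w\<^sup>2) = X * (x / w\<^sup>2)" unfolding xw a_def accel_def w_def[symmetric] by (simp add: algebra_simps)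
    have "?lhs = m * (4 * x * b / w - 2 * w * a * b + 2 * x * (X / w\<^sup>2 + \<delta> * a + 4 * \<delta> * w\<^sup>2))
       - 2 * ((- 2 * m * vd y * b)\<^sup>2 * (D / m)) - 2 * (m * X) * (w\<^sup>2 - q\<^sup>2 / w\<^sup>2)
       - 2 * H * c\<^sup>2 * ((m * X)\<^sup>2 - m\<^sup>2)"
      unfolding \<Psi>''_def \<Psi>'_def \<Psi>_def m_def[symmetric] X_def[symmetric] a_def[symmetric]
        x_def[symmetric] b_def[symmetric] w_def[symmetric] D' by (simp only: mult.assoc)
    also have "(- 2 * m * vd y * b)\<^sup>2 * (D / m) = 4 * m * x * b\<^sup>2 * D"
      using m by (simp add: x_def power_mult_distrib power2_eq_square)
    finally have 1: "?lhs = m * (4 * x * (b / w) - 2 * (w * a * b) + 2 * x * (X / w\<^sup>2 + \<delta> * a + 4 * \<delta> * w\<^sup>2))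
       - 8 * m * x * b\<^sup>2 * D - 2 * m * (X * (w\<^sup>2 - q\<^sup>2 / w\<^sup>2)) - 2 * H * c\<^sup>2 * (m\<^sup>2 * (X\<^sup>2 - 1))"
      by (simp add: algebra_simps)
    have 2: "X * (w\<^sup>2 - q\<^sup>2 / w\<^sup>2) = X * (x / w\<^sup>2) - X * a" using aw by simp
    show ?thesis unfolding 1 wab bw 2 by (simp add: algebra_simps)
  qed
  have "x * (4 * X / w\<^sup>2 + 6 * \<delta> * a + 8 * \<delta> * w\<^sup>2 - 8 * b\<^sup>2 * D) - 2 * \<delta> * w\<^sup>2 * a\<^sup>2 < 0"
  proof (cases "x = 0")
    case True
    then have "w\<^sup>2 = 1 \<or> w\<^sup>2 = q\<^sup>2" using x by simp
    \<comment> \<open>At a critical point of \<open>v\<close> the value of \<open>accel\<close> is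
      \<open>q^2 - 1\<close> or \<open>1 - q^2\<close>, so the term with \<open>\<delta>\<close>
      alone gives strictness.\<close>
    then have "a \<noteq> 0" using q by (auto simp: a_def accel_def w_def[symmetric])
    then show ?thesis using True \<delta> w by simp
  next
    case False
    then have "x * (4 * X / w\<^sup>2 + 6 * \<delta> * a + 8 * \<delta> * w\<^sup>2 - 8 * b\<^sup>2 * D) < 0"
      using x(1) neg by (intro mult_pos_neg) auto
    moreover have "0 \<le> 2 * \<delta> * w\<^sup>2 * a\<^sup>2" using \<delta> by simp
    ultimately show ?thesis by linarith
  qed
  then have "m * (x * (4 * X / w\<^sup>2 + 6 * \<delta> * a + 8 * \<delta> * w\<^sup>2 - 8 * b\<^sup>2 * D) - 2 * \<delta> * w\<^sup>2 * a\<^sup>2) < 0"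
    using m by (intro mult_pos_neg)
  moreover have "0 \<le> 2 * H * c\<^sup>2 * (m\<^sup>2 * (X\<^sup>2 - 1))"
    using H X1 by (intro mult_nonneg_nonneg) (auto simp: power_less_one_iff)
  ultimately show ?thesis unfolding eq by linarith
qed

subsection \<open>Touching balls near the diagonal\<close>

lemma continuous_frame: "continuous_on UNIV f" "continuous_on UNIV N" "continuous_on UNIV F1" "continuous_on UNIV F2"
  by (rule has_derivative_continuous_on[OF has_derivative_at_withinI], rule Df DN DF1 DF2)+

lemma continuous_profile: "continuous_on UNIV v" "continuous_on UNIV vd" "continuous_on UNIV \<mu>"
  by (rule DERIV_continuous_on[OF has_field_derivative_at_within], rule DERIV_v DERIV_vd DERIV_\<mu>)+

lemma continuous_snd:
  fixes g :: "real \<Rightarrow> 'c::topological_space"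
  assumes "continuous_on UNIV g"
  shows "continuous_on X (\<lambda>p::real \<times> real. g (snd p))"
  by (intro continuous_on_compose2[OF assms]) (auto intro: continuous_intros)

lemma continuous_second_frame: "continuous_on UNIV F11" "continuous_on UNIV F12" "continuous_on UNIV F22"
  unfolding F11_def F12_def F22_def \<rho>_def
  using v_pos by (auto intro!: continuous_intros continuous_snd continuous_frame continuous_profile
      simp: less_imp_neq[symmetric])

lemma inner_f_le_1: "f p \<bullet> f r \<le> 1"
  using norm_cauchy_schwarz[of "f p" "f r"] frame(1) by (simp add: norm_eq_sqrt_inner)

lemma Z_mono: "\<Psi>1 (snd p) \<le> \<Psi>2 (snd p) \<Longrightarrow> Z \<Psi>1 p r \<le> Z \<Psi>2 p r"
  using inner_f_le_1[of p r] by (simp add: Z_def mult_right_mono)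

text \<open>For fixed \<open>p\<close>, the function \<open>r \<mapsto> Z \<psi> p r\<close> and its
  gradient vanish at \<open>r = p\<close>. Its Hessian there has the eigenvalues
  \<open>(\<psi> - \<mu>) * \<rho>^2\<close> and \<open>(\<psi> + \<mu>) * \<rho>^2\<close> and
  stays positive definite nearby, so \<open>Z\<close> is strictly convex on the segment from
  \<open>p\<close> to \<open>r\<close>.\<close>

lemma near_diagonal:
  assumes \<psi>: "\<And>y. (\<psi> has_real_derivative \<psi>' y) (at y)" and \<psi>': "\<And>y. (\<psi>' has_real_derivative \<psi>'' y) (at y)"
    and gap: "\<bar>\<mu> (snd p0)\<bar> < \<psi> (snd p0)"
  shows "\<exists>\<epsilon>>0. \<forall>p\<in>ball p0 \<epsilon>. \<forall>r\<in>ball p0 \<epsilon>. p \<noteq> r \<longrightarrow> 0 < Z \<psi> p r"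
proof -
  define w where "w p = (H + \<psi> (snd p)) *\<^sub>R f p + N p" for p
  \<comment> \<open>The entries of the Hessian in \<open>r\<close> with respect to the principal
    directions.\<close>
  define a b c where "a pr = - (w (fst pr) \<bullet> F11 (snd pr))" and "b pr = - (w (fst pr) \<bullet> F12 (snd pr))"
    and "c pr = - (w (fst pr) \<bullet> F22 (snd pr))" for pr
  have "continuous_on UNIV \<psi>" by (rule DERIV_continuous_on[OF has_field_derivative_at_within[OF \<psi>]])
  then have contw: "continuous_on UNIV w"
    unfolding w_def by (intro continuous_intros continuous_frame continuous_snd)
  have cont: "continuous_on UNIV a" "continuous_on UNIV b" "continuous_on UNIV c"
    unfolding a_def b_def c_def
    by (intro continuous_intros continuous_on_compose2[OF contw] continuous_on_compose2[OF continuous_second_frame(1)]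
       continuous_on_compose2[OF continuous_second_frame(2)] continuous_on_compose2[OF continuous_second_frame(3)]; simp)+
  define m R where "m = \<mu> (snd p0)" and "R = \<rho> p0"
  have kR: "k = m * R\<^sup>2" using s_pos v_pos[of "snd p0"] by (simp add: m_def \<mu>_def R_def \<rho>_def)
  define Y where "Y = \<psi> (snd p0)"
  have Y: "\<bar>m\<bar> < Y" using gap by (simp add: m_def Y_def)
  have R: "0 < R\<^sup>2" using \<rho>_pos[of p0] by (simp add: R_def)
  have w0: "w p0 \<bullet> f p0 = H + Y" "w p0 \<bullet> N p0 = 1" "w p0 \<bullet> F1 p0 = 0" "w p0 \<bullet> F2 p0 = 0"
    by (simp_all add: w_def Y_def inner_simps frame frame')
  have a0: "a (p0, p0) = (Y - m) * R\<^sup>2" and c0: "c (p0, p0) = (Y + m) * R\<^sup>2" and b0: "b (p0, p0) = 0"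
    unfolding a_def b_def c_def F11_def F12_def F22_def
    using kR by (simp_all add: inner_simps w0 R_def[symmetric], simp_all add: algebra_simps)
  \<comment> \<open>Half the smaller eigenvalue on the diagonal. The bounds \<open>e\<close> for
    \<open>a\<close>, \<open>c\<close> and \<open>e / 2\<close> for \<open>b\<close> leave a form
    that is at least \<open>e / 2\<close> times the square of the length.\<close>
  define e where "e = (Y - \<bar>m\<bar>) * R\<^sup>2 / 2"
  have e: "0 < e" using Y R by (simp add: e_def)
  have "isCont a (p0, p0)" "isCont b (p0, p0)" "isCont c (p0, p0)"
    using cont continuous_on_eq_continuous_at[OF open_UNIV] by blast+
  then have "\<forall>\<^sub>F pr in at (p0, p0). dist (a pr) (a (p0, p0)) < e \<and> dist (b pr) (b (p0, p0)) < e/2 \<and> dist (c pr) (c (p0, p0)) < e"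
    unfolding isCont_def using e by (intro eventually_conj tendstoD) simp_all
  then obtain d where d: "0 < d" and dd: "\<And>pr. dist pr (p0, p0) < d \<Longrightarrow> pr \<noteq> (p0, p0) \<Longrightarrow>
      dist (a pr) (a (p0, p0)) < e \<and> dist (b pr) (b (p0, p0)) < e/2 \<and> dist (c pr) (c (p0, p0)) < e"
    unfolding eventually_at by auto
  have near: "e \<le> a (p, r) \<and> \<bar>b (p, r)\<bar> \<le> e / 2 \<and> e \<le> c (p, r)" if "p \<in> ball p0 (d/2)" "r \<in> ball p0 (d/2)" for p r
  proof -
    have "dist (p, r) (p0, p0) \<le> dist p p0 + dist r p0"
      by (simp add: dist_Pair_Pair sqrt_sum_squares_le_sum)
    then have "dist (p, r) (p0, p0) < d" using that by (simp add: dist_commute)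
    from dd[OF this] have "dist (a (p, r)) (a (p0, p0)) < e \<and> dist (b (p, r)) (b (p0, p0)) < e/2 \<and> dist (c (p, r)) (c (p0, p0)) < e"
      using e by (cases "(p, r) = (p0, p0)") auto
    moreover have "2 * e \<le> a (p0, p0)" "2 * e \<le> c (p0, p0)"
      using R by (auto simp: a0 c0 e_def intro!: mult_right_mono)
    ultimately show ?thesis by (auto simp: dist_real_def b0)
  qed
  have "0 < Z \<psi> p r" if p: "p \<in> ball p0 (d/2)" and r: "r \<in> ball p0 (d/2)" and pr: "p \<noteq> r" for p r
  proof -
    define h where "h = r - p"
    have h: "0 < (x1 h)\<^sup>2 + (x2 h)\<^sup>2"
    proof -
      have "(x1 h)\<^sup>2 + (x2 h)\<^sup>2 = (C\<^sup>2 + S\<^sup>2) * ((fst h)\<^sup>2 + (snd h)\<^sup>2)"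
        by (simp add: x1_def x2_def power2_eq_square algebra_simps)
      moreover have "h \<noteq> 0" using pr by (simp add: h_def)
      ultimately show ?thesis
        by (cases h) (auto simp: CS sum_power2_gt_zero_iff zero_prod_def)
    qed
    define g where "g t = Z \<psi> p (p + t *\<^sub>R h)" for t
    define g' where "g' t = Z' \<psi> \<psi>' 0 h p (p + t *\<^sub>R h)" for t
    define g'' where "g'' t = Z'' \<psi> \<psi>' \<psi>'' 0 h p (p + t *\<^sub>R h)" for t
    have g: "(g has_real_derivative g' t) (at t)" for t
      using DERIV_Z_line[of "\<psi>" "\<psi>'", OF \<psi>, where p = p and a = 0 and r = p and b = h]
      unfolding g_def[abs_def] g'_def by simp
    have g': "(g' has_real_derivative g'' t) (at t)" for t
      using DERIV_Z'_line[of "\<psi>" "\<psi>'" "\<psi>''", OF \<psi> \<psi>', where p = p and a = 0 and r = p and b = h]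
      unfolding g'_def[abs_def] g''_def by simp
    have g''_pos: "0 < g'' t" if t: "0 \<le> t" "t \<le> 1" for t
    proof -
      have "p + t *\<^sub>R h = (1 - t) *\<^sub>R p + t *\<^sub>R r" by (simp add: h_def algebra_simps)
      also have "\<dots> \<in> ball p0 (d/2)" using p r t by (intro convexD[OF convex_ball]) auto
      finally have nr: "e \<le> a (p, p + t *\<^sub>R h) \<and> \<bar>b (p, p + t *\<^sub>R h)\<bar> \<le> e / 2 \<and> e \<le> c (p, p + t *\<^sub>R h)"
        using near p by blast
      have "g'' t = (x1 h)\<^sup>2 * a (p, p + t *\<^sub>R h) + 2 * (x1 h * x2 h * b (p, p + t *\<^sub>R h)) + (x2 h)\<^sup>2 * c (p, p + t *\<^sub>R h)"
        unfolding g''_def Z''_def w_def[symmetric] a_def b_def c_def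
        by (simp only: inner_simps) (simp add: x1_def[of 0] x2_def[of 0] power2_eq_square algebra_simps)
      moreover have "(x1 h)\<^sup>2 * e \<le> (x1 h)\<^sup>2 * a (p, p + t *\<^sub>R h)" "(x2 h)\<^sup>2 * e \<le> (x2 h)\<^sup>2 * c (p, p + t *\<^sub>R h)"
        using nr by (auto intro: mult_left_mono)
      moreover have "\<bar>x1 h * x2 h * b (p, p + t *\<^sub>R h)\<bar> \<le> \<bar>x1 h * x2 h\<bar> * (e / 2)"
        unfolding abs_mult[of "x1 h * x2 h"] using nr by (intro mult_left_mono) auto
      moreover have "0 \<le> ((x1 h)\<^sup>2 + (x2 h)\<^sup>2 - 2 * \<bar>x1 h * x2 h\<bar>) * (e / 2)"
      proof (rule mult_nonneg_nonneg)
        have "0 \<le> (\<bar>x1 h\<bar> - \<bar>x2 h\<bar>)\<^sup>2" by simp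
        then show "0 \<le> (x1 h)\<^sup>2 + (x2 h)\<^sup>2 - 2 * \<bar>x1 h * x2 h\<bar>"
          by (simp add: power2_diff abs_mult)
      qed (use e in simp)
      moreover have "0 < ((x1 h)\<^sup>2 + (x2 h)\<^sup>2) * (e / 2)" using h e by simp
      ultimately show ?thesis by (simp add: algebra_simps abs_le_iff)
    qed
    have g'0: "g' 0 = 0" by (simp add: g'_def Z'_def x1_def[of 0] x2_def[of 0] frame frame')
    have g0: "g 0 = 0" by (simp add: g_def Z_def frame frame')
    have g'_pos: "0 < g' t" if t: "0 < t" "t \<le> 1" for t
    proof -
      have "\<exists>z>0. z < t \<and> g' t - g' 0 = (t - 0) * g'' z" using t by (intro MVT2 g') auto
      then obtain z where z: "0 < z" "z < t" "g' t = t * g'' z" using g'0 by auto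
      then show ?thesis using t g''_pos[of z] by simp
    qed
    have "\<exists>z>0. z < 1 \<and> g 1 - g 0 = (1 - 0) * g' z" by (intro MVT2 g) auto
    then have "g 0 < g 1" using g'_pos by fastforce
    then show ?thesis using g0 by (simp add: g_def h_def)
  qed
  then show ?thesis using d by (intro exI[of _ "d/2"]) auto
qed

text \<open>In the direction of \<open>F1\<close>, \<open>Z\<close> vanishes to second order at
  \<open>p\<close>, since the ball has the principal curvature of this direction. Its third
  derivative is \<open>- (\<rho> p)^2\<close> times the derivative of \<open>\<mu>\<close> in this
  direction, and a minimum forces it to vanish.\<close>

lemma third_order_condition:
  assumes nonneg: "\<And>p r. 0 \<le> Z \<mu> p r" and k: "0 < k"
  shows "S * vd y = 0"
proof -
  define p :: "real \<times> real" where "p = (0, y)"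
  define h where "h = (C, S)"
  have h: "x1 h = 1" "x2 h = 0" "x1 0 = 0" "x2 0 = 0" "snd h = S"
    using CS by (simp_all add: h_def x1_def x2_def power2_eq_square)
  \<comment> \<open>Makes the derivative rules for \<open>\<Psi>\<close> available for
    \<open>\<mu>\<close>.\<close>
  have \<Psi>1: "\<Psi> 1 0 = \<mu>" by (simp add: \<Psi>_def \<omega>_def fun_eq_iff)
  define w where "w = (H + \<mu> y) *\<^sub>R f p + N p"
  have w: "w \<bullet> f p = H + \<mu> y" "w \<bullet> N p = 1" "w \<bullet> F1 p = 0" "w \<bullet> F2 p = 0"
    by (simp_all add: w_def inner_simps frame frame')
  define g where "g t = Z \<mu> p (p + t *\<^sub>R h)" for t
  define g' where "g' t = Z' \<mu> (\<Psi>' 1 0) 0 h p (p + t *\<^sub>R h)" for t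
  define g'' where "g'' t = Z'' \<mu> (\<Psi>' 1 0) (\<Psi>'' 1 0) 0 h p (p + t *\<^sub>R h)" for t
  have g: "(g has_real_derivative g' t) (at t)" for t
    using DERIV_Z_line[of "\<mu>" "\<Psi>' 1 0", OF DERIV_\<Psi>[of 1 0, unfolded \<Psi>1], where p = p and a = 0 and r = p and b = h]
    unfolding g_def[abs_def] g'_def by simp
  have g': "(g' has_real_derivative g'' t) (at t)" for t
    using DERIV_Z'_line[of "\<mu>" "\<Psi>' 1 0" "\<Psi>'' 1 0", OF DERIV_\<Psi>[of 1 0, unfolded \<Psi>1] DERIV_\<Psi>',
        where p = p and a = 0 and r = p and b = h]
    unfolding g'_def[abs_def] g''_def by simp
  have g'': "g'' t = - (w \<bullet> F11 (p + t *\<^sub>R h))" for t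
    by (simp add: g''_def Z''_def h w_def p_def)
  have k\<mu>: "k = \<mu> y * (\<rho> p)\<^sup>2" using s_pos v_pos[of y] by (simp add: \<mu>_def \<rho>_def p_def)
  have z: "w \<bullet> F11 p = 0" "w \<bullet> F12 p = 0"
    using k\<mu> by (simp_all add: F11_def F12_def inner_simps w algebra_simps)
  have lw: "((\<lambda>t. w \<bullet> X (p + t *\<^sub>R h)) has_real_derivative w \<bullet> X') (at 0)"
    if "((\<lambda>t. X (p + t *\<^sub>R h)) has_vector_derivative X') (at 0)" for X X'
    using has_real_derivative_inner[OF has_vector_derivative_const that] by simp
  have Dl: "((\<lambda>t. vd (snd (p + t *\<^sub>R h)) / v (snd (p + t *\<^sub>R h))) has_real_derivative
     (v y * (1 + q\<^sup>2 - 2 * (v y)\<^sup>2) * v y - vd y * vd y) / (v y * v y) * S) (at 0)"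
    using v_pos[of y] DERIV_line[of "\<lambda>y. vd y / v y" "\<lambda>y. (v y * (1 + q\<^sup>2 - 2 * (v y)\<^sup>2) * v y - vd y * vd y) / (v y * v y)" p h 0]
    by (force intro!: derivative_eq_intros DERIV_v DERIV_vd simp: p_def h less_imp_neq[OF v_pos, symmetric])
  have D\<rho>: "((\<lambda>t. (\<rho> (p + t *\<^sub>R h))\<^sup>2) has_real_derivative 2 * s\<^sup>2 * v y * vd y * S) (at 0)"
    using DERIV_line[of "\<lambda>y. (s * v y)\<^sup>2" "\<lambda>y. 2 * s\<^sup>2 * v y * vd y" p h 0] unfolding \<rho>_def
    by (force intro!: derivative_eq_intros DERIV_v simp: p_def h power2_eq_square)
  have "((\<lambda>t. w \<bullet> F11 (p + t *\<^sub>R h)) has_real_derivative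
      - \<mu> y * (2 * s\<^sup>2 * v y * vd y * S)) (at 0)"
    unfolding F11_def inner_simps
    by (rule derivative_eq_intros Dl D\<rho> lw line_f line_N line_F1 line_F2 refl)+
      (simp add: h inner_simps w z algebra_simps)
  then have "(g'' has_real_derivative \<mu> y * (2 * s\<^sup>2 * v y * vd y * S)) (at 0)"
    unfolding g'' [abs_def] using DERIV_minus by fastforce
  from nonneg_third_derivative[OF g g' this]
  have "\<mu> y * (2 * s\<^sup>2 * v y * vd y * S) = 0"
    using nonneg by (simp add: g_def g'_def g'' Z_def Z'_def h frame frame' z)
  moreover have "\<mu> y \<noteq> 0" using k s_pos v_pos[of y] by (simp add: \<mu>_def)
  ultimately show ?thesis using s_pos v_pos[of y] by auto
qed

end

section \<open>Rotational surfaces\<close>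

text \<open>For orthonormal \<open>a\<close>, \<open>b\<close> this is the rotation by
  \<open>t\<close> in their plane, written as a displacement so that the orthogonal complement is
  visibly fixed.\<close>

definition plane_rotation :: "real^4 \<Rightarrow> real^4 \<Rightarrow> real \<Rightarrow> real^4 \<Rightarrow> real^4" where
  "plane_rotation a b t z = z + ((cos t - 1) * (z \<bullet> a) - sin t * (z \<bullet> b)) *\<^sub>R a
     + (sin t * (z \<bullet> a) + (cos t - 1) * (z \<bullet> b)) *\<^sub>R b"

lemma one_param_plane_rotation:
  assumes ab: "a \<bullet> a = 1" "b \<bullet> b = 1" "a \<bullet> b = 0"
  shows "one_param_isometry_group (\<lambda>t. plane_rotation a b (c * t))"
  unfolding one_param_isometry_group_def
proof (intro conjI allI)
  have ba: "b \<bullet> a = 0" using ab by (simp add: inner_commute)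
  have coord: "plane_rotation a b t z \<bullet> a = cos t * (z \<bullet> a) - sin t * (z \<bullet> b)"
    "plane_rotation a b t z \<bullet> b = sin t * (z \<bullet> a) + cos t * (z \<bullet> b)" for t z
    by (simp_all add: plane_rotation_def inner_simps ab ba algebra_simps)
  show "orthogonal_transformation (plane_rotation a b (c * t))" for t
    unfolding orthogonal_transformation_def
  proof (intro conjI allI)
    show "linear (plane_rotation a b (c * t))"
      by (intro linearI) (simp_all add: plane_rotation_def inner_simps algebra_simps)
    show "plane_rotation a b (c * t) v \<bullet> plane_rotation a b (c * t) w = v \<bullet> w" for v w
    proof -
      define \<tau> sn cs where "\<tau> = c * t" and "sn = sin \<tau>" and "cs = cos \<tau>"
      have "plane_rotation a b \<tau> v \<bullet> plane_rotation a b \<tau> w = plane_rotation a b \<tau> v \<bullet> w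
          + ((cos \<tau> - 1) * (w \<bullet> a) - sin \<tau> * (w \<bullet> b)) * (plane_rotation a b \<tau> v \<bullet> a)
          + (sin \<tau> * (w \<bullet> a) + (cos \<tau> - 1) * (w \<bullet> b)) * (plane_rotation a b \<tau> v \<bullet> b)"
        by (subst (2) plane_rotation_def) (simp add: inner_simps)
      also have "plane_rotation a b \<tau> v \<bullet> w = v \<bullet> w
          + ((cos \<tau> - 1) * (v \<bullet> a) - sin \<tau> * (v \<bullet> b)) * (w \<bullet> a)
          + (sin \<tau> * (v \<bullet> a) + (cos \<tau> - 1) * (v \<bullet> b)) * (w \<bullet> b)"
        by (simp add: plane_rotation_def inner_simps inner_commute)
      finally have "plane_rotation a b \<tau> v \<bullet> plane_rotation a b \<tau> w = v \<bullet> w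
          + (sn\<^sup>2 + cs\<^sup>2 - 1) * ((v \<bullet> a) * (w \<bullet> a) + (v \<bullet> b) * (w \<bullet> b))"
        unfolding coord sn_def[symmetric] cs_def[symmetric] by (simp add: algebra_simps power2_eq_square)
      then have "plane_rotation a b \<tau> v \<bullet> plane_rotation a b \<tau> w = v \<bullet> w" by (simp add: sn_def cs_def)
      then show ?thesis by (simp add: \<tau>_def)
    qed
  qed
  show "plane_rotation a b (c * (s + t)) = plane_rotation a b (c * s) \<circ> plane_rotation a b (c * t)" for s t
  proof
    fix z
    define \<sigma> \<tau> where "\<sigma> = c * s" and "\<tau> = c * t"
    have "plane_rotation a b \<sigma> (plane_rotation a b \<tau> z) = plane_rotation a b \<tau> z
        + ((cos \<sigma> - 1) * (cos \<tau> * (z \<bullet> a) - sin \<tau> * (z \<bullet> b)) - sin \<sigma> * (sin \<tau> * (z \<bullet> a) + cos \<tau> * (z \<bullet> b))) *\<^sub>R a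
        + (sin \<sigma> * (cos \<tau> * (z \<bullet> a) - sin \<tau> * (z \<bullet> b)) + (cos \<sigma> - 1) * (sin \<tau> * (z \<bullet> a) + cos \<tau> * (z \<bullet> b))) *\<^sub>R b"
      by (subst plane_rotation_def) (simp add: coord)
    also have "\<dots> = plane_rotation a b (\<sigma> + \<tau>) z"
      by (simp add: plane_rotation_def cos_add sin_add algebra_simps)
    finally show "plane_rotation a b (c * (s + t)) z = (plane_rotation a b (c * s) \<circ> plane_rotation a b (c * t)) z"
      by (simp add: \<sigma>_def \<tau>_def algebra_simps)
  qed
  show "continuous_on UNIV (\<lambda>t. plane_rotation a b (c * t) z)" for z
    unfolding plane_rotation_def by (intro continuous_intros)
qed

lemma geodesic_orthogonal_plane:
  assumes ab: "a \<bullet> a = 1" "b \<bullet> b = 1" "a \<bullet> b = (0::real)"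
  shows "geodesic_S3 ({z. z \<bullet> a = 0 \<and> z \<bullet> b = 0} \<inter> sphere 0 1)"
  unfolding geodesic_S3_def
proof (intro exI conjI)
  show "subspace {z. z \<bullet> a = 0 \<and> z \<bullet> b = 0}" by (auto simp: subspace_def inner_simps)
  have ne: "a \<noteq> b" using ab by auto
  have "pairwise orthogonal {a, b}" using ab by (auto simp: pairwise_def orthogonal_def inner_commute)
  moreover have "0 \<notin> {a, b}" using ab by auto
  ultimately have "independent {a, b}" by (rule pairwise_orthogonal_independent)
  then have "dim (span {a, b}) = 2" using ne by (simp add: dim_eq_card_independent)
  moreover have "{z. z \<bullet> a = 0 \<and> z \<bullet> b = 0} = {y \<in> UNIV. \<forall>x\<in>span {a, b}. orthogonal x y}"
  proof (intro equalityI subsetI CollectI conjI ballI UNIV_I)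
    fix z x assume "z \<in> {z. z \<bullet> a = 0 \<and> z \<bullet> b = 0}" "x \<in> span {a, b}"
    then show "orthogonal x z"
      using orthogonal_to_span[of x "{a, b}" z] by (auto simp: orthogonal_def inner_commute)
  qed (auto simp: orthogonal_def inner_commute span_base)
  ultimately show "dim {z. z \<bullet> a = 0 \<and> z \<bullet> b = 0} = 2"
    using dim_subspace_orthogonal_to_vectors[of "span {a, b}" UNIV] by simp
qed simp

context dn_surface
begin

text \<open>Here \<open>F1\<close> is the \<open>x\<close>-derivative of \<open>f\<close>, and
  \<open>F1 / v\<close> depends on \<open>x\<close> only. It solves the oscillator equation, hence
  turns uniformly in a fixed plane. Integration in \<open>x\<close> shows that the
  \<open>x\<close>-curves are circles parallel to this plane with centres orthogonal to it, so they
  are orbits of rotations.\<close>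

lemma rotational_if_x_principal:
  assumes CS10: "C = 1" "S = 0"
  shows "rotational f"
proof -
  have xs: "x1 h = fst h" "x2 h = snd h" for h unfolding x1_def x2_def by (simp_all add: CS10)
  have F12': "F12 p = (vd (snd p) / v (snd p)) *\<^sub>R F1 p"
    and F11': "F11 p = - (vd (snd p) / v (snd p)) *\<^sub>R F2 p + (H * (s * v (snd p))\<^sup>2 + k) *\<^sub>R N p - (s * v (snd p))\<^sup>2 *\<^sub>R f p"
    for p unfolding F12_def F11_def \<rho>_def by (simp_all add: CS10)
  define E where "E x = F1 (x, 0) /\<^sub>R v 0" for x
  have F1_E: "F1 (x, y) = v y *\<^sub>R E x" for x y
  proof -
    have "((\<lambda>t. F1 (x, t) /\<^sub>R v t) has_vector_derivative 0) (at t)" for t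
    proof -
      have "((\<lambda>t. F1 (x, t)) has_vector_derivative F12 (x, t)) (at t)"
        using line_F1[of "(x, 0)" "(0, 1)" t] by (simp add: xs)
      moreover have "((\<lambda>t. inverse (v t)) has_vector_derivative - (vd t / (v t * v t))) (at t)"
        using DERIV_inverse'[OF DERIV_v, of t] v_pos[of t]
        by (simp add: has_real_derivative_iff_has_vector_derivative divide_inverse mult_ac)
      ultimately have "((\<lambda>t. inverse (v t) *\<^sub>R F1 (x, t)) has_vector_derivative
          inverse (v t) *\<^sub>R F12 (x, t) + (- (vd t / (v t * v t))) *\<^sub>R F1 (x, t)) (at t)"
        by (rule has_vector_derivative_scaleR[rotated, unfolded has_real_derivative_iff_has_vector_derivative])
      then show ?thesis by (simp add: F12' divide_inverse mult_ac)
    qed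
    from vector_derivative_zero_constant[OF this, of y 0] have "E x = F1 (x, y) /\<^sub>R v y" by (simp add: E_def)
    then show ?thesis using v_pos[of y] by simp
  qed
  define G where "G x = F11 (x, 0) /\<^sub>R v 0" for x
  define l R where "l = vd 0 / v 0" and "R = (s * v 0)\<^sup>2"
  have R: "0 < R" using s_pos v_pos[of 0] by (simp add: R_def)
  \<comment> \<open>The \<open>x\<close>-derivatives of \<open>F2\<close>, \<open>N\<close> and
    \<open>f\<close> are multiples of \<open>F1\<close>; \<open>c^2\<close> collects their
    contributions to the derivative of \<open>G\<close>, one summand each.\<close>
  define c where "c = sqrt (l\<^sup>2 + (H * R + k)\<^sup>2 / R + R)"
  have c2: "c\<^sup>2 = l\<^sup>2 + (H * R + k)\<^sup>2 / R + R" using R by (simp add: c_def add_nonneg_nonneg)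
  have "0 < l\<^sup>2 + (H * R + k)\<^sup>2 / R + R" using R by (intro add_nonneg_pos) auto
  then have c: "0 < c" by (simp add: c_def)
  have E: "(E has_vector_derivative G x) (at x)" for x
    unfolding E_def[abs_def] G_def
    by (rule bounded_linear.has_vector_derivative[OF bounded_linear_scaleR_right])
      (use line_F1[of "(0, 0)" "(1, 0)" x] in \<open>simp add: xs\<close>)
  have G: "(G has_vector_derivative - (c\<^sup>2) *\<^sub>R E x) (at x)" for x
  proof -
    have "F11 (x, 0) = (- l) *\<^sub>R F2 (x, 0) + (H * R + k) *\<^sub>R N (x, 0) - R *\<^sub>R f (x, 0)" for x
      by (simp add: F11' l_def R_def)
    then have Ge: "G = (\<lambda>x. ((- l) *\<^sub>R F2 (x, 0) + (H * R + k) *\<^sub>R N (x, 0) - R *\<^sub>R f (x, 0)) /\<^sub>R v 0)"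
      by (simp add: G_def fun_eq_iff)
    have "((\<lambda>x. F2 (x, 0)) has_vector_derivative l *\<^sub>R F1 (x, 0)) (at x)"
      using line_F2[of "(0, 0)" "(1, 0)" x] by (simp add: xs F12' l_def)
    moreover have "((\<lambda>x. N (x, 0)) has_vector_derivative (- (H + k / R)) *\<^sub>R F1 (x, 0)) (at x)"
      using line_N[of "(0, 0)" "(1, 0)" x] by (simp add: xs \<mu>_def R_def)
    moreover have "((\<lambda>x. f (x, 0)) has_vector_derivative F1 (x, 0)) (at x)"
      using line_f[of "(0, 0)" "(1, 0)" x] by (simp add: xs)
    ultimately have "(G has_vector_derivative ((- l) *\<^sub>R l *\<^sub>R F1 (x, 0)
        + (H * R + k) *\<^sub>R (- (H + k / R)) *\<^sub>R F1 (x, 0) - R *\<^sub>R F1 (x, 0)) /\<^sub>R v 0) (at x)"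
      unfolding Ge by (intro has_vector_derivative_add has_vector_derivative_diff
          bounded_linear.has_vector_derivative[OF bounded_linear_scaleR_right])
    moreover have "((- l) *\<^sub>R l *\<^sub>R F1 (x, 0)
        + (H * R + k) *\<^sub>R (- (H + k / R)) *\<^sub>R F1 (x, 0) - R *\<^sub>R F1 (x, 0)) /\<^sub>R v 0 = - (c\<^sup>2) *\<^sub>R E x"
    proof -
      have "(H * R + k) * (H + k / R) = (H * R + k)\<^sup>2 / R" using R by (simp add: field_simps power2_eq_square)
      then have "c\<^sup>2 = l * l + (H * R + k) * (H + k / R) + R" unfolding c2 by (simp add: power2_eq_square)
      then show ?thesis by (simp add: E_def algebra_simps)
    qed
    ultimately show ?thesis by simp
  qed
  define a b where "a = E 0 /\<^sub>R s" and "b = G 0 /\<^sub>R (c * s)"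
  have EE: "E x \<bullet> E x = s\<^sup>2" for x
    using v_pos[of 0] frame(9)[of "(x, 0)"] by (simp add: E_def power2_eq_square) (simp add: field_simps)
  have EG: "E x \<bullet> G x = 0" for x
  proof -
    have "((\<lambda>x. E x \<bullet> E x) has_real_derivative E x \<bullet> G x + G x \<bullet> E x) (at x)"
      by (rule has_real_derivative_inner[OF E E])
    then have "E x \<bullet> G x + G x \<bullet> E x = 0" unfolding EE using DERIV_const DERIV_unique by blast
    then show ?thesis by (simp add: inner_commute)
  qed
  have GG: "G x \<bullet> G x = c\<^sup>2 * s\<^sup>2" for x
  proof -
    have "((\<lambda>x. E x \<bullet> G x) has_real_derivative E x \<bullet> (- (c\<^sup>2) *\<^sub>R E x) + G x \<bullet> G x) (at x)"
      by (rule has_real_derivative_inner[OF E G])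
    then have "E x \<bullet> (- (c\<^sup>2) *\<^sub>R E x) + G x \<bullet> G x = 0" unfolding EG using DERIV_const DERIV_unique by blast
    then show ?thesis by (simp add: EE)
  qed
  have ab: "a \<bullet> a = 1" "b \<bullet> b = 1" "a \<bullet> b = 0"
    using s_pos c EE[of 0] EG[of 0] GG[of 0] by (simp_all add: a_def b_def power2_eq_square) (simp_all add: field_simps)
  have ba: "b \<bullet> a = 0" using ab by (simp add: inner_commute)
  have E_ab: "E x = s *\<^sub>R (cos (c * x) *\<^sub>R a + sin (c * x) *\<^sub>R b)" for x
  proof -
    have E0: "E 0 = s *\<^sub>R a" "G 0 = (c * s) *\<^sub>R b" using c s_pos by (simp_all add: a_def b_def divide_inverse[symmetric] flip: inverse_mult_distrib)
    show ?thesis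
      using harmonic_oscillator[OF E G, of x] c unfolding E0 by (simp add: scaleR_add_right mult.commute)
  qed
  \<comment> \<open>The centre of the circle \<open>x \<mapsto> f (x, y)\<close>.\<close>
  define g where "g y = f (0, y) + (v y * s / c) *\<^sub>R b" for y
  have f_eq: "f (x, y) = g y + (v y * s / c) *\<^sub>R (sin (c * x) *\<^sub>R a - cos (c * x) *\<^sub>R b)" for x y
  proof -
    have "((\<lambda>x. f (x, y) - (v y * s / c) *\<^sub>R (sin (c * x) *\<^sub>R a - cos (c * x) *\<^sub>R b)) has_vector_derivative 0) (at x)" for x
    proof -
      have f1: "((\<lambda>x. f (x, y)) has_vector_derivative v y *\<^sub>R E x) (at x)"
        using line_f[of "(0, y)" "(1, 0)" x] by (simp add: xs F1_E)
      have "((\<lambda>x. sin (c * x) *\<^sub>R a - cos (c * x) *\<^sub>R b) has_vector_derivative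
         (c * cos (c * x)) *\<^sub>R a + (c * sin (c * x)) *\<^sub>R b) (at x)"
        by (rule derivative_eq_intros refl | simp)+ (simp add: algebra_simps)
      note d = has_vector_derivative_diff[OF f1 bounded_linear.has_vector_derivative[OF bounded_linear_scaleR_right this]]
      have "(v y * s / c) *\<^sub>R ((c * cos (c * x)) *\<^sub>R a + (c * sin (c * x)) *\<^sub>R b) = v y *\<^sub>R E x"
        using c by (simp add: E_ab scaleR_add_right)
      then show ?thesis using d[of "v y * s / c"] by simp
    qed
    from vector_derivative_zero_constant[OF this, of x 0] show ?thesis
      by (simp add: g_def algebra_simps)
  qed
  have g: "g y \<bullet> a = 0" "g y \<bullet> b = 0" for y
  proof -
    have "f (0, y) \<bullet> F1 (0, y) = 0" by (rule frame')
    then have fa: "f (0, y) \<bullet> a = 0" using v_pos[of y] by (simp add: F1_E a_def)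
    have "((\<lambda>x. F1 (x, y)) has_vector_derivative F11 (0, y)) (at 0)"
      using line_F1[of "(0, y)" "(1, 0)" 0] by (simp add: xs)
    moreover have "((\<lambda>x. F1 (x, y)) has_vector_derivative v y *\<^sub>R G 0) (at 0)"
      unfolding F1_E by (rule bounded_linear.has_vector_derivative[OF bounded_linear_scaleR_right E])
    ultimately have "F11 (0, y) = v y *\<^sub>R G 0" by (rule vector_derivative_unique_at)
    then have "f (0, y) \<bullet> (v y *\<^sub>R G 0) = f (0, y) \<bullet> F11 (0, y)" by simp
    also have "\<dots> = - (s * v y)\<^sup>2" by (simp add: F11' inner_simps frame frame')
    finally have "v y * (f (0, y) \<bullet> G 0) = v y * (- (s\<^sup>2 * v y))" by (simp add: power2_eq_square)
    then have "f (0, y) \<bullet> G 0 = - (s\<^sup>2 * v y)"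
      by (simp only: mult_left_cancel[OF less_imp_neq[OF v_pos, symmetric]])
    then have fb: "f (0, y) \<bullet> b = - (v y * s / c)" using s_pos c by (simp add: b_def power2_eq_square field_simps)
    show "g y \<bullet> a = 0" "g y \<bullet> b = 0" by (simp_all add: g_def inner_simps fa fb ab ba)
  qed
  have "x_translation_group f (\<lambda>t. plane_rotation a b (c * t))"
    unfolding x_translation_group_def
  proof (intro conjI allI)
    show "one_param_isometry_group (\<lambda>t. plane_rotation a b (c * t))" by (rule one_param_plane_rotation[OF ab])
    show "f (x + t, y) = plane_rotation a b (c * t) (f (x, y))" for t x y
      unfolding f_eq plane_rotation_def
      by (simp add: inner_simps g ab ba distrib_left cos_add sin_add algebra_simps diff_divide_distrib add_divide_distrib)
  qed
  moreover have "plane_rotation a b (c * t) z = z" if "z \<in> {z. z \<bullet> a = 0 \<and> z \<bullet> b = 0} \<inter> sphere 0 1" for t z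
    using that by (simp add: plane_rotation_def)
  ultimately show ?thesis
    unfolding rotational_def using geodesic_orthogonal_plane[OF ab] by blast
qed

section \<open>Periodicity of metric and normal\<close>

text \<open>The derivative of \<open>f\<close> determines \<open>F1\<close>, \<open>F2\<close> and
  hence \<open>v\<close>, but \<open>N\<close> might still change its sign. The second derivatives
  of \<open>f\<close> are periodic, and their normal components \<open>H * \<rho>^2 + k\<close> and
  \<open>H * \<rho>^2 - k\<close> cannot both vanish for \<open>k \<noteq> 0\<close>, so the sign is
  preserved.\<close>

lemma f_periodic_imp_v_N_periodic:
  assumes per: "\<And>p. f (p + \<gamma>) = f p" and k: "k \<noteq> 0"
  shows "v (y + snd \<gamma>) = v y" "N (p + \<gamma>) = N p"
proof -
  have shift: "((\<lambda>p. X (p + \<gamma>)) has_derivative X') (at p)" if "(X has_derivative X') (at (p + \<gamma>))"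
    for X :: "real \<times> real \<Rightarrow> real^4" and X' p
  proof -
    have "((\<lambda>p. p + \<gamma>) has_derivative (\<lambda>h. h)) (at p)" by (auto intro!: derivative_eq_intros)
    from has_derivative_compose[OF this that] show ?thesis .
  qed
  have u: "C * C + S * S = 1" "C * S - S * C = 0" using CS by (simp_all add: power2_eq_square)
  have Df': "(\<lambda>h. (C * fst h + S * snd h) *\<^sub>R F1 (p + \<gamma>) + (C * snd h - S * fst h) *\<^sub>R F2 (p + \<gamma>))
     = (\<lambda>h. (C * fst h + S * snd h) *\<^sub>R F1 p + (C * snd h - S * fst h) *\<^sub>R F2 p)" for p
    using shift[OF Df] Df[of p] unfolding per by (rule has_derivative_unique)
  have F1p: "F1 (p + \<gamma>) = F1 p" for p using fun_cong[OF Df'[of p], of "(C, S)"] by (simp add: u)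
  have F2p: "F2 (p + \<gamma>) = F2 p" for p using fun_cong[OF Df'[of p], of "(- S, C)"] by (simp add: u)
  have "(s * v (snd (p + \<gamma>)))\<^sup>2 = (s * v (snd p))\<^sup>2" for p using frame(9)[of "p + \<gamma>"] frame(9)[of p] by (simp add: F1p)
  then have vp: "v (snd (p + \<gamma>)) = v (snd p)" for p
    using s_pos v_pos by (metis less_imp_le mult_left_cancel mult_nonneg_nonneg order_less_irrefl power2_eq_imp_eq)
  show "v (y + snd \<gamma>) = v y" using vp[of "(0, y)"] by simp
  have F11p: "F11 (p + \<gamma>) = F11 p"
    using fun_cong[OF has_derivative_unique[OF shift[OF DF1[of "p + \<gamma>"], unfolded F1p] DF1[of p]], of "(C, S)"]
    by (simp add: u F11_def \<rho>_def F1p F2p)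
  have F22p: "F22 (p + \<gamma>) = F22 p"
    using fun_cong[OF has_derivative_unique[OF shift[OF DF2[of "p + \<gamma>"], unfolded F2p] DF2[of p]], of "(- S, C)"]
    by (simp add: u F22_def \<rho>_def F1p F2p)
  define c where "c = N (p + \<gamma>) \<bullet> N p"
  have "N (p + \<gamma>) \<bullet> f p = 0" "N (p + \<gamma>) \<bullet> F1 p = 0" "N (p + \<gamma>) \<bullet> F2 p = 0"
    using frame'(1,4,5)[of "p + \<gamma>"] by (simp_all add: per F1p F2p)
  then have Nc: "N (p + \<gamma>) = c *\<^sub>R N p" using expand[of "N (p + \<gamma>)" p] by (simp add: c_def)
  have II: "F11 p \<bullet> N p = H * (\<rho> p)\<^sup>2 + k" "F22 p \<bullet> N p = H * (\<rho> p)\<^sup>2 - k" for p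
    by (simp_all add: F11_def F22_def inner_simps frame)
  have \<rho>p: "\<rho> (p + \<gamma>) = \<rho> p" by (simp only: \<rho>_def vp)
  have "H * (\<rho> p)\<^sup>2 + k = c * (H * (\<rho> p)\<^sup>2 + k)" "H * (\<rho> p)\<^sup>2 - k = c * (H * (\<rho> p)\<^sup>2 - k)"
    using II[of "p + \<gamma>"] II[of p] unfolding Nc F11p F22p \<rho>p by simp_all
  then have "c = 1 \<or> (H * (\<rho> p)\<^sup>2 + k = 0 \<and> H * (\<rho> p)\<^sup>2 - k = 0)" by auto
  then have "c = 1" using k by auto
  then show "N (p + \<gamma>) = N p" using Nc by simp
qed

end

section \<open>Embedded surfaces\<close>

text \<open>The lattice enters as a group of periods together with a compact set that meets every
  orbit; \<open>f_inj\<close> expresses embeddedness. By \<open>k_pos\<close>, \<open>F1\<close> is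
  the direction of the larger principal curvature.\<close>

locale embedded_dn_surface = dn_surface +
  fixes \<Gamma> P :: "(real \<times> real) set"
  assumes k_pos: "0 < k" and H_nonneg: "0 \<le> H"
    and \<Gamma>_0: "0 \<in> \<Gamma>" and \<Gamma>_uminus: "\<And>\<gamma>. \<gamma> \<in> \<Gamma> \<Longrightarrow> - \<gamma> \<in> \<Gamma>"
    and \<Gamma>_add: "\<And>\<alpha> \<beta>. \<alpha> \<in> \<Gamma> \<Longrightarrow> \<beta> \<in> \<Gamma> \<Longrightarrow> \<alpha> + \<beta> \<in> \<Gamma>"
    and compact_P: "compact P" and P_covers: "\<And>p. \<exists>\<gamma>\<in>\<Gamma>. p + \<gamma> \<in> P"
    and f_periodic: "\<And>p \<gamma>. \<gamma> \<in> \<Gamma> \<Longrightarrow> f (p + \<gamma>) = f p"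
    and N_periodic: "\<And>p \<gamma>. \<gamma> \<in> \<Gamma> \<Longrightarrow> N (p + \<gamma>) = N p"
    and v_periodic: "\<And>y \<gamma>. \<gamma> \<in> \<Gamma> \<Longrightarrow> v (y + snd \<gamma>) = v y"
    and f_inj: "\<And>p r. f p = f r \<Longrightarrow> r - p \<in> \<Gamma>"
begin

section \<open>Compactness modulo the periods\<close>

text \<open>Represents the pairs of points of the torus that keep a distance from the diagonal; a
  pair near the diagonal of the torus may have representatives far apart in \<open>P\<close>, hence
  the condition on all periods.\<close>

definition off_diagonal :: "real \<Rightarrow> ((real \<times> real) \<times> (real \<times> real)) set" where
  "off_diagonal \<epsilon> = {(p, r) \<in> P \<times> P. \<forall>\<gamma>\<in>\<Gamma>. \<epsilon> \<le> dist r (p + \<gamma>)}"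

lemma compact_off_diagonal: "compact (off_diagonal \<epsilon>)"
proof -
  have "off_diagonal \<epsilon> = (P \<times> P) \<inter> (\<Inter>\<gamma>\<in>\<Gamma>. {pr. \<epsilon> \<le> dist (snd pr) (fst pr + \<gamma>)})"
    by (auto simp only: off_diagonal_def mem_Times_iff case_prod_beta fst_conv snd_conv mem_Collect_eq Int_iff INT_iff)
  moreover have "closed {pr :: (real \<times> real) \<times> (real \<times> real). \<epsilon> \<le> dist (snd pr) (fst pr + \<gamma>)}" for \<gamma>
    by (intro closed_Collect_le continuous_intros)
  ultimately show ?thesis
    by (auto intro!: compact_Int_closed closed_INT compact_Times compact_P)
qed

lemma off_diagonal_pos:
  assumes "0 < \<epsilon>" "(p, r) \<in> off_diagonal \<epsilon>"
  shows "0 < 1 - f p \<bullet> f r"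
proof -
  have "f p \<noteq> f r"
  proof
    assume "f p = f r"
    then have "r - p \<in> \<Gamma>" by (rule f_inj)
    then have "\<epsilon> \<le> dist r (p + (r - p))" using assms(2) unfolding off_diagonal_def by blast
    then show False using assms(1) by simp
  qed
  then have "0 < (f p - f r) \<bullet> (f p - f r)" by simp
  then show ?thesis by (simp add: inner_simps frame inner_commute)
qed

lemma translate_Z:
  assumes "\<gamma> \<in> \<Gamma>" "\<gamma>' \<in> \<Gamma>" and "\<And>y. (\<psi> (y + snd \<gamma>) :: real) = \<psi> y"
  shows "Z \<psi> (p + \<gamma>) (r + \<gamma>') = Z \<psi> p r"
  using assms by (simp add: Z_def f_periodic N_periodic)

text \<open>\<open>vd\<close> enters only through its square, which \<open>vd_sq\<close> writes as a
  function of \<open>v\<close>.\<close>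

lemma \<Psi>_shift: "\<gamma> \<in> \<Gamma> \<Longrightarrow> \<Psi> \<kappa> \<delta> (y + snd \<gamma>) = \<Psi> \<kappa> \<delta> y"
  by (simp add: \<Psi>_def \<omega>_def \<mu>_def vd_sq v_periodic)

lemma \<mu>_pos: "0 < \<mu> y"
  using k_pos s_pos v_pos[of y] by (simp add: \<mu>_def)

text \<open>\<open>\<epsilon>\<close> is a Lebesgue number for the cover of \<open>P\<close> by the
  balls of \<open>near_diagonal\<close>; any other pair is translated by a common period.\<close>

lemma uniform_near_diagonal:
  assumes \<psi>: "\<And>y. (\<psi> has_real_derivative \<psi>' y) (at y)" and \<psi>': "\<And>y. (\<psi>' has_real_derivative \<psi>'' y) (at y)"
    and gap: "\<And>y. \<mu> y < \<psi> y"
    and per: "\<And>\<gamma> y. \<gamma> \<in> \<Gamma> \<Longrightarrow> \<psi> (y + snd \<gamma>) = \<psi> y"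
  shows "\<exists>\<epsilon>>0. \<forall>p r. dist r p < \<epsilon> \<longrightarrow> p \<noteq> r \<longrightarrow> 0 < Z \<psi> p r"
proof -
  define good where "good x e \<longleftrightarrow> e > 0 \<and> (\<forall>p\<in>ball x e. \<forall>r\<in>ball x e. p \<noteq> r \<longrightarrow> 0 < Z \<psi> p r)" for x e
  have "\<exists>e. good x e" for x
    unfolding good_def by (rule near_diagonal[OF \<psi> \<psi>']) (use gap \<mu>_pos in \<open>simp add: abs_of_pos\<close>)
  then obtain E where E: "\<And>x. good x (E x)" by metis
  have "x \<in> ball x (E x)" for x using E[of x] by (simp add: good_def)
  then have cover: "P \<subseteq> \<Union>((\<lambda>x. ball x (E x)) ` P)" by blast
  obtain \<epsilon> where \<epsilon>: "0 < \<epsilon>" "\<And>x. x \<in> P \<Longrightarrow> \<exists>G\<in>(\<lambda>x. ball x (E x)) ` P. ball x \<epsilon> \<subseteq> G"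
    by (rule Heine_Borel_lemma[OF compact_P cover]) auto
  have "0 < Z \<psi> p r" if "dist r p < \<epsilon>" "p \<noteq> r" for p r
  proof -
    obtain \<gamma> where \<gamma>: "\<gamma> \<in> \<Gamma>" "p + \<gamma> \<in> P" using P_covers by blast
    obtain x where x: "ball (p + \<gamma>) \<epsilon> \<subseteq> ball x (E x)" using \<epsilon>(2)[OF \<gamma>(2)] by blast
    have "p + \<gamma> \<in> ball (p + \<gamma>) \<epsilon>" "r + \<gamma> \<in> ball (p + \<gamma>) \<epsilon>" using that \<epsilon>(1) by (auto simp: dist_commute)
    then have "p + \<gamma> \<in> ball x (E x)" "r + \<gamma> \<in> ball x (E x)" by (blast intro: subsetD[OF x])+
    note in_ball = this
    have "p + \<gamma> \<noteq> r + \<gamma>" using that by simp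
    note Z_pos = E[of x, unfolded good_def, THEN conjunct2, THEN bspec, OF in_ball(1), THEN bspec, OF in_ball(2), THEN mp, OF this]
    have "0 < Z \<psi> (p + \<gamma>) (r + \<gamma>)" by (rule Z_pos)
    then show ?thesis using translate_Z[of \<gamma> \<gamma> \<psi>, OF \<gamma>(1) \<gamma>(1) per[OF \<gamma>(1)]] by simp
  qed
  then show ?thesis using \<epsilon>(1) by blast
qed

lemma reduce_pair:
  assumes "\<not> (\<exists>\<gamma>\<in>\<Gamma>. dist r (p + \<gamma>) < \<epsilon>)"
  obtains \<gamma> \<gamma>' where "\<gamma> \<in> \<Gamma>" "\<gamma>' \<in> \<Gamma>" "(p + \<gamma>, r + \<gamma>') \<in> off_diagonal \<epsilon>"
proof -
  obtain \<gamma> \<gamma>' where g: "\<gamma> \<in> \<Gamma>" "p + \<gamma> \<in> P" "\<gamma>' \<in> \<Gamma>" "r + \<gamma>' \<in> P" using P_covers by blast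
  have "\<epsilon> \<le> dist (r + \<gamma>') (p + \<gamma> + \<beta>)" if "\<beta> \<in> \<Gamma>" for \<beta>
  proof -
    have "\<gamma> + \<beta> + - \<gamma>' \<in> \<Gamma>" using g that \<Gamma>_add \<Gamma>_uminus by blast
    then have "\<epsilon> \<le> dist r (p + (\<gamma> + \<beta> + - \<gamma>'))" using assms(1) by force
    also have "\<dots> = dist (r + \<gamma>') (p + \<gamma> + \<beta>)" by (simp add: dist_norm algebra_simps)
    finally show ?thesis .
  qed
  then show ?thesis using that g by (auto simp: off_diagonal_def)
qed

lemma \<mu>_bounded: "\<mu> y \<le> k / (s\<^sup>2 * q\<^sup>2)"
  unfolding \<mu>_def power_mult_distrib using v_sq_ge[of y] s_pos q k_pos v_pos[of y]
  by (intro divide_left_mono mult_left_mono) auto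

text \<open>A constant \<open>c\<close> above all values of \<open>\<mu>\<close> lets
  \<open>near_diagonal\<close> apply to both orientations, that is, to touching balls on either
  side. The strict inequality also gives the local injectivity of \<open>f\<close> that
  \<open>open_cone_image\<close> uses.\<close>

lemma normal_bound_near:
  "\<exists>c \<epsilon>. 0 < \<epsilon> \<and> (\<forall>p r. dist r p < \<epsilon> \<longrightarrow> \<bar>N p \<bullet> f r\<bar> \<le> c * (1 - f p \<bullet> f r) \<and> (p \<noteq> r \<longrightarrow> f p \<noteq> f r))"
proof -
  define c where "c = k / (s\<^sup>2 * q\<^sup>2) + 1"
  have c: "\<mu> y < c" for y using \<mu>_bounded[of y] by (simp add: c_def)
  \<comment> \<open>Reversing the normal changes the signs of \<open>H\<close> and \<open>k\<close>
    and keeps \<open>F1\<close> and \<open>F2\<close>.\<close>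
  interpret neg: dn_surface q s "- H" "- k" C S v vd f F1 F2 "\<lambda>p. - N p"
  proof unfold_locales
    show "((\<lambda>p. - N p) has_derivative
         (\<lambda>h. (C * fst h + S * snd h) *\<^sub>R (- (- H + - k / (s * v (snd p))\<^sup>2)) *\<^sub>R F1 p +
              (C * snd h - S * fst h) *\<^sub>R (- (- H - - k / (s * v (snd p))\<^sup>2)) *\<^sub>R F2 p)) (at p)" for p
      by (rule has_derivative_eq_rhs[OF has_derivative_minus[OF DN]]) (simp add: fun_eq_iff algebra_simps)
    show "(F1 has_derivative
         (\<lambda>h. (C * fst h + S * snd h) *\<^sub>R
              ((vd (snd p) / v (snd p)) *\<^sub>R (S *\<^sub>R F1 p - C *\<^sub>R F2 p) +
               (- H * (s * v (snd p))\<^sup>2 + - k) *\<^sub>R - N p - (s * v (snd p))\<^sup>2 *\<^sub>R f p) +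
              (C * snd h - S * fst h) *\<^sub>R (vd (snd p) / v (snd p)) *\<^sub>R (C *\<^sub>R F1 p + S *\<^sub>R F2 p))) (at p)" for p
      by (rule has_derivative_eq_rhs[OF DF1]) (simp add: fun_eq_iff algebra_simps)
    show "(F2 has_derivative
         (\<lambda>h. (C * fst h + S * snd h) *\<^sub>R (vd (snd p) / v (snd p)) *\<^sub>R (C *\<^sub>R F1 p + S *\<^sub>R F2 p) +
              (C * snd h - S * fst h) *\<^sub>R
              ((vd (snd p) / v (snd p)) *\<^sub>R (C *\<^sub>R F2 p - S *\<^sub>R F1 p) +
               (- H * (s * v (snd p))\<^sup>2 - - k) *\<^sub>R - N p - (s * v (snd p))\<^sup>2 *\<^sub>R f p))) (at p)" for p
      by (rule has_derivative_eq_rhs[OF DF2]) (simp add: fun_eq_iff algebra_simps)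
  qed (use CS s_pos sH k_sq q v_pos v_le_1 DERIV_v DERIV_vd vd_sq frame Df in \<open>simp_all\<close>)
  have neg\<mu>: "neg.\<mu> y = - \<mu> y" for y by (simp add: neg.\<mu>_def \<mu>_def)
  define good where "good x e \<longleftrightarrow> e > 0 \<and> (\<forall>p\<in>ball x e. \<forall>r\<in>ball x e. p \<noteq> r \<longrightarrow>
      0 < Z (\<lambda>_. c) p r \<and> 0 < neg.Z (\<lambda>_. c) p r)" for x e
  have "\<exists>e. good x e" for x
  proof -
    obtain e where e: "e > 0" "\<forall>p\<in>ball x e. \<forall>r\<in>ball x e. p \<noteq> r \<longrightarrow> 0 < Z (\<lambda>_. c) p r"
      using near_diagonal[of "\<lambda>_. c" "\<lambda>_. 0" "\<lambda>_. 0" x] c \<mu>_pos by (auto simp: abs_of_pos)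
    obtain e' where e': "e' > 0" "\<forall>p\<in>ball x e'. \<forall>r\<in>ball x e'. p \<noteq> r \<longrightarrow> 0 < neg.Z (\<lambda>_. c) p r"
      using neg.near_diagonal[of "\<lambda>_. c" "\<lambda>_. 0" "\<lambda>_. 0" x] c \<mu>_pos by (auto simp: abs_of_pos neg\<mu>)
    have "good x (min e e')" unfolding good_def using e e' by simp
    then show ?thesis ..
  qed
  then obtain E where E: "\<And>x. good x (E x)" by metis
  have "x \<in> ball x (E x)" for x using E[of x] by (simp add: good_def)
  then have cover: "P \<subseteq> \<Union>((\<lambda>x. ball x (E x)) ` P)" by blast
  obtain \<epsilon> where \<epsilon>: "0 < \<epsilon>" "\<And>x. x \<in> P \<Longrightarrow> \<exists>G\<in>(\<lambda>x. ball x (E x)) ` P. ball x \<epsilon> \<subseteq> G"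
    by (rule Heine_Borel_lemma[OF compact_P cover]) auto
  have "\<bar>N p \<bullet> f r\<bar> \<le> (H + c) * (1 - f p \<bullet> f r) \<and> (p \<noteq> r \<longrightarrow> f p \<noteq> f r)" if "dist r p < \<epsilon>" for p r
  proof (cases "p = r")
    case True then show ?thesis by (simp add: frame frame')
  next
    case False
    obtain \<gamma> where \<gamma>: "\<gamma> \<in> \<Gamma>" "p + \<gamma> \<in> P" using P_covers by blast
    obtain x where x: "ball (p + \<gamma>) \<epsilon> \<subseteq> ball x (E x)" using \<epsilon>(2)[OF \<gamma>(2)] by blast
    have "p + \<gamma> \<in> ball (p + \<gamma>) \<epsilon>" "r + \<gamma> \<in> ball (p + \<gamma>) \<epsilon>" using that \<epsilon>(1) by (auto simp: dist_commute)
    then have "p + \<gamma> \<in> ball x (E x)" "r + \<gamma> \<in> ball x (E x)" by (blast intro: subsetD[OF x])+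
    note in_ball = this
    have "p + \<gamma> \<noteq> r + \<gamma>" using False by simp
    note Z_pos = E[of x, unfolded good_def, THEN conjunct2, THEN bspec, OF in_ball(1), THEN bspec, OF in_ball(2), THEN mp, OF this]
    have "0 < Z (\<lambda>_. c) (p + \<gamma>) (r + \<gamma>)" "0 < neg.Z (\<lambda>_. c) (p + \<gamma>) (r + \<gamma>)"
      using Z_pos by (rule conjunct1, rule conjunct2)
    then have *: "N p \<bullet> f r < (H + c) * (1 - f p \<bullet> f r)" "- (N p \<bullet> f r) < (- H + c) * (1 - f p \<bullet> f r)"
      using \<gamma>(1) by (simp_all add: Z_def neg.Z_def f_periodic N_periodic)
    have "(- H + c) * (1 - f p \<bullet> f r) \<le> (H + c) * (1 - f p \<bullet> f r)"
      using H_nonneg inner_f_le_1[of p r] by (intro mult_right_mono) auto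
    then have "\<bar>N p \<bullet> f r\<bar> \<le> (H + c) * (1 - f p \<bullet> f r)" using * by linarith
    moreover have "f p \<noteq> f r"
    proof
      assume "f p = f r"
      then have "N p \<bullet> f r = 0" "f p \<bullet> f r = 1" using frame(1)[of r] frame(3)[of p] by (auto simp: inner_commute)
      then show False using *(1) by simp
    qed
    ultimately show ?thesis by blast
  qed
  then show ?thesis using \<epsilon>(1) by blast
qed

text \<open>Touching balls of one fixed size exist on both sides of the surface. Away from the
  diagonal, embeddedness and compactness bound \<open>1 - f p \<bullet> f r\<close> from below,
  while the left-hand side is at most 1.\<close>

lemma normal_bound: "\<exists>c>0. \<forall>p r. \<bar>N p \<bullet> f r\<bar> \<le> c * (1 - f p \<bullet> f r)"
proof -
  obtain c \<epsilon> where \<epsilon>: "0 < \<epsilon>"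
    and near: "\<And>p r. dist r p < \<epsilon> \<Longrightarrow> \<bar>N p \<bullet> f r\<bar> \<le> c * (1 - f p \<bullet> f r)"
    using normal_bound_near by blast
  have "continuous_on (off_diagonal \<epsilon>) (\<lambda>pr. 1 - f (fst pr) \<bullet> f (snd pr))"
    by (intro continuous_intros continuous_on_compose2[OF continuous_frame(1)]; simp)
  then have "\<exists>d>0. \<forall>pr\<in>off_diagonal \<epsilon>. d \<le> 1 - f (fst pr) \<bullet> f (snd pr)"
  proof (cases "off_diagonal \<epsilon> = {}")
    case False
    then obtain pr where "pr \<in> off_diagonal \<epsilon>"
      "\<forall>x\<in>off_diagonal \<epsilon>. 1 - f (fst pr) \<bullet> f (snd pr) \<le> 1 - f (fst x) \<bullet> f (snd x)"
      using continuous_attains_inf[OF compact_off_diagonal False \<open>continuous_on _ _\<close>] by blast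
    moreover have "0 < 1 - f (fst pr) \<bullet> f (snd pr)"
      using off_diagonal_pos[OF \<epsilon>, of "fst pr" "snd pr"] calculation(1) by simp
    ultimately show ?thesis by blast
  qed (auto intro: exI[of _ 1])
  then obtain d where d: "0 < d" "\<And>p r. (p, r) \<in> off_diagonal \<epsilon> \<Longrightarrow> d \<le> 1 - f p \<bullet> f r" by force
  have "\<bar>N p \<bullet> f r\<bar> \<le> (\<bar>c\<bar> + 1 / d) * (1 - f p \<bullet> f r)" for p r
  proof (cases "\<exists>\<gamma>\<in>\<Gamma>. dist r (p + \<gamma>) < \<epsilon>")
    case True
    then obtain \<gamma> where \<gamma>: "\<gamma> \<in> \<Gamma>" "dist r (p + \<gamma>) < \<epsilon>" by blast
    have "\<bar>N p \<bullet> f r\<bar> \<le> c * (1 - f p \<bullet> f r)"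
      using near[OF \<gamma>(2)] \<gamma>(1) by (simp add: f_periodic N_periodic)
    also have "\<dots> \<le> (\<bar>c\<bar> + 1 / d) * (1 - f p \<bullet> f r)"
      using inner_f_le_1[of p r] d(1) by (intro mult_right_mono) (auto simp: add_increasing2)
    finally show ?thesis .
  next
    case False
    then obtain \<gamma> \<gamma>' where g: "\<gamma> \<in> \<Gamma>" "\<gamma>' \<in> \<Gamma>" "(p + \<gamma>, r + \<gamma>') \<in> off_diagonal \<epsilon>" by (rule reduce_pair)
    have "d \<le> 1 - f p \<bullet> f r" using d(2)[OF g(3)] g by (simp add: f_periodic)
    then have "1 \<le> 1 / d * (1 - f p \<bullet> f r)" using d(1) by (simp add: field_simps)
    also have "\<dots> \<le> (\<bar>c\<bar> + 1 / d) * (1 - f p \<bullet> f r)"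
      using inner_f_le_1[of p r] by (intro mult_right_mono) auto
    finally have "1 \<le> (\<bar>c\<bar> + 1 / d) * (1 - f p \<bullet> f r)" .
    moreover have "\<bar>N p \<bullet> f r\<bar> \<le> 1"
      using Cauchy_Schwarz_ineq2[of "N p" "f r"] by (simp add: norm_eq_sqrt_inner frame)
    ultimately show ?thesis by linarith
  qed
  moreover have "0 < \<bar>c\<bar> + 1 / d" using d(1) by (simp add: add_nonneg_pos)
  ultimately show ?thesis by blast
qed

subsection \<open>The two sides of the surface\<close>

text \<open>The point at signed distance \<open>arctan t\<close> from \<open>f p\<close> on the
  normal geodesic.\<close>

definition tube :: "real \<times> real \<Rightarrow> real \<Rightarrow> real^4" where
  "tube p t = (f p + t *\<^sub>R N p) /\<^sub>R sqrt (1 + t\<^sup>2)"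

lemma sqrt_pos: "0 < sqrt (1 + t\<^sup>2)"
  by (simp add: add_pos_nonneg)

lemma norm_normal_line: "norm (f p + t *\<^sub>R N p) = sqrt (1 + t\<^sup>2)"
  by (simp add: norm_eq_sqrt_inner inner_simps frame frame' power2_eq_square)

lemma norm_tube: "norm (tube p t) = 1"
  using sqrt_pos[of t] by (simp add: tube_def norm_normal_line)

lemma tube_periodic: "\<gamma> \<in> \<Gamma> \<Longrightarrow> tube (p + \<gamma>) t = tube p t"
  by (simp add: tube_def f_periodic N_periodic)

lemma continuous_on_tube: "continuous_on X (\<lambda>pt. tube (fst pt) (snd pt))"
  unfolding tube_def using sqrt_pos
  by (intro continuous_intros continuous_on_compose2[OF continuous_frame(1)]
      continuous_on_compose2[OF continuous_frame(2)]) (auto simp: add_nonneg_eq_0_iff)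

text \<open>For small \<open>t\<close> the point of the surface closest to \<open>tube p t\<close> is \<open>f p\<close>.\<close>

lemma tube_inject: "\<exists>\<delta>>0. \<forall>p p' t t'. \<bar>t\<bar> \<le> \<delta> \<longrightarrow> \<bar>t'\<bar> \<le> \<delta> \<longrightarrow> tube p t = tube p' t' \<longrightarrow> f p = f p' \<and> t = t'"
proof -
  obtain c where c: "c > 0" "\<And>p r. \<bar>N p \<bullet> f r\<bar> \<le> c * (1 - f p \<bullet> f r)" using normal_bound by blast
  \<comment> \<open>\<open>\<delta> * c < 1\<close> ensures that the normal displacement cannot
    compensate for the loss \<open>1 - f p \<bullet> f r\<close>.\<close>
  define \<delta> where "\<delta> = 1 / (c + 1)"
  have \<delta>: "0 < \<delta>" "\<delta> * c < 1" using c(1) by (simp_all add: \<delta>_def)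
  have strict: "tube p t \<bullet> f r < tube p t \<bullet> f p" if t: "\<bar>t\<bar> \<le> \<delta>" and ne: "f p \<noteq> f r" for p r t
  proof -
    have "0 < (f p - f r) \<bullet> (f p - f r)" using ne by simp
    then have d: "0 < 1 - f p \<bullet> f r" by (simp add: inner_simps frame inner_commute)
    have "t * (N p \<bullet> f r) \<le> \<bar>t\<bar> * \<bar>N p \<bullet> f r\<bar>" by (simp add: abs_mult[symmetric])
    also have "\<dots> \<le> \<delta> * (c * (1 - f p \<bullet> f r))" using t c(2) \<delta>(1) by (intro mult_mono) auto
    also have "\<dots> < 1 - f p \<bullet> f r" using d \<delta>(2) by (simp add: mult.assoc[symmetric])
    finally have "f p \<bullet> f r + t * (N p \<bullet> f r) < 1" by simp
    then have "(f p + t *\<^sub>R N p) \<bullet> f r < (f p + t *\<^sub>R N p) \<bullet> f p"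
      by (simp add: inner_simps frame frame')
    then show ?thesis using sqrt_pos[of t] by (simp add: tube_def divide_strict_right_mono divide_inverse)
  qed
  have "f p = f p' \<and> t = t'" if t: "\<bar>t\<bar> \<le> \<delta>" "\<bar>t'\<bar> \<le> \<delta>" and eq: "tube p t = tube p' t'" for p p' t t'
  proof
    show ff: "f p = f p'"
      using strict[OF t(1), of p p'] strict[OF t(2), of p' p] eq by fastforce
    then obtain \<gamma> where "\<gamma> \<in> \<Gamma>" "p' = p + \<gamma>" using f_inj[OF ff] by (metis add_diff_cancel_left' diff_add_cancel add.commute)
    then have eq': "tube p t = tube p t'" using eq tube_periodic by simp
    have "tube p u \<bullet> f p = 1 / sqrt (1 + u\<^sup>2)" "tube p u \<bullet> N p = u / sqrt (1 + u\<^sup>2)" for u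
      by (simp_all add: tube_def inner_simps frame frame' divide_inverse)
    then have "1 / sqrt (1 + t\<^sup>2) = 1 / sqrt (1 + t'\<^sup>2)" "t / sqrt (1 + t\<^sup>2) = t' / sqrt (1 + t'\<^sup>2)"
      using eq' by metis+
    then show "t = t'" using sqrt_pos[of t] sqrt_pos[of t'] by simp
  qed
  then show ?thesis using \<delta>(1) by blast
qed

text \<open>The tube with a radial coordinate added, so that source and target both have dimension 4
  and invariance of domain applies to the collar of the surface.\<close>

definition cone_map :: "(real \<times> real) \<times> (real \<times> real) \<Rightarrow> real^4" where
  "cone_map x = snd (snd x) *\<^sub>R (f (fst x) + fst (snd x) *\<^sub>R N (fst x))"

lemma cone_map_tube: "cone_map (p, t, c) = (c * sqrt (1 + t\<^sup>2)) *\<^sub>R tube p t"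
  using sqrt_pos[of t] by (simp add: cone_map_def tube_def)

text \<open>Injectivity in \<open>p\<close> holds only modulo periods, so invariance of domain is
  applied on balls of radius \<open>\<epsilon> / 2\<close>, where \<open>f\<close> is injective, and
  the images are united.\<close>

lemma open_cone_image:
  assumes inj: "\<And>p p' t t'. \<bar>t\<bar> \<le> \<delta> \<Longrightarrow> \<bar>t'\<bar> \<le> \<delta> \<Longrightarrow> tube p t = tube p' t' \<Longrightarrow> f p = f p' \<and> t = t'"
  shows "open (cone_map ` (UNIV \<times> ({-\<delta><..<\<delta>} \<times> {0<..})))"
proof -
  obtain c \<epsilon> where \<epsilon>: "0 < \<epsilon>" and loc: "\<And>p r. dist r p < \<epsilon> \<Longrightarrow> p \<noteq> r \<Longrightarrow> f p \<noteq> f r"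
    using normal_bound_near by blast
  let ?I = "{-\<delta><..<\<delta>} \<times> {0<..} :: (real \<times> real) set"
  have "open (cone_map ` (ball p0 (\<epsilon>/2) \<times> ?I))" for p0
  proof (rule invariance_of_domain_gen)
    show "open (ball p0 (\<epsilon>/2) \<times> ?I)" by (intro open_Times) auto
    show "continuous_on (ball p0 (\<epsilon>/2) \<times> ?I) cone_map"
      unfolding cone_map_def
      by (intro continuous_intros continuous_on_compose2[OF continuous_frame(1)]
        continuous_on_compose2[OF continuous_frame(2)]) auto
    show "inj_on cone_map (ball p0 (\<epsilon>/2) \<times> ?I)"
    proof (rule inj_onI)
      fix x x' assume x: "x \<in> ball p0 (\<epsilon>/2) \<times> ?I" "x' \<in> ball p0 (\<epsilon>/2) \<times> ?I" and eq: "cone_map x = cone_map x'"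
      obtain p t c p' t' c' where xs: "x = (p, t, c)" "x' = (p', t', c')" by (metis prod.exhaust)
      have p: "p \<in> ball p0 (\<epsilon>/2)" "p' \<in> ball p0 (\<epsilon>/2)" and t: "t \<in> {-\<delta><..<\<delta>}" "t' \<in> {-\<delta><..<\<delta>}"
        and c: "c \<in> {0<..}" "c' \<in> {0<..}"
        using x unfolding xs by auto
      have eq: "(c * sqrt (1 + t\<^sup>2)) *\<^sub>R tube p t = (c' * sqrt (1 + t'\<^sup>2)) *\<^sub>R tube p' t'"
        using eq by (simp add: cone_map_tube xs)
      have "norm ((c * sqrt (1 + t\<^sup>2)) *\<^sub>R tube p t) = norm ((c' * sqrt (1 + t'\<^sup>2)) *\<^sub>R tube p' t')"
        by (simp only: eq)
      then have cc: "c * sqrt (1 + t\<^sup>2) = c' * sqrt (1 + t'\<^sup>2)"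
        using c by (simp add: norm_tube abs_mult)
      moreover have "c * sqrt (1 + t\<^sup>2) \<noteq> 0" using c sqrt_pos[of t] by simp
      ultimately have "tube p t = tube p' t'" using eq by simp
      moreover have "\<bar>t\<bar> \<le> \<delta>" "\<bar>t'\<bar> \<le> \<delta>" using t by auto
      ultimately have ft: "f p = f p'" "t = t'" using inj[of t t' p p'] by blast+
      have "dist p' p < \<epsilon>" using p dist_triangle[of p' p p0] by (simp add: dist_commute)
      then have "p = p'" using loc ft by blast
      moreover have "c = c'" using cc ft sqrt_pos[of t] by simp
      ultimately show "x = x'" using ft by (simp add: xs)
    qed
  qed simp
  moreover have "cone_map ` (UNIV \<times> ?I) = (\<Union>p0. cone_map ` (ball p0 (\<epsilon>/2) \<times> ?I))"
  proof -
    have "UNIV \<times> ?I = (\<Union>p0. ball p0 (\<epsilon>/2) \<times> ?I)" using \<epsilon> by (force intro: exI[of _ "fst _"])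
    then have "cone_map ` (UNIV \<times> ?I) = cone_map ` (\<Union>p0. ball p0 (\<epsilon>/2) \<times> ?I)" by (rule arg_cong)
    then show ?thesis by (simp only: image_UN)
  qed
  ultimately show ?thesis by auto
qed

text \<open>A map \<open>h\<close> of the 3-sphere to the circle that wraps once around the circle across the collar of
  the surface has a logarithm \<open>\<eta>\<close>; the sign of \<open>\<eta>\<close> tells the two sides of the surface apart.\<close>

lemma side_function:
  obtains \<eta> :: "real^4 \<Rightarrow> real" and \<delta> where "0 < \<delta>" "continuous_on (sphere 0 1) \<eta>"
    "\<And>p t. \<bar>t\<bar> < \<delta> \<Longrightarrow> \<eta> (tube p t) = pi * t / \<delta>"
    "\<And>z. z \<in> sphere 0 1 \<Longrightarrow> \<eta> z = 0 \<Longrightarrow> \<exists>p. z = f p"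
proof -
  obtain \<delta> where \<delta>: "\<delta> > 0" and inj: "\<And>p p' t t'. \<bar>t\<bar> \<le> \<delta> \<Longrightarrow> \<bar>t'\<bar> \<le> \<delta> \<Longrightarrow> tube p t = tube p' t' \<Longrightarrow> f p = f p' \<and> t = t'"
    using tube_inject by metis
  define U where "U = cone_map ` (UNIV \<times> ({-\<delta><..<\<delta>} \<times> {0<..}))"
  have U: "open U" unfolding U_def by (rule open_cone_image[OF inj])
  have in_U: "z \<in> U \<longleftrightarrow> (\<exists>p t. \<bar>t\<bar> < \<delta> \<and> z = tube p t)" if "z \<in> sphere 0 1" for z
  proof
    assume "z \<in> U"
    then obtain p t c where z: "z = cone_map (p, t, c)" "\<bar>t\<bar> < \<delta>" "0 < c" by (auto simp: U_def abs_less_iff)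
    have "norm z = c * sqrt (1 + t\<^sup>2)" using z by (simp add: cone_map_tube norm_tube abs_mult)
    then have "z = tube p t" using that z(1) by (simp add: cone_map_tube)
    with z(2) show "\<exists>p t. \<bar>t\<bar> < \<delta> \<and> z = tube p t" by blast
  next
    assume "\<exists>p t. \<bar>t\<bar> < \<delta> \<and> z = tube p t"
    then obtain p t where t: "\<bar>t\<bar> < \<delta>" "z = tube p t" by blast
    then have "z = cone_map (p, t, 1 / sqrt (1 + t\<^sup>2))" using sqrt_pos[of t] by (simp add: cone_map_tube)
    moreover have "(p, t, 1 / sqrt (1 + t\<^sup>2)) \<in> UNIV \<times> ({-\<delta><..<\<delta>} \<times> {0<..})"
      using t sqrt_pos[of t] by auto
    ultimately show "z \<in> U" unfolding U_def by blast
  qed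
  define K where "K = (\<lambda>pt. tube (fst pt) (snd pt)) ` (P \<times> {-\<delta>..\<delta>})"
  have in_K: "tube p t \<in> K" if t: "\<bar>t\<bar> \<le> \<delta>" for p t
  proof -
    obtain \<gamma> where \<gamma>: "\<gamma> \<in> \<Gamma>" "p + \<gamma> \<in> P" using P_covers by blast
    have "tube p t = (\<lambda>pt. tube (fst pt) (snd pt)) (p + \<gamma>, t)" using \<gamma> by (simp add: tube_periodic)
    moreover have "(p + \<gamma>, t) \<in> P \<times> {-\<delta>..\<delta>}" using \<gamma> t by auto
    ultimately show ?thesis unfolding K_def by blast
  qed
  have K_sphere: "K \<subseteq> sphere 0 1" by (auto simp: K_def norm_tube)
  define T where "T z = (SOME t. \<bar>t\<bar> \<le> \<delta> \<and> (\<exists>p. z = tube p t))" for z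
  have T: "T (tube p t) = t" if "\<bar>t\<bar> \<le> \<delta>" for p t
    unfolding T_def by (rule some_equality) (use that inj in blast)+
  \<comment> \<open>The graph of \<open>T\<close> is a continuous image of the compact set
    \<open>P \<times> {-\<delta>..\<delta>}\<close>, hence closed.\<close>
  have contT: "continuous_on K T"
  proof (rule continuous_from_closed_graph)
    show "compact {-\<delta>..\<delta>}" by simp
    show "T \<in> K \<rightarrow> {-\<delta>..\<delta>}" by (auto simp: K_def T)
    have "(\<lambda>z. (z, T z)) ` K = (\<lambda>pt. (tube (fst pt) (snd pt), snd pt)) ` (P \<times> {-\<delta>..\<delta>})"
      unfolding K_def image_image by (intro image_cong) (auto simp: T)
    moreover have "compact ((\<lambda>pt. (tube (fst pt) (snd pt), snd pt)) ` (P \<times> {-\<delta>..\<delta>}))"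
      by (intro compact_continuous_image continuous_intros continuous_on_tube compact_Times compact_P) simp
    ultimately show "closed ((\<lambda>z. (z, T z)) ` K)" by (simp add: compact_imp_closed)
  qed
  have compact_K: "compact K"
    unfolding K_def by (intro compact_continuous_image continuous_on_tube compact_Times compact_P) simp
  \<comment> \<open>On the boundary \<open>t = \<plusminus>\<delta>\<close> of the collar the first
    formula takes the value \<open>-1\<close> as well, so the two pieces fit together.\<close>
  define h where "h z = (if z \<in> U then cis (pi * T z / \<delta>) else -1)" for z
  have "continuous_on (K \<union> (sphere 0 1 - U)) h"
    unfolding h_def
  proof (rule continuous_on_cases)
    show "closed K" using compact_K by (rule compact_imp_closed)
    show "closed (sphere 0 1 - U)" using U by (intro closed_Diff) auto
    show "continuous_on K (\<lambda>z. cis (pi * T z / \<delta>))" using \<delta> by (intro continuous_intros contT) auto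
    have "cis (pi * T z / \<delta>) = -1" if z: "z \<in> K" "z \<notin> U" for z
    proof -
      obtain p t where t: "\<bar>t\<bar> \<le> \<delta>" "z = tube p t"
        using z(1) unfolding K_def by (force simp: abs_le_iff)
      moreover have "\<not> \<bar>t\<bar> < \<delta>" using z(2) in_U[of z] t K_sphere z(1) by blast
      ultimately have "T z = \<delta> \<or> T z = - \<delta>" using T by auto
      then show ?thesis using \<delta> by (auto simp: cis_pi cis_inverse[symmetric] simp flip: cis_inverse)
    qed
    then show "\<forall>z. z \<in> K \<and> z \<notin> U \<or> z \<in> sphere 0 1 - U \<and> z \<in> U \<longrightarrow> cis (pi * T z / \<delta>) = - 1" by blast
  qed simp
  moreover have "K \<union> (sphere 0 1 - U) = sphere 0 1"
    using K_sphere in_U in_K by (auto intro: less_imp_le)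
  ultimately have conth: "continuous_on (sphere 0 1) h" by simp
  have h_sphere: "h \<in> sphere 0 1 \<rightarrow> sphere 0 1" by (auto simp: h_def)
  obtain c where "homotopic_with_canon (\<lambda>z. True) (sphere 0 1) (sphere 0 1) h (\<lambda>x. c)"
    by (rule inessential_spheremap_2[OF _ _ conth h_sphere]) auto
  then obtain \<eta> where \<eta>: "continuous_on (sphere 0 1) \<eta>" "\<And>z. z \<in> sphere 0 1 \<Longrightarrow> h z = exp (\<i> * of_real (\<eta> z))"
    using inessential_eq_continuous_logarithm_circle[of "sphere 0 1" h] by blast
  \<comment> \<open>The deviation of \<open>\<eta>\<close> from the intended value in units of
    \<open>2 * pi\<close>: a continuous integer-valued function on the connected collar, hence a
    constant that can be subtracted.\<close>
  define D where "D pt = (\<eta> (tube (fst pt) (snd pt)) - pi * snd pt / \<delta>) / (2 * pi)" for pt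
  have D_Ints: "D pt \<in> \<int>" if "pt \<in> UNIV \<times> {-\<delta><..<\<delta>}" for pt
  proof -
    define p t where "p = fst pt" and "t = snd pt"
    have t: "\<bar>t\<bar> < \<delta>" using that by (auto simp: t_def)
    have s: "tube p t \<in> sphere 0 1" by (simp add: norm_tube)
    have "tube p t \<in> U" using t in_U[OF s] by blast
    then have "h (tube p t) = cis (pi * t / \<delta>)" using t T[of t p] by (simp add: h_def)
    then have "cis (\<eta> (tube p t) - pi * t / \<delta>) = 1" using \<eta>(2)[OF s] by (simp add: cis_conv_exp[symmetric] flip: cis_divide)
    then have "cos (\<eta> (tube p t) - pi * t / \<delta>) = 1" by (metis cis.simps(1) one_complex.simps(1))
    then obtain n :: int where "\<eta> (tube p t) - pi * t / \<delta> = of_int n * 2 * pi" unfolding cos_one_2pi_int by blast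
    then have "D pt = of_int n" by (simp add: D_def p_def t_def)
    then show ?thesis by simp
  qed
  have "D constant_on (UNIV \<times> {-\<delta><..<\<delta>})"
  proof (rule continuous_discrete_range_constant)
    show "connected (UNIV \<times> {-\<delta><..<\<delta>} :: ((real \<times> real) \<times> real) set)"
      by (intro connected_Times connected_UNIV) (simp add: connected_Ioo)
    show "continuous_on (UNIV \<times> {-\<delta><..<\<delta>}) D"
      unfolding D_def using \<delta> by (intro continuous_intros continuous_on_compose2[OF \<eta>(1) continuous_on_tube])
        (auto simp: norm_tube)
    show "\<exists>e>0. \<forall>y. y \<in> UNIV \<times> {-\<delta><..<\<delta>} \<and> D y \<noteq> D x \<longrightarrow> e \<le> norm (D y - D x)"
      if "x \<in> UNIV \<times> {-\<delta><..<\<delta>}" for x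
      using D_Ints[OF that] D_Ints by (intro exI[of _ 1]) (auto intro: Ints_nonzero_abs_ge1)
  qed
  then obtain n where n: "\<And>pt. pt \<in> UNIV \<times> {-\<delta><..<\<delta>} \<Longrightarrow> D pt = n" by (auto simp: constant_on_def)
  have "n \<in> \<int>" using n[of "(0, 0)"] D_Ints[of "(0, 0)"] \<delta> by auto
  then have n1: "exp (\<i> * of_real (2 * pi * n)) = 1"
    by (elim Ints_cases) (auto simp: exp_eq_1 mult_ac)
  show thesis
  proof (rule that[OF \<delta>, of "\<lambda>z. \<eta> z - 2 * pi * n"])
    show "continuous_on (sphere 0 1) (\<lambda>z. \<eta> z - 2 * pi * n)" by (intro continuous_intros \<eta>(1))
    show "\<eta> (tube p t) - 2 * pi * n = pi * t / \<delta>" if "\<bar>t\<bar> < \<delta>" for p t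
      using n[of "(p, t)"] that by (auto simp: D_def field_simps abs_less_iff)
    show "\<exists>p. z = f p" if z: "z \<in> sphere 0 1" "\<eta> z - 2 * pi * n = 0" for z
    proof -
      have "h z = 1" using \<eta>(2)[OF z(1)] z(2) n1 by simp
      then have "z \<in> U" "cis (pi * T z / \<delta>) = 1" by (auto simp: h_def split: if_splits)
      then obtain p t where t: "\<bar>t\<bar> < \<delta>" "z = tube p t" using in_U[OF z(1)] by blast
      then have "cos (pi * t / \<delta>) = 1" using \<open>cis _ = 1\<close> T[of t p] by (metis cis.simps(1) one_complex.simps(1) less_imp_le)
      then obtain m :: int where m: "pi * t / \<delta> = of_int m * 2 * pi" unfolding cos_one_2pi_int by blast
      then have tm: "t = 2 * of_int m * \<delta>" using \<delta> by (simp add: field_simps)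
      then have "\<bar>2 * real_of_int m\<bar> < 1" using t(1) \<delta> by (simp add: abs_mult)
      then have "m = 0" by linarith
      then have "z = f p" using t(2) tm by (simp add: tube_def)
      then show ?thesis ..
    qed
  qed
qed

subsection \<open>No ball touches twice\<close>

lemma Z_eq: "Z \<psi> p r = (H + \<psi> (snd p)) - ((H + \<psi> (snd p)) *\<^sub>R f p + N p) \<bullet> f r"
  by (simp add: Z_def inner_simps algebra_simps)

lemma translate_Z_\<Psi>:
  "\<gamma> \<in> \<Gamma> \<Longrightarrow> \<gamma>' \<in> \<Gamma> \<Longrightarrow> Z (\<Psi> \<kappa> \<delta>) (p + \<gamma>) (r + \<gamma>') = Z (\<Psi> \<kappa> \<delta>) p r"
  by (rule translate_Z) (simp_all add: \<Psi>_shift)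

text \<open>The open geodesic ball \<open>w \<bullet> z > \<Phi>\<close>, here as a convex cone, misses the surface and hence lies on
  one side of it.\<close>

lemma same_side:
  assumes \<Phi>: "0 < \<Phi>" and w: "w = \<Phi> *\<^sub>R f p + N p"
    and le: "\<And>z. w \<bullet> f z \<le> \<Phi>" and touch: "w \<bullet> f r = \<Phi>"
  shows "w \<bullet> N r \<noteq> - 1"
proof
  assume opposite: "w \<bullet> N r = - 1"
  obtain \<eta> \<delta> where \<delta>: "0 < \<delta>" and cont: "continuous_on (sphere 0 1) \<eta>"
    and \<eta>_tube: "\<And>p t. \<bar>t\<bar> < \<delta> \<Longrightarrow> \<eta> (tube p t) = pi * t / \<delta>"
    and \<eta>_0: "\<And>z. z \<in> sphere 0 1 \<Longrightarrow> \<eta> z = 0 \<Longrightarrow> \<exists>p. z = f p"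
    using side_function by metis
  define V where "V = {z. \<Phi> * norm z < w \<bullet> z}"
  have "convex V"
  proof (rule convexI)
    fix x y :: "real^4" and a b :: real
    assume x: "x \<in> V" and y: "y \<in> V" and ab: "0 \<le> a" "0 \<le> b" "a + b = 1"
    have "\<Phi> * norm (a *\<^sub>R x + b *\<^sub>R y) \<le> \<Phi> * (a * norm x + b * norm y)"
      using \<Phi> ab norm_triangle_ineq[of "a *\<^sub>R x" "b *\<^sub>R y"] by simp
    also have "\<dots> = a * (\<Phi> * norm x) + b * (\<Phi> * norm y)" by (simp add: algebra_simps)
    also have "\<dots> < a * (w \<bullet> x) + b * (w \<bullet> y)"
    proof (cases "a = 0")
      case False
      then show ?thesis using x y ab by (intro add_less_le_mono mult_strict_left_mono mult_left_mono) (auto simp: V_def)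
    qed (use y ab in \<open>simp add: V_def\<close>)
    finally show "a *\<^sub>R x + b *\<^sub>R y \<in> V" by (simp add: V_def inner_simps)
  qed
  have ne: "z \<noteq> 0" if "z \<in> V" for z using that by (auto simp: V_def)
  define E where "E z = \<eta> (z /\<^sub>R norm z)" for z
  have "continuous_on V E"
    unfolding E_def
    by (intro continuous_on_compose2[OF cont] continuous_intros) (auto dest: ne)
  then have conn: "connected (E ` V)"
    using \<open>convex V\<close> by (intro connected_continuous_image convex_connected)
  \<comment> \<open>\<open>\<Phi> * t \<le> 1\<close> is what the inequality \<open>small\<close>
    needs, and \<open>t < \<delta>\<close> keeps both test points in the collar.\<close>
  define t where "t = min (\<delta> / 2) (1 / \<Phi>)"
  have t: "0 < t" "t < \<delta>" "\<Phi> * t \<le> 1" using \<delta> \<Phi> by (auto simp: t_def min_def field_simps)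
  have small: "\<Phi> * sqrt (1 + t\<^sup>2) < \<Phi> + t"
  proof -
    have "\<Phi> * (\<Phi> * t) \<le> \<Phi>" using t(3) \<Phi> by simp
    then have "0 < 2 * \<Phi> + t - \<Phi> * (\<Phi> * t)" using t(1) \<Phi> by linarith
    from mult_pos_pos[OF t(1) this] have "\<Phi>\<^sup>2 * (1 + t\<^sup>2) < (\<Phi> + t)\<^sup>2" by (simp add: power2_eq_square algebra_simps)
    then have "sqrt (\<Phi>\<^sup>2 * (1 + t\<^sup>2)) < \<Phi> + t" using \<Phi> t(1) by (intro real_less_lsqrt) auto
    then show ?thesis using \<Phi> by (simp add: real_sqrt_mult)
  qed
  have E_line: "E (f p' + u *\<^sub>R N p') = pi * u / \<delta>" if "\<bar>u\<bar> < \<delta>" for p' u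
    using \<eta>_tube[OF that, of p'] by (simp add: E_def norm_normal_line tube_def)
  \<comment> \<open>Two points of the ball on different sides of the surface: \<open>E\<close> is
    positive at this one and negative at the next. Hence \<open>E\<close> vanishes somewhere in
    \<open>V\<close>, at a point of the surface inside the ball.\<close>
  have "f p + t *\<^sub>R N p \<in> V"
    using small by (simp add: V_def norm_normal_line w inner_simps frame frame')
  moreover have "f r + (- t) *\<^sub>R N r \<in> V"
    using small norm_normal_line[of r "- t"] by (simp add: V_def inner_simps touch opposite)
  ultimately have "{E (f r + (- t) *\<^sub>R N r) .. E (f p + t *\<^sub>R N p)} \<subseteq> E ` V"
    using connected_contains_Icc[OF conn] by blast
  moreover have "E (f r + (- t) *\<^sub>R N r) \<le> 0" "0 \<le> E (f p + t *\<^sub>R N p)"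
    using t \<delta> by (subst E_line; simp)+
  ultimately obtain z where z: "z \<in> V" "E z = 0" by fastforce
  then obtain p' where p': "z /\<^sub>R norm z = f p'" using \<eta>_0[of "z /\<^sub>R norm z"] ne[OF z(1)] by (auto simp: E_def)
  have "w \<bullet> f p' = (w \<bullet> z) / norm z" unfolding p'[symmetric] by (simp add: divide_inverse)
  also have "\<dots> > \<Phi>" using z(1) ne[OF z(1)] by (simp add: V_def less_divide_eq)
  finally show False using le[of p'] by simp
qed

section \<open>First contact and the limit of balls\<close>

text \<open>The value of \<open>\<kappa>\<close> at which
  \<open>Z (\<Psi> \<kappa> \<delta>) p r\<close> vanishes. For a pair with
  \<open>f p \<bullet> f r \<noteq> 1\<close>, \<open>Z\<close> is non-negative exactly when
  \<open>\<kappa>\<close> is at least this value.\<close>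

definition ratio :: "real \<Rightarrow> (real \<times> real) \<times> (real \<times> real) \<Rightarrow> real" where
  "ratio \<delta> pr = ((N (fst pr) \<bullet> f (snd pr)) / (1 - f (fst pr) \<bullet> f (snd pr)) - H) / \<mu> (snd (fst pr))
     + \<delta> * (vd (snd (fst pr)))\<^sup>2"

lemma Z_ratio:
  assumes "f p \<bullet> f r \<noteq> 1"
  shows "Z (\<Psi> \<kappa> \<delta>) p r = (1 - f p \<bullet> f r) * \<mu> (snd p) * (\<kappa> - ratio \<delta> (p, r))"
  using assms \<mu>_pos[of "snd p"] by (simp add: Z_def \<Psi>_def \<omega>_def ratio_def field_simps)

text \<open>Near the diagonal \<open>Z\<close> is already non-negative, so a violation makes
  \<open>ratio\<close> exceed \<open>\<kappa>1\<close> on a compact set. Its maximum there is the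
  parameter of a first contact, where \<open>touching\<close> and \<open>supersolution\<close>
  contradict each other.\<close>

lemma barrier:
  assumes \<kappa>1: "1 < \<kappa>1"
  shows "0 \<le> Z (\<Psi> \<kappa>1 0) p r"
proof (rule ccontr)
  assume neg: "\<not> 0 \<le> Z (\<Psi> \<kappa>1 0) p r"
  \<comment> \<open>Any divisor of at least 17 satisfies the bound of
    \<open>supersolution\<close>.\<close>
  define \<delta> where "\<delta> = (\<kappa>1 - 1) / 40"
  have \<delta>: "0 < \<delta>" "1 + 17 * \<delta> \<le> \<kappa>1" "1 < \<kappa>1 - \<delta>" using \<kappa>1 by (simp_all add: \<delta>_def field_simps)
  have gap: "\<mu> y < \<Psi> \<kappa> \<delta> y" if "\<kappa>1 \<le> \<kappa>" for y \<kappa>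
  proof -
    have "1 < \<omega> \<kappa> \<delta> y" using \<omega>_ge[of \<delta> \<kappa> y] \<delta> that by simp
    then show ?thesis using \<mu>_pos[of y] by (simp add: \<Psi>_def)
  qed
  obtain \<epsilon> where \<epsilon>: "0 < \<epsilon>" and near: "\<And>p r. dist r p < \<epsilon> \<Longrightarrow> p \<noteq> r \<Longrightarrow> 0 < Z (\<Psi> \<kappa>1 \<delta>) p r"
    using uniform_near_diagonal[of "\<Psi> \<kappa>1 \<delta>", OF DERIV_\<Psi> DERIV_\<Psi>' gap[OF order_refl] \<Psi>_shift] by blast
  have near': "0 \<le> Z (\<Psi> \<kappa> \<delta>) p r" if g: "\<gamma> \<in> \<Gamma>" "dist r (p + \<gamma>) < \<epsilon>" and \<kappa>: "\<kappa>1 \<le> \<kappa>" for p r \<gamma> \<kappa>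
  proof -
    have "0 \<le> Z (\<Psi> \<kappa>1 \<delta>) (p + \<gamma>) r"
      using near[OF g(2)] by (cases "p + \<gamma> = r") (auto simp: Z_def frame frame')
    also have "\<dots> \<le> Z (\<Psi> \<kappa> \<delta>) (p + \<gamma>) r"
      using \<kappa> \<mu>_pos[of "snd (p + \<gamma>)"] by (intro Z_mono) (simp add: \<Psi>_def \<omega>_def)
    also have "\<dots> = Z (\<Psi> \<kappa> \<delta>) p r"
      using translate_Z_\<Psi>[OF g(1) \<Gamma>_0, of \<kappa> \<delta> p r] by simp
    finally show ?thesis .
  qed
  let ?K = "off_diagonal \<epsilon>"
  have K: "0 < 1 - f p \<bullet> f r" if "(p, r) \<in> ?K" for p r using off_diagonal_pos[OF \<epsilon> that] .
  \<comment> \<open>\<open>\<Psi>\<close> decreases when \<open>\<delta>\<close> grows, so the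
    perturbation preserves the violation.\<close>
  have Zneg: "Z (\<Psi> \<kappa>1 \<delta>) p r < 0"
  proof -
    have "Z (\<Psi> \<kappa>1 \<delta>) p r \<le> Z (\<Psi> \<kappa>1 0) p r"
      using \<mu>_pos[of "snd p"] \<delta> by (intro Z_mono) (simp add: \<Psi>_def \<omega>_def)
    then show ?thesis using neg by simp
  qed
  then have "\<not> (\<exists>\<gamma>\<in>\<Gamma>. dist r (p + \<gamma>) < \<epsilon>)" using near'[OF _ _ order_refl, of _ r p] by (meson not_le)
  then obtain \<gamma> \<gamma>' where g: "\<gamma> \<in> \<Gamma>" "\<gamma>' \<in> \<Gamma>" "(p + \<gamma>, r + \<gamma>') \<in> ?K" by (rule reduce_pair)
  have "Z (\<Psi> \<kappa>1 \<delta>) (p + \<gamma>) (r + \<gamma>') < 0" using Zneg translate_Z_\<Psi>[OF g(1,2)] by simp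
  then have big: "\<kappa>1 < ratio \<delta> (p + \<gamma>, r + \<gamma>')"
    using K[OF g(3)] \<mu>_pos[of "snd (p + \<gamma>)"] by (subst (asm) Z_ratio) (auto simp: mult_less_0_iff)
  have "continuous_on ?K (ratio \<delta>)"
    unfolding ratio_def using K \<mu>_pos
    by (intro continuous_intros continuous_on_compose2[OF continuous_frame(1)] continuous_on_compose2[OF continuous_frame(2)]
        continuous_on_compose2[OF continuous_profile(3)] continuous_on_compose2[OF continuous_profile(2)])
      (force simp: less_imp_neq[symmetric])+
  then obtain p1 r1 where pr1: "(p1, r1) \<in> ?K" and max: "\<And>pr. pr \<in> ?K \<Longrightarrow> ratio \<delta> pr \<le> ratio \<delta> (p1, r1)"
    using continuous_attains_sup[OF compact_off_diagonal, of \<epsilon> "ratio \<delta>"] g(3) by (metis empty_iff prod.exhaust)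
  define \<kappa> where "\<kappa> = ratio \<delta> (p1, r1)"
  have \<kappa>: "\<kappa>1 \<le> \<kappa>" using max[OF g(3)] big by (simp add: \<kappa>_def)
  have nonneg: "0 \<le> Z (\<Psi> \<kappa> \<delta>) p r" for p r
  proof (cases "\<exists>\<gamma>\<in>\<Gamma>. dist r (p + \<gamma>) < \<epsilon>")
    case True then show ?thesis using near' \<kappa> by blast
  next
    case False
    then obtain \<gamma> \<gamma>' where g: "\<gamma> \<in> \<Gamma>" "\<gamma>' \<in> \<Gamma>" "(p + \<gamma>, r + \<gamma>') \<in> ?K" by (rule reduce_pair)
    have "0 \<le> Z (\<Psi> \<kappa> \<delta>) (p + \<gamma>) (r + \<gamma>')"
      using K[OF g(3)] \<mu>_pos[of "snd (p + \<gamma>)"] max[OF g(3)]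
      by (subst Z_ratio) (auto simp: \<kappa>_def intro!: mult_nonneg_nonneg)
    then show ?thesis using translate_Z_\<Psi>[OF g(1,2)] by simp
  qed
  have zero: "Z (\<Psi> \<kappa> \<delta>) p1 r1 = 0" using K[OF pr1] by (subst Z_ratio) (auto simp: \<kappa>_def)
  have ne: "f p1 \<noteq> f r1" using K[OF pr1] frame(1)[of p1] by auto
  define \<Phi> where "\<Phi> = H + \<Psi> \<kappa> \<delta> (snd p1)"
  have "0 < \<Phi>" using H_nonneg gap[OF \<kappa>, of "snd p1"] \<mu>_pos[of "snd p1"] by (simp add: \<Phi>_def)
  then have "(\<Phi> *\<^sub>R f p1 + N p1) \<bullet> N r1 \<noteq> - 1"
  proof (rule same_side[OF _ refl])
    show "(\<Phi> *\<^sub>R f p1 + N p1) \<bullet> f z \<le> \<Phi>" for z using nonneg[of p1 z] by (simp add: Z_eq \<Phi>_def)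
    show "(\<Phi> *\<^sub>R f p1 + N p1) \<bullet> f r1 = \<Phi>" using zero by (simp add: Z_eq \<Phi>_def)
  qed
  then have "H = 0 \<or> ((H + \<Psi> \<kappa> \<delta> (snd p1)) *\<^sub>R f p1 + N p1) \<bullet> N r1 \<noteq> - 1" by (simp add: \<Phi>_def)
  moreover have "- \<mu> (snd p1) < \<Psi> \<kappa> \<delta> (snd p1)" using gap[OF \<kappa>, of "snd p1"] \<mu>_pos[of "snd p1"] by simp
  ultimately show False
    using touching[OF DERIV_\<Psi> DERIV_\<Psi>' nonneg zero ne gap[OF \<kappa>]]
      supersolution[OF k_pos H_nonneg \<delta>(1), of \<kappa> "snd p1" "\<rho> p1"] \<delta>(2) \<kappa> by linarith
qed

text \<open>The limit \<open>\<kappa> \<rightarrow> 1\<close> of \<open>barrier\<close> feeds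
  \<open>third_order_condition\<close>. If \<open>S \<noteq> 0\<close>, then \<open>v\<close> is
  constant, with \<open>v^2 = (1 + q^2) / 2\<close> by the second-order equation but
  \<open>v^2\<close> equal to 1 or \<open>q^2\<close> by the first-order one.\<close>

lemma principal_direction_horizontal: "S = 0"
proof (rule ccontr)
  assume S: "S \<noteq> 0"
  have "0 \<le> Z \<mu> p r" for p r
  proof (rule ccontr)
    assume neg: "\<not> 0 \<le> Z \<mu> p r"
    define c where "c = \<mu> (snd p) * (1 - f p \<bullet> f r)"
    have c: "0 \<le> c" using \<mu>_pos[of "snd p"] inner_f_le_1[of p r] by (simp add: c_def)
    \<comment> \<open>Raising \<open>\<kappa>\<close> from 1 to \<open>1 + e\<close> adds
      \<open>e * c\<close> to \<open>Z\<close>, which makes up for at most half of the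
      deficit.\<close>
    define e where "e = - Z \<mu> p r / (2 * (c + 1))"
    have e: "0 < e" unfolding e_def using neg c by (intro divide_pos_pos) auto
    have "Z (\<Psi> (1 + e) 0) p r = Z \<mu> p r + e * c"
      by (simp add: Z_def \<Psi>_def \<omega>_def c_def algebra_simps)
    moreover have "e * c \<le> e * (c + 1)" using e by simp
    moreover have "e * (c + 1) = - Z \<mu> p r / 2" using c by (simp add: e_def field_simps)
    moreover have "0 \<le> Z (\<Psi> (1 + e) 0) p r" using e by (intro barrier) simp
    ultimately show False using neg by linarith
  qed
  then have vd: "vd y = 0" for y using third_order_condition k_pos S by simp
  then have "vd = (\<lambda>_. 0)" by (simp add: fun_eq_iff)
  then have "v 0 * (1 + q\<^sup>2 - 2 * (v 0)\<^sup>2) = 0"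
    using DERIV_vd[of 0] DERIV_const[of 0 "at 0"] DERIV_unique by metis
  then have v2: "(v 0)\<^sup>2 = (1 + q\<^sup>2) / 2" using v_pos[of 0] by simp
  have "(1 - (v 0)\<^sup>2) * ((v 0)\<^sup>2 - q\<^sup>2) = 0" using vd_sq[of 0] vd by simp
  moreover have "1 - (v 0)\<^sup>2 = (1 - q\<^sup>2) / 2" "(v 0)\<^sup>2 - q\<^sup>2 = (1 - q\<^sup>2) / 2"
    unfolding v2 by (simp_all add: field_simps)
  ultimately show False using q by simp
qed

end

section \<open>Spectral genus one surfaces\<close>

lemma norm_cis_diff: "(norm (cis (2 * a) - cis (2 * b)))\<^sup>2 = 4 * (sin (a - b))\<^sup>2"
proof -
  have "(norm (cis (2 * a) - cis (2 * b)))\<^sup>2 = 2 - 2 * cos (2 * a - 2 * b)"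
    by (simp add: cmod_power2 cos_diff power2_diff sin_squared_eq)
  also have "cos (2 * a - 2 * b) = 1 - 2 * (sin (a - b))\<^sup>2"
    using cos_double_sin[of "a - b"] by (simp add: right_diff_distrib)
  finally show ?thesis by simp
qed

text \<open>The source of \<open>k_sq\<close>: the difference of the two inverses is a chord of the
  unit circle of length \<open>2 * |sin (a - b)|\<close>.\<close>

lemma norm_hopf_Q: "(norm (hopf_Q q (cis (2 * a)) (cis (2 * b))))\<^sup>2 = q\<^sup>2 * (sin (a - b))\<^sup>2"
proof -
  have "(norm (cis (2 * - b) - cis (2 * - a)))\<^sup>2 = 4 * (sin (a - b))\<^sup>2"
    using norm_cis_diff[of "- b" "- a"] by simp
  then show ?thesis
    by (simp add: hopf_Q_def norm_mult norm_divide power_mult_distrib power_divide cis_inverse)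
qed

lemma dn_profile:
  fixes q :: real
  assumes q: "q \<noteq> 0" "q\<^sup>2 < 1"
  defines "m \<equiv> 1 - q\<^sup>2"
  defines "v \<equiv> \<lambda>y. jacobi_dn y m" and "vd \<equiv> \<lambda>y. - m * sin (jacobi_am m y) * cos (jacobi_am m y)"
  shows "0 < v y" "v y \<le> 1" "(v has_real_derivative vd y) (at y)"
    "(vd has_real_derivative v y * (1 + q\<^sup>2 - 2 * (v y)\<^sup>2)) (at y)"
    "(vd y)\<^sup>2 = (1 - (v y)\<^sup>2) * ((v y)\<^sup>2 - q\<^sup>2)"
proof -
  have m: "0 \<le> m" "m < 1" and q2: "q\<^sup>2 = 1 - m" using q by (simp_all add: m_def)
  define a where "a = jacobi_am m y"
  have pos: "0 < 1 - m * (sin a)\<^sup>2" by (rule elliptic_integrand_pos[OF m])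
  have v: "v y = sqrt (1 - m * (sin a)\<^sup>2)" by (simp add: v_def jacobi_dn_def a_def)
  then have v2: "(v y)\<^sup>2 = 1 - m * (sin a)\<^sup>2" using pos by simp
  show "0 < v y" using pos v by simp
  show "v y \<le> 1" using m v by simp
  show "(v has_real_derivative vd y) (at y)"
    unfolding v_def vd_def by (rule jacobi_dn_has_derivative[OF m])
  have c2: "(cos a)\<^sup>2 = 1 - (sin a)\<^sup>2" by (rule cos_squared_eq)
  have "(vd has_real_derivative - m * ((cos a)\<^sup>2 - (sin a)\<^sup>2) * v y) (at y)"
    unfolding vd_def v_def a_def
    by (rule derivative_eq_intros jacobi_am_has_derivative[OF m] refl)+ (simp add: power2_eq_square algebra_simps)
  also have "- m * ((cos a)\<^sup>2 - (sin a)\<^sup>2) * v y = v y * (1 + q\<^sup>2 - 2 * (v y)\<^sup>2)"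
    unfolding v2 q2 c2 by (simp add: algebra_simps)
  finally show "(vd has_real_derivative v y * (1 + q\<^sup>2 - 2 * (v y)\<^sup>2)) (at y)" .
  have "(vd y)\<^sup>2 = m\<^sup>2 * (sin a)\<^sup>2 * (cos a)\<^sup>2" by (simp add: vd_def a_def power_mult_distrib)
  then show "(vd y)\<^sup>2 = (1 - (v y)\<^sup>2) * ((v y)\<^sup>2 - q\<^sup>2)"
    unfolding v2 q2 c2 by (simp add: algebra_simps power2_eq_square)
qed

text \<open>\<open>\<sigma> = \<plusminus>1\<close> is the choice of the unit normal, and \<open>(C, S)\<close> a principal direction.\<close>

lemma equivariant_cmc_surface_dn_surface:
  assumes q: "0 < \<bar>q\<bar>" "\<bar>q\<bar> < 1" and ne: "cis (2 * \<theta>1) \<noteq> cis (2 * \<theta>2)"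
    and surf: "equivariant_cmc_surface q \<theta>1 \<theta>2 f"
    and \<sigma>: "\<sigma> = 1 \<or> \<sigma> = (-1::real)"
    and CS: "C\<^sup>2 + S\<^sup>2 = 1"
    and principal: "of_real \<sigma> * hopf_Q q (cis (2 * \<theta>1)) (cis (2 * \<theta>2)) * (Complex C S)\<^sup>2 = of_real k"
  shows "\<exists>vd F1 F2 N. dn_surface q \<bar>sin (\<theta>1 - \<theta>2)\<bar> (\<sigma> * cot (\<theta>1 - \<theta>2)) k C S
    (\<lambda>y. jacobi_dn y (1 - q\<^sup>2)) vd f F1 F2 N"
proof -
  define v where "v y = jacobi_dn y (1 - q\<^sup>2)" for y
  define vd where "vd y = - (1 - q\<^sup>2) * sin (jacobi_am (1 - q\<^sup>2) y) * cos (jacobi_am (1 - q\<^sup>2) y)" for y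
  define s where "s = \<bar>sin (\<theta>1 - \<theta>2)\<bar>"
  define H where "H = \<sigma> * cot (\<theta>1 - \<theta>2)"
  define Q where "Q = of_real \<sigma> * hopf_Q q (cis (2 * \<theta>1)) (cis (2 * \<theta>2))"
  have q': "q \<noteq> 0" "q\<^sup>2 < 1" using q by (auto simp: abs_square_less_1)
  note prof = dn_profile[OF q', folded v_def vd_def]
  have \<sigma>2: "\<sigma>\<^sup>2 = 1" using \<sigma> by auto
  have s: "0 < s" using norm_cis_diff[of \<theta>1 \<theta>2] ne by (auto simp: s_def)
  have sH: "s\<^sup>2 * (1 + H\<^sup>2) = 1"
    using s by (simp add: s_def H_def power_mult_distrib \<sigma>2 cot_def power_divide field_simps)
  have k2: "k\<^sup>2 = q\<^sup>2 * s\<^sup>2"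
  proof -
    have "norm (Complex C S) = 1" using CS by (simp add: complex_norm)
    then have "(norm (Q * (Complex C S)\<^sup>2))\<^sup>2 = (norm Q)\<^sup>2" by (simp add: norm_mult norm_power)
    also have "\<dots> = q\<^sup>2 * s\<^sup>2"
      using \<sigma> by (auto simp: Q_def norm_mult norm_hopf_Q s_def)
    finally show ?thesis using principal by (simp add: Q_def)
  qed
  obtain N0 where imm: "immersion_S3 f" and N0: "unit_normal_S3 f N0"
    and I: "\<And>x y dx dy. first_form f (x, y) (dx, dy) = (sin (\<theta>1 - \<theta>2))\<^sup>2 * (v y)\<^sup>2 * (dx\<^sup>2 + dy\<^sup>2)"
    and II: "\<And>x y dx dy. second_form f N0 (x, y) (dx, dy) =
                cot (\<theta>1 - \<theta>2) * (sin (\<theta>1 - \<theta>2))\<^sup>2 * (v y)\<^sup>2 * (dx\<^sup>2 + dy\<^sup>2)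
                + Re (hopf_Q q (cis (2 * \<theta>1)) (cis (2 * \<theta>2)) * (Complex dx dy)\<^sup>2)"
    using surf unfolding equivariant_cmc_surface_def Let_def v_def by blast
  have C2: "C_k 2 f" "C_k 1 N0"
    using imm N0 unfolding immersion_S3_def unit_normal_S3_def smooth_map_def by blast+
  define D where "D p = frechet_derivative f (at p)" for p
  define D2 where "D2 u p = frechet_derivative (\<lambda>p. D p u) (at p)" for u p
  note der = C_k_2_derivatives[OF C2(1), folded D_def, folded D2_def]
  define N where "N p = \<sigma> *\<^sub>R N0 p" for p
  define u1 u2 where "u1 = (C, S)" and "u2 = (- S, C)"
  define F1 F2 where "F1 p = D p u1" and "F2 p = D p u2" for p
  have N0_diff: "N0 differentiable at p" for p using C2(2) unfolding One_nat_def C_k.simps by blast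
  define DN where "DN p = frechet_derivative N (at p)" for p
  have DN: "(N has_derivative DN p) (at p)" for p
    unfolding DN_def frechet_derivative_works[symmetric] N_def[abs_def]
    using N0_diff by (intro differentiable_scaleR differentiable_const)
  have DF1: "(F1 has_derivative D2 u1 p) (at p)" and DF2: "(F2 has_derivative D2 u2 p) (at p)"
    and Df: "(f has_derivative D p) (at p)" for p
    using der(1,2) by (simp_all add: F1_def[abs_def] F2_def[abs_def])
  define R where "R p = (s * v (snd p))\<^sup>2" for p :: "real \<times> real"
  have s2: "s\<^sup>2 = (sin (\<theta>1 - \<theta>2))\<^sup>2" by (simp add: s_def)
  have Dlin: "D p (h + h') = D p h + D p h'" "D p (t *\<^sub>R h) = t *\<^sub>R D p h" for p h h' t
    using linear_add[OF der(4)] linear_cmul[OF der(4)] by blast+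
  have I': "D p h \<bullet> D p h = R p * ((fst h)\<^sup>2 + (snd h)\<^sup>2)" for p h
    using I[of "fst p" "snd p" "fst h" "snd h"] by (simp add: first_form_def D_def R_def power_mult_distrib s2)
  have FF: "F1 p \<bullet> F1 p = R p" "F2 p \<bullet> F2 p = R p" "F1 p \<bullet> F2 p = 0" for p
  proof -
    show 1: "F1 p \<bullet> F1 p = R p" and 2: "F2 p \<bullet> F2 p = R p"
      using CS by (simp_all add: F1_def F2_def I' u1_def u2_def add.commute)
    have "(F1 p + F2 p) \<bullet> (F1 p + F2 p) = R p * ((C - S)\<^sup>2 + (S + C)\<^sup>2)"
      unfolding F1_def F2_def Dlin(1)[symmetric] I' by (simp add: u1_def u2_def)
    also have "(C - S)\<^sup>2 + (S + C)\<^sup>2 = 2" using CS by (simp add: power2_diff power2_sum)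
    finally show "F1 p \<bullet> F2 p = 0" using 1 2 by (simp add: inner_simps inner_commute)
  qed
  have II': "D2 h p h \<bullet> N p = H * R p * ((fst h)\<^sup>2 + (snd h)\<^sup>2) + Re (Q * (Complex (fst h) (snd h))\<^sup>2)" for p h
  proof -
    have "D2 h p h \<bullet> N p = \<sigma> * second_form f N0 (fst p, snd p) (fst h, snd h)"
      by (simp add: second_form_def D2_def D_def N_def)
    also have "\<dots> = H * R p * ((fst h)\<^sup>2 + (snd h)\<^sup>2)
        + \<sigma> * Re (hopf_Q q (cis (2 * \<theta>1)) (cis (2 * \<theta>2)) * (Complex (fst h) (snd h))\<^sup>2)"
      unfolding II by (simp add: H_def R_def s2 power_mult_distrib algebra_simps)
    finally show ?thesis by (simp add: Q_def mult.assoc)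
  qed
  have Qu: "Q * (Complex C S)\<^sup>2 = of_real k" using principal by (simp add: Q_def)
  \<comment> \<open>As complex numbers, \<open>u2\<close> and \<open>u1 + u2\<close> are
    \<open>\<i>\<close> and \<open>1 + \<i>\<close> times \<open>u1\<close>. The Hopf term is
    therefore \<open>- k\<close> at \<open>u2\<close> and 0 at \<open>u1 + u2\<close>, and
    polarization gives a diagonal second form.\<close>
  have u2c: "Complex (- S) C = \<i> * Complex C S" "Complex (C - S) (S + C) = (1 + \<i>) * Complex C S"
    by (simp_all add: complex_eq_iff)
  have f11N: "D2 u1 p u1 \<bullet> N p = H * R p + k" and f22N: "D2 u2 p u2 \<bullet> N p = H * R p - k" for p
  proof -
    show "D2 u1 p u1 \<bullet> N p = H * R p + k" unfolding II' using CS Qu by (simp add: u1_def)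
    have "Q * (Complex (- S) C)\<^sup>2 = - of_real k"
      unfolding u2c power_mult_distrib using Qu by simp
    then show "D2 u2 p u2 \<bullet> N p = H * R p - k" unfolding II' using CS by (simp add: u2_def add.commute)
  qed
  have sym: "D2 u2 p u1 = D2 u1 p u2" for p
    by (rule second_derivative_symmetric[OF der(1) der(2) der(2)])
      (use der(3) continuous_on_eq_continuous_at[OF open_UNIV] in blast)+
  have D2lin: "D2 h p (a + b) = D2 h p a + D2 h p b" for h p a b
    using linear_add[OF has_derivative_linear[OF der(2)]] by blast
  have f12N: "D2 u1 p u2 \<bullet> N p = 0" for p
  proof -
    have "D2 (u1 + u2) p (u1 + u2) \<bullet> N p = 2 * H * R p + 2 * (D2 u1 p u2 \<bullet> N p)"
      by (simp only: der(5) D2lin inner_add_left f11N f22N sym)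
    moreover have "Q * (Complex (C - S) (S + C))\<^sup>2 = 2 * \<i> * of_real k"
    proof -
      have "Q * (Complex (C - S) (S + C))\<^sup>2 = (1 + \<i>)\<^sup>2 * (Q * (Complex C S)\<^sup>2)"
        unfolding u2c power_mult_distrib by (simp add: mult_ac)
      then show ?thesis unfolding Qu by (simp add: power2_sum)
    qed
    moreover have "(C - S)\<^sup>2 + (S + C)\<^sup>2 = 2" using CS by (simp add: power2_diff power2_sum)
    ultimately show ?thesis using II'[of "u1 + u2" p] by (simp add: u1_def u2_def)
  qed
  have R: "0 < R p" for p using s prof(1)[of "snd p"] by (simp add: R_def)
  have N0': "norm (N0 p) = 1" "N0 p \<bullet> f p = 0" "N0 p \<bullet> D p X = 0" for p X
    using N0 unfolding unit_normal_S3_def D_def by blast+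
  have "norm (f p) = 1" for p using imm rangeI[of f p] unfolding immersion_S3_def by (metis mem_sphere_0 subsetD)
  then have ff: "f p \<bullet> f p = 1" for p by (simp add: norm_eq_1)
  have NN: "N p \<bullet> N p = 1" for p
    using N0'(1)[of p] \<sigma> by (auto simp: N_def norm_eq_1)
  have fN: "f p \<bullet> N p = 0" "N p \<bullet> f p = 0" for p using N0'(2)[of p] by (simp_all add: N_def inner_commute)
  have FN: "D p X \<bullet> N p = 0" for p X using N0'(3)[of p X] by (simp add: N_def inner_commute)
  have Ff: "D p h \<bullet> f p = 0" for p h
    using inner_derivative_eq[OF Df Df ff has_derivative_const, of p h] by (simp add: inner_commute)
  have NF: "N p \<bullet> D p X = 0" for p X using FN by (simp add: inner_commute)
  have Du: "D p u1 = F1 p" "D p u2 = F2 p" for p by (simp_all add: F1_def F2_def)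
  define A where "A p = s\<^sup>2 * v (snd p) * vd (snd p)" for p :: "real \<times> real"
  have DR: "(R has_derivative (\<lambda>h. 2 * A p * snd h)) (at p)" for p
  proof -
    have "((\<lambda>p. v (snd p)) has_derivative (\<lambda>h. vd (snd p) * snd h)) (at p)"
      using has_derivative_compose[OF has_derivative_snd[OF has_derivative_ident] prof(3)[unfolded has_field_derivative_def], of p]
      by simp
    from has_derivative_power[OF has_derivative_mult_right[OF this, of s], of 2] show ?thesis
      unfolding R_def[abs_def] by (rule has_derivative_eq_rhs) (simp add: A_def fun_eq_iff power2_eq_square)
  qed
  \<comment> \<open>Together with the symmetry \<open>sym\<close>, the derivatives of the metric
    coefficients determine all tangential components of the second derivatives.\<close>
  have d1: "D2 u1 p h \<bullet> F1 p = A p * snd h" "D2 u2 p h \<bullet> F2 p = A p * snd h"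
    "D2 u1 p h \<bullet> F2 p = - (D2 u2 p h \<bullet> F1 p)" for p h
    using inner_derivative_eq[OF DF1 DF1 FF(1) DR, of p h] inner_derivative_eq[OF DF2 DF2 FF(2) DR, of p h]
      inner_derivative_eq[OF DF1 DF2 FF(3) has_derivative_const, of p h]
    by (simp_all add: inner_commute)
  have Ff': "F1 p \<bullet> f p = 0" "F2 p \<bullet> f p = 0" for p using Ff by (simp_all add: F1_def F2_def)
  have FN': "F1 p \<bullet> N p = 0" "F2 p \<bullet> N p = 0" for p using FN by (simp_all add: F1_def F2_def)
  have d2: "D2 u1 p h \<bullet> f p = - (F1 p \<bullet> D p h)" "D2 u2 p h \<bullet> f p = - (F2 p \<bullet> D p h)" for p h
    using inner_derivative_eq[OF DF1 Df Ff'(1) has_derivative_const, of p h]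
      inner_derivative_eq[OF DF2 Df Ff'(2) has_derivative_const, of p h]
    by simp_all
  have d3: "DN p h \<bullet> F1 p = - (D2 u1 p h \<bullet> N p)" "DN p h \<bullet> F2 p = - (D2 u2 p h \<bullet> N p)"
    "DN p h \<bullet> N p = 0" "DN p h \<bullet> f p = 0" for p h
    using inner_derivative_eq[OF DF1 DN FN'(1) has_derivative_const, of p h]
      inner_derivative_eq[OF DF2 DN FN'(2) has_derivative_const, of p h]
      inner_derivative_eq[OF DN DN NN has_derivative_const, of p h]
      inner_derivative_eq[OF DN Df fN(2) has_derivative_const, of p h] NF[of p h]
    by (simp_all add: inner_commute)
  note expand = orthogonal_expand_real4[OF ff NN FF(1,2) R fN(1) Ff' FN' FF(3)]
  have FF': "F2 p \<bullet> F1 p = 0" for p using FF(3) by (simp add: inner_commute)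
  have snd_u: "snd u1 = S" "snd u2 = C" by (simp_all add: u1_def u2_def)
  have AR: "t * A p / R p = t * vd (snd p) / v (snd p)" for p t
    using s prof(1)[of "snd p"] by (simp add: A_def R_def power2_eq_square)
  have f11: "D2 u1 p u1 = (vd (snd p) / v (snd p)) *\<^sub>R (S *\<^sub>R F1 p - C *\<^sub>R F2 p)
      + (H * R p + k) *\<^sub>R N p - R p *\<^sub>R f p" for p
    using expand[of "D2 u1 p u1" p] d1(1)[of p u1] d1(3)[of p u1] d1(1)[of p u2]
    by (simp add: d2 Du FF FF' f11N sym snd_u AR algebra_simps)
  have f12: "D2 u1 p u2 = (vd (snd p) / v (snd p)) *\<^sub>R (C *\<^sub>R F1 p + S *\<^sub>R F2 p)" for p
    using expand[of "D2 u1 p u2" p] d1(1)[of p u2] d1(2)[of p u1]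
    by (simp add: d2 Du FF FF' f12N sym snd_u AR algebra_simps)
  have f22: "D2 u2 p u2 = (vd (snd p) / v (snd p)) *\<^sub>R (C *\<^sub>R F2 p - S *\<^sub>R F1 p)
      + (H * R p - k) *\<^sub>R N p - R p *\<^sub>R f p" for p
  proof -
    have "D2 u2 p u2 \<bullet> F1 p = - (S * A p)"
      using d1(3)[of p u2] d1(2)[of p u1] by (simp add: sym snd_u mult.commute)
    then show ?thesis using expand[of "D2 u2 p u2" p] d1(2)[of p u2]
      by (simp add: d2 Du FF FF' f22N sym snd_u AR algebra_simps)
  qed
  have N1: "DN p u1 = (- (H + k / R p)) *\<^sub>R F1 p" and N2: "DN p u2 = (- (H - k / R p)) *\<^sub>R F2 p" for p
    using expand[of "DN p u1" p] expand[of "DN p u2" p] R[of p]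
    by (simp_all add: d3 f11N f22N f12N sym add_divide_distrib diff_divide_distrib)
  have h: "h = (C * fst h + S * snd h) *\<^sub>R u1 + (C * snd h - S * fst h) *\<^sub>R u2" for h
  proof -
    have "h = (C\<^sup>2 + S\<^sup>2) *\<^sub>R h" using CS by simp
    then show ?thesis by (cases h) (simp add: u1_def u2_def power2_eq_square algebra_simps)
  qed
  have lin: "L h = (C * fst h + S * snd h) *\<^sub>R L u1 + (C * snd h - S * fst h) *\<^sub>R L u2"
    if "linear L" for L :: "real \<times> real \<Rightarrow> real^4" and h
    by (subst h) (simp add: linear_add[OF that] linear_cmul[OF that])
  have "dn_surface q s H k C S v vd f F1 F2 N"
  proof unfold_locales
    show "(f has_derivative (\<lambda>h. (C * fst h + S * snd h) *\<^sub>R F1 p + (C * snd h - S * fst h) *\<^sub>R F2 p)) (at p)" for p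
      by (rule has_derivative_eq_rhs[OF Df]) (rule ext, subst lin[OF der(4)], simp only: Du)
    show "(N has_derivative (\<lambda>h.
         (C * fst h + S * snd h) *\<^sub>R (- (H + k / (s * v (snd p))\<^sup>2)) *\<^sub>R F1 p
         + (C * snd h - S * fst h) *\<^sub>R (- (H - k / (s * v (snd p))\<^sup>2)) *\<^sub>R F2 p)) (at p)" for p
      by (rule has_derivative_eq_rhs[OF DN]) (rule ext, subst lin[OF has_derivative_linear[OF DN]], simp only: N1 N2 R_def)
    show "(F1 has_derivative (\<lambda>h.
         (C * fst h + S * snd h) *\<^sub>R ((vd (snd p) / v (snd p)) *\<^sub>R (S *\<^sub>R F1 p - C *\<^sub>R F2 p)
            + (H * (s * v (snd p))\<^sup>2 + k) *\<^sub>R N p - (s * v (snd p))\<^sup>2 *\<^sub>R f p)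
         + (C * snd h - S * fst h) *\<^sub>R ((vd (snd p) / v (snd p)) *\<^sub>R (C *\<^sub>R F1 p + S *\<^sub>R F2 p)))) (at p)" for p
      by (rule has_derivative_eq_rhs[OF DF1])
        (rule ext, subst lin[OF has_derivative_linear[OF DF1]], simp only: f11 f12 R_def)
    show "(F2 has_derivative (\<lambda>h.
         (C * fst h + S * snd h) *\<^sub>R ((vd (snd p) / v (snd p)) *\<^sub>R (C *\<^sub>R F1 p + S *\<^sub>R F2 p))
         + (C * snd h - S * fst h) *\<^sub>R ((vd (snd p) / v (snd p)) *\<^sub>R (C *\<^sub>R F2 p - S *\<^sub>R F1 p)
            + (H * (s * v (snd p))\<^sup>2 - k) *\<^sub>R N p - (s * v (snd p))\<^sup>2 *\<^sub>R f p))) (at p)" for p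
      by (rule has_derivative_eq_rhs[OF DF2])
        (rule ext, subst lin[OF has_derivative_linear[OF DF2]], simp only: sym f12 f22 R_def)
  qed (use q' CS s sH k2 prof ff NN fN Ff' FN' FF in \<open>simp_all add: R_def\<close>)
  then show ?thesis unfolding v_def[abs_def] s_def H_def by blast
qed

section \<open>Lattices and conclusion\<close>

lemma plane_lattice_group:
  assumes "plane_lattice \<Gamma>"
  shows "0 \<in> \<Gamma>" "\<alpha> \<in> \<Gamma> \<Longrightarrow> - \<alpha> \<in> \<Gamma>" "\<alpha> \<in> \<Gamma> \<Longrightarrow> \<beta> \<in> \<Gamma> \<Longrightarrow> \<alpha> + \<beta> \<in> \<Gamma>"
proof -
  obtain a b where G: "\<Gamma> = {of_int m *\<^sub>R a + of_int n *\<^sub>R b | m n :: int. True}"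
    using assms unfolding plane_lattice_def by blast
  have mem: "of_int m *\<^sub>R a + of_int n *\<^sub>R b \<in> \<Gamma>" for m n unfolding G by blast
  show "0 \<in> \<Gamma>" using mem[of 0 0] by simp
  show "- \<alpha> \<in> \<Gamma>" if \<alpha>: "\<alpha> \<in> \<Gamma>"
  proof -
    obtain m n where "\<alpha> = of_int m *\<^sub>R a + of_int n *\<^sub>R b" using \<alpha> unfolding G by blast
    then show ?thesis using mem[of "- m" "- n"] by simp
  qed
  show "\<alpha> + \<beta> \<in> \<Gamma>" if ab: "\<alpha> \<in> \<Gamma>" "\<beta> \<in> \<Gamma>"
  proof -
    obtain m n m' n' where "\<alpha> = of_int m *\<^sub>R a + of_int n *\<^sub>R b" "\<beta> = of_int m' *\<^sub>R a + of_int n' *\<^sub>R b"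
      using ab unfolding G by blast
    then show ?thesis using mem[of "m + m'" "n + n'"] by (simp add: algebra_simps)
  qed
qed

text \<open>The closed parallelogram spanned by the lattice basis; the period subtracts the integer
  parts of the coordinates.\<close>

lemma plane_lattice_fundamental_domain:
  assumes "plane_lattice \<Gamma>"
  obtains P where "compact P" "\<And>p. \<exists>\<gamma>\<in>\<Gamma>. p + \<gamma> \<in> P"
proof -
  obtain a b :: "real \<times> real" where ab: "a \<noteq> b" "independent {a, b}"
    and G: "\<Gamma> = {of_int m *\<^sub>R a + of_int n *\<^sub>R b | m n :: int. True}"
    using assms unfolding plane_lattice_def by blast
  define g where "g c = fst c *\<^sub>R a + snd c *\<^sub>R b" for c :: "real \<times> real"
  show thesis
  proof (rule that)
    show "compact (g ` (cbox (0, 0) (1, 1)))"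
      unfolding g_def by (intro compact_continuous_image continuous_intros compact_cbox)
    have "span {a, b} = UNIV"
      using card_ge_dim_independent[of "{a, b}" UNIV] ab by (simp add: dim_UNIV) blast
    show "\<exists>\<gamma>\<in>\<Gamma>. p + \<gamma> \<in> g ` (cbox (0, 0) (1, 1))" for p
    proof -
      have "p \<in> span {a, b}" using \<open>span _ = UNIV\<close> by simp
      then obtain \<alpha> \<beta> where p: "p = \<alpha> *\<^sub>R a + \<beta> *\<^sub>R b"
        by (auto simp: span_breakdown_eq algebra_simps)
      have "p + (of_int (- \<lfloor>\<alpha>\<rfloor>) *\<^sub>R a + of_int (- \<lfloor>\<beta>\<rfloor>) *\<^sub>R b) = g (frac \<alpha>, frac \<beta>)"
        by (simp add: p g_def frac_def algebra_simps)
      moreover have "(frac \<alpha>, frac \<beta>) \<in> cbox (0, 0) (1, 1)"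
        using frac_lt_1[of \<alpha>] frac_lt_1[of \<beta>] by (simp add: cbox_Pair_eq less_imp_le)
      ultimately show ?thesis unfolding G by blast
    qed
  qed
qed

theorem corollary5p5:
  fixes q \<theta>1 \<theta>2 :: real
    and f :: "real \<times> real \<Rightarrow> real^4"
    and \<Gamma> :: "(real \<times> real) set"
    and F :: "(real \<times> real) set \<Rightarrow> real^4"
  assumes "0 < \<bar>q\<bar>" and "\<bar>q\<bar> < 1"
    and "cis (2 * \<theta>1) \<noteq> cis (2 * \<theta>2)"
    and "equivariant_cmc_surface q \<theta>1 \<theta>2 f"
    and "plane_lattice \<Gamma>"
    and "f = F \<circ> plane_coset \<Gamma>"
    and "\<not> rotational f"
  shows "\<not> embedding_map (torus \<Gamma>) (top_of_set (sphere 0 1)) F"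
proof
  assume emb: "embedding_map (torus \<Gamma>) (top_of_set (sphere 0 1)) F"
  define Q where "Q = hopf_Q q (cis (2 * \<theta>1)) (cis (2 * \<theta>2))"
  note to_dn_surface = equivariant_cmc_surface_dn_surface[OF assms(1-4), folded Q_def]
  \<comment> \<open>If \<open>Q\<close> is real, the \<open>x\<close>-axis is a principal direction
    and \<open>rotational_if_x_principal\<close> applies with \<open>k = Re Q\<close>, of either
    sign.\<close>
  have "Im Q \<noteq> 0"
  proof
    assume "Im Q = 0"
    then have "of_real 1 * Q * (Complex 1 0)\<^sup>2 = of_real (Re Q)"
      by (simp add: complex_eq_iff flip: one_complex.code)
    then obtain vd F1 F2 N where "dn_surface q \<bar>sin (\<theta>1 - \<theta>2)\<bar> (1 * cot (\<theta>1 - \<theta>2)) (Re Q) 1 0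
        (\<lambda>y. jacobi_dn y (1 - q\<^sup>2)) vd f F1 F2 N"
      using to_dn_surface[of 1 1 0 "Re Q"] by auto
    then show False using dn_surface.rotational_if_x_principal assms(7) by blast
  qed
  define \<sigma> :: real where "\<sigma> = (if 0 \<le> cot (\<theta>1 - \<theta>2) then 1 else - 1)"
  have \<sigma>: "\<sigma> = 1 \<or> \<sigma> = - 1" "0 \<le> \<sigma> * cot (\<theta>1 - \<theta>2)" by (auto simp: \<sigma>_def)
  define k where "k = norm (of_real \<sigma> * Q)"
  \<comment> \<open>Turning \<open>dx + i dy\<close> by \<open>\<tau>\<close> makes the coefficient
    of the Hopf differential positive, so \<open>(cos \<tau>, sin \<tau>)\<close> points in the
    direction of the larger principal curvature.\<close>
  define \<tau> where "\<tau> = - Arg (of_real \<sigma> * Q) / 2"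
  have k: "0 < k" using \<open>Im Q \<noteq> 0\<close> \<sigma>(1) by (auto simp: k_def norm_mult)
  have polar: "of_real \<sigma> * Q = of_real k * cis (- 2 * \<tau>)"
    using rcis_cmod_Arg[of "of_real \<sigma> * Q"] by (simp add: rcis_def k_def \<tau>_def)
  have "(Complex (cos \<tau>) (sin \<tau>))\<^sup>2 = cis (2 * \<tau>)"
    by (simp flip: cis.code add: power2_eq_square cis_mult)
  then have principal: "of_real \<sigma> * Q * (Complex (cos \<tau>) (sin \<tau>))\<^sup>2 = of_real k"
    unfolding polar by (simp add: cis_mult)
  \<comment> \<open>\<open>\<tau>\<close> is an integer multiple of \<open>pi\<close> only if the
    Hopf differential is real.\<close>
  have sin: "sin \<tau> \<noteq> 0"
  proof
    assume "sin \<tau> = 0"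
    then have "Im (of_real \<sigma> * Q) = 0"
      unfolding polar using sin_double[of \<tau>] by simp
    then show False using \<open>Im Q \<noteq> 0\<close> \<sigma>(1) by auto
  qed
  obtain vd F1 F2 N where surface: "dn_surface q \<bar>sin (\<theta>1 - \<theta>2)\<bar> (\<sigma> * cot (\<theta>1 - \<theta>2)) k (cos \<tau>) (sin \<tau>)
      (\<lambda>y. jacobi_dn y (1 - q\<^sup>2)) vd f F1 F2 N"
    using to_dn_surface[OF \<sigma>(1) _ principal] by auto
  obtain P where P: "compact P" "\<And>p. \<exists>\<gamma>\<in>\<Gamma>. p + \<gamma> \<in> P"
    using plane_lattice_fundamental_domain[OF assms(5)] by blast
  note group = plane_lattice_group[OF assms(5)]
  have "plane_coset \<Gamma> (p + \<gamma>) = plane_coset \<Gamma> p" if \<gamma>: "\<gamma> \<in> \<Gamma>" for p \<gamma>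
  proof (intro equalityI subsetI)
    fix z assume "z \<in> plane_coset \<Gamma> (p + \<gamma>)"
    then obtain \<beta> where "\<beta> \<in> \<Gamma>" "z = p + (\<gamma> + \<beta>)" by (auto simp: plane_coset_def add.assoc)
    then show "z \<in> plane_coset \<Gamma> p" using group(3)[OF \<gamma>] by (auto simp: plane_coset_def)
  next
    fix z assume "z \<in> plane_coset \<Gamma> p"
    then obtain \<beta> where "\<beta> \<in> \<Gamma>" "z = p + \<gamma> + (- \<gamma> + \<beta>)" by (auto simp: plane_coset_def add.assoc)
    then show "z \<in> plane_coset \<Gamma> (p + \<gamma>)"
      unfolding plane_coset_def using group(3)[OF group(2)[OF \<gamma>]] by blast
  qed
  then have per: "f (p + \<gamma>) = f p" if "\<gamma> \<in> \<Gamma>" for p \<gamma> using that by (simp add: assms(6))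
  have inj: "r - p \<in> \<Gamma>" if "f p = f r" for p r
  proof -
    have inj_F: "inj_on F (range (plane_coset \<Gamma>))"
      using emb homeomorphic_imp_injective_map unfolding embedding_map_def topspace_torus[symmetric] by blast
    have "plane_coset \<Gamma> p = plane_coset \<Gamma> r"
      by (rule inj_onD[OF inj_F]) (use that in \<open>simp_all add: assms(6)\<close>)
    moreover have "r \<in> plane_coset \<Gamma> r" using group(1) by (force simp: plane_coset_def)
    ultimately have "r \<in> plane_coset \<Gamma> p" by simp
    then show ?thesis by (auto simp: plane_coset_def)
  qed
  interpret dn_surface q "\<bar>sin (\<theta>1 - \<theta>2)\<bar>" "\<sigma> * cot (\<theta>1 - \<theta>2)" k "cos \<tau>" "sin \<tau>"
    "\<lambda>y. jacobi_dn y (1 - q\<^sup>2)" vd f F1 F2 N by (rule surface)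
  interpret embedded_dn_surface q "\<bar>sin (\<theta>1 - \<theta>2)\<bar>" "\<sigma> * cot (\<theta>1 - \<theta>2)" k "cos \<tau>" "sin \<tau>"
    "\<lambda>y. jacobi_dn y (1 - q\<^sup>2)" vd f F1 F2 N \<Gamma> P
  proof unfold_locales
    show "jacobi_dn (y + snd \<gamma>) (1 - q\<^sup>2) = jacobi_dn y (1 - q\<^sup>2)" "N (p + \<gamma>) = N p" if "\<gamma> \<in> \<Gamma>" for p y \<gamma>
      using f_periodic_imp_v_N_periodic[of \<gamma>] per[OF that] k by auto
  qed (use k \<sigma>(2) group P per inj in auto)
  show False using principal_direction_horizontal sin by simp
qed

end
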